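(* Let $S_0=0$ and $S_j=\sum_{i=1}^jX_i$ for $j\ge1$, where $X_1,X_2,\ldots$ are independent random variables with common continuous distribution that has a well defined mean $\mu:=\mathbb{E}(X_1)\in[-\infty,\infty)$. Let $S^{[0,\infty)}=\{(j,S_j):j\ge0\}$. Let $0=T_0<T_1<T_2<\cdots$ be the successive times that $S^{[0,\infty)}$ meets its concave majorant, and let $N_i=T_i-T_{i-1}$ for $i\ge1$. Then the sequence of path segments $$\{(S_{T_i+k}-S_{T_i},\ 0\le k\le N_{i+1}),\ i=0,1,2,\ldots\}$$ is a list of the points of a Poisson point process in the space of finite random walk segments $$\{(s_1,\ldots,s_j)\text{ for some }j=1,2,\ldots\}$$ whose intensity measure on paths of length $j$ is $j^{-1}$ times the restriction to $S_j\in(j\mu,\infty)$ of the conditional distribution of $(S_1,\ldots,S_j)$ given that $S_k<(k/j)S_j$ for all $1\le k<j$.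
   Context: The concave majorant of $S^{[0,\infty)}$ is the least concave function $C$ on $[0,\infty)$ with $C(j)\ge S_j$ for all integers $j\ge0$. A path segment $(s_0,s_1,\ldots,s_j)$ with $s_0=0$ is identified with $(s_1,\ldots,s_j)$ and has length $j$. "Restriction" means that the conditional distribution is restricted as a measure (without renormalization) to the set of paths whose end value $s_j$ lies in $(j\mu,\infty)$. "Continuous distribution" means a distribution without atoms. *)

theory Defs
  imports "HOL-Probability.Probability"
begin

section \<open>Extended-real means\<close>

text \<open>In the integrals below \<^const>\<open>ennreal\<close> truncates negative values to \<open>0\<close>, so they are the
  integrals of the positive and the negative part.\<close>

definition has_ext_mean :: "'a measure \<Rightarrow> ('a \<Rightarrow> real) \<Rightarrow> bool" where
  "has_ext_mean M f \<longleftrightarrow> f \<in> borel_measurable M \<and>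
     ((\<integral>\<^sup>+ \<omega>. ennreal (f \<omega>) \<partial>M) < \<infinity> \<or> (\<integral>\<^sup>+ \<omega>. ennreal (- f \<omega>) \<partial>M) < \<infinity>)"

definition ext_mean :: "'a measure \<Rightarrow> ('a \<Rightarrow> real) \<Rightarrow> ereal" where
  "ext_mean M f =
     enn2ereal (\<integral>\<^sup>+ \<omega>. ennreal (f \<omega>) \<partial>M) - enn2ereal (\<integral>\<^sup>+ \<omega>. ennreal (- f \<omega>) \<partial>M)"


section \<open>Walks and concave majorants\<close>

definition walk :: "(nat \<Rightarrow> 'a \<Rightarrow> real) \<Rightarrow> 'a \<Rightarrow> nat \<Rightarrow> real" where
  "walk X \<omega> n = (\<Sum>i = 1..n. X i \<omega>)"

text \<open>Only the values of \<open>C\<close> on \<open>[0, \<infinity>)\<close> are relevant.\<close>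

definition is_concave_majorant :: "(nat \<Rightarrow> real) \<Rightarrow> (real \<Rightarrow> real) \<Rightarrow> bool" where
  "is_concave_majorant s C \<longleftrightarrow>
     (concave_on {0..} C \<and> (\<forall>j. s j \<le> C (real j))) \<and>
     (\<forall>D. concave_on {0..} D \<and> (\<forall>j. s j \<le> D (real j)) \<longrightarrow> (\<forall>x\<ge>0. C x \<le> D x))"

definition contact_times :: "(nat \<Rightarrow> real) \<Rightarrow> nat set" where
  "contact_times s = {j. \<exists>C. is_concave_majorant s C \<and> s j = C (real j)}"

text \<open>The contact times in increasing order; meaningful when there are infinitely many of them.\<close>

definition contact_time :: "(nat \<Rightarrow> real) \<Rightarrow> nat \<Rightarrow> nat" where
  "contact_time s i = enumerate (contact_times s) i"

text \<open>A segment \<open>(0, s\<^sub>1, \<dots>, s\<^sub>j)\<close> is encoded as the list \<open>[s\<^sub>1, \<dots>, s\<^sub>j]\<close>.\<close>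

definition face_segment :: "(nat \<Rightarrow> real) \<Rightarrow> nat \<Rightarrow> real list" where
  "face_segment s i =
     (let a = contact_time s i; N = contact_time s (Suc i) - a
      in map (\<lambda>k. s (a + k) - s a) [1..<Suc N])"


section \<open>The space of finite walk segments\<close>

text \<open>The disjoint union of the spaces \<open>\<real>\<^sup>j\<close>, \<open>j \<ge> 1\<close>: the generators are the measurable boxes
  \<open>B\<^sub>1 \<times> \<dots> \<times> B\<^sub>j\<close>, each consisting of lists of one fixed length \<open>j\<close>.\<close>

definition segment_space :: "real list measure" where
  "segment_space = sigma {xs. xs \<noteq> []} {listset Bs | Bs. Bs \<noteq> [] \<and> set Bs \<subseteq> sets borel}"


section \<open>Lists of the points of a Poisson point process\<close>

definition point_count :: "(nat \<Rightarrow> 'a \<Rightarrow> 'b) \<Rightarrow> 'b set \<Rightarrow> 'a \<Rightarrow> ennreal" where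
  "point_count Z A \<omega> = emeasure (count_space UNIV) {i. Z i \<omega> \<in> A}"

text \<open>The points are random elements of the space of \<open>\<nu>\<close>, defined up to a null set; the counts of
  measurable sets are Poisson with mean given by \<open>\<nu>\<close> (almost surely infinite where \<open>\<nu>\<close> is), and
  independent over disjoint sets. The Poisson weights are spelled out since \<^const>\<open>poisson_pmf\<close>
  is specified for positive rates only.\<close>

definition lists_poisson_process ::
    "'a measure \<Rightarrow> 'b measure \<Rightarrow> (nat \<Rightarrow> 'a \<Rightarrow> 'b) \<Rightarrow> bool" where
  "lists_poisson_process M \<nu> Z \<longleftrightarrow>
     (\<forall>i. (AE \<omega> in M. Z i \<omega> \<in> space \<nu>) \<and> (\<forall>A\<in>sets \<nu>. {\<omega> \<in> space M. Z i \<omega> \<in> A} \<in> sets M)) \<and>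
     (\<forall>A\<in>sets \<nu>. emeasure \<nu> A < \<infinity> \<longrightarrow>
        (\<forall>k::nat. measure M {\<omega> \<in> space M. point_count Z A \<omega> = of_nat k} =
           measure \<nu> A ^ k / fact k * exp (- measure \<nu> A))) \<and>
     (\<forall>A\<in>sets \<nu>. emeasure \<nu> A = \<infinity> \<longrightarrow> (AE \<omega> in M. point_count Z A \<omega> = \<infinity>)) \<and>
     (\<forall>(n::nat) A. (\<forall>i<n. A i \<in> sets \<nu>) \<and> disjoint_family_on A {..<n} \<longrightarrow>
        prob_space.indep_vars M (\<lambda>_. borel) (\<lambda>i. point_count Z (A i)) {..<n})"


section \<open>The intensity measure\<close>

definition below_chord :: "'a measure \<Rightarrow> (nat \<Rightarrow> 'a \<Rightarrow> real) \<Rightarrow> nat \<Rightarrow> 'a set" where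
  "below_chord M X j =
     {\<omega> \<in> space M. \<forall>k. 1 \<le> k \<and> k < j \<longrightarrow> walk X \<omega> k < (real k / real j) * walk X \<omega> j}"

definition chord_law :: "'a measure \<Rightarrow> (nat \<Rightarrow> 'a \<Rightarrow> real) \<Rightarrow> nat \<Rightarrow> real list measure" where
  "chord_law M X j =
     distr (uniform_measure M (below_chord M X j)) segment_space (\<lambda>\<omega>. map (walk X \<omega>) [1..<Suc j])"

definition steep_segments :: "ereal \<Rightarrow> nat \<Rightarrow> real list set" where
  "steep_segments \<mu> j = {xs. length xs = j \<and> ereal (real j) * \<mu> < ereal (last xs)}"

definition face_intensity_on ::
    "'a measure \<Rightarrow> (nat \<Rightarrow> 'a \<Rightarrow> real) \<Rightarrow> ereal \<Rightarrow> nat \<Rightarrow> real list measure" where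
  "face_intensity_on M X \<mu> j =
     scale_measure (ennreal (1 / real j)) (density (chord_law M X j) (indicator (steep_segments \<mu> j)))"

text \<open>The sum over all lengths \<open>j \<ge> 1\<close>.\<close>

definition face_intensity ::
    "'a measure \<Rightarrow> (nat \<Rightarrow> 'a \<Rightarrow> real) \<Rightarrow> ereal \<Rightarrow> real list measure" where
  "face_intensity M X \<mu> =
     measure_of (space segment_space) (sets segment_space)
       (\<lambda>A. \<Sum>j. emeasure (face_intensity_on M X \<mu> (Suc j)) A)"

text \<open>The remaining lemmas check that the measures above have the values they are meant to have.\<close>

lemma listset_iff: "xs \<in> listset Bs \<longleftrightarrow> length xs = length Bs \<and> (\<forall>i<length Bs. xs ! i \<in> Bs ! i)"
proof (induction Bs arbitrary: xs)
  case (Cons B Bs)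
  show ?case
    by (cases xs) (auto simp: set_Cons_def Cons.IH nth_Cons less_Suc_eq_0_disj split: nat.splits)
qed simp

lemma segment_generators: "{listset Bs | Bs. Bs \<noteq> [] \<and> set Bs \<subseteq> sets borel} \<subseteq> Pow {xs. xs \<noteq> []}"
  by (auto simp: listset_iff)

lemma space_segment_space: "space segment_space = {xs. xs \<noteq> []}"
  unfolding segment_space_def by (rule space_measure_of[OF segment_generators])

lemma sets_segment_space: "sets segment_space =
    sigma_sets {xs. xs \<noteq> []} {listset Bs | Bs. Bs \<noteq> [] \<and> set Bs \<subseteq> sets borel}"
  unfolding segment_space_def by (rule sets_measure_of[OF segment_generators])

lemma sets_face_intensity_on [simp]: "sets (face_intensity_on M X \<mu> j) = sets segment_space"
  by (simp add: face_intensity_on_def chord_law_def)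

lemma sets_face_intensity [simp]: "sets (face_intensity M X \<mu>) = sets segment_space"
  by (simp add: face_intensity_def)

lemma space_face_intensity [simp]: "space (face_intensity M X \<mu>) = space segment_space"
  by (simp add: face_intensity_def)

lemma emeasure_face_intensity:
  assumes "A \<in> sets segment_space"
  shows "emeasure (face_intensity M X \<mu>) A = (\<Sum>j. emeasure (face_intensity_on M X \<mu> (Suc j)) A)"
  unfolding face_intensity_def
proof (rule emeasure_measure_of_sigma)
  show "sigma_algebra (space segment_space) (sets segment_space)" ..
  show "positive (sets segment_space) (\<lambda>A. \<Sum>j. emeasure (face_intensity_on M X \<mu> (Suc j)) A)"
    by (simp add: positive_def)
  show "countably_additive (sets segment_space)
      (\<lambda>A. \<Sum>j. emeasure (face_intensity_on M X \<mu> (Suc j)) A)"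
  proof (rule countably_additiveI)
    fix F :: "nat \<Rightarrow> real list set"
    assume F: "range F \<subseteq> sets segment_space" "disjoint_family F"
    let ?e = "\<lambda>i j. emeasure (face_intensity_on M X \<mu> (Suc j)) (F i)"
    have "(\<Sum>i. \<Sum>j. ?e i j) = (\<integral>\<^sup>+ i. (\<Sum>j. ?e i j) \<partial>count_space UNIV)"
      by (simp add: nn_integral_count_space_nat)
    also have "\<dots> = (\<Sum>j. \<integral>\<^sup>+ i. ?e i j \<partial>count_space UNIV)"
      by (rule nn_integral_suminf) simp
    also have "\<dots> = (\<Sum>j. \<Sum>i. ?e i j)"
      by (simp add: nn_integral_count_space_nat)
    also have "\<dots> = (\<Sum>j. emeasure (face_intensity_on M X \<mu> (Suc j)) (\<Union>i. F i))"
      using F by (simp add: suminf_emeasure)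
    finally show "(\<Sum>i. \<Sum>j. ?e i j) =
      (\<Sum>j. emeasure (face_intensity_on M X \<mu> (Suc j)) (\<Union>i. F i))" .
  qed
  show "A \<in> sets segment_space" by fact
qed

lemma steep_segments_sets [measurable]:
  assumes "j \<ge> 1"
  shows "steep_segments \<mu> j \<in> sets segment_space"
proof -
  let ?B = "{x::real. ereal (real j) * \<mu> < ereal x}"
  let ?Bs = "replicate (j - 1) UNIV @ [?B]"
  have "?B \<in> sets borel" by measurable
  then have "set ?Bs \<subseteq> sets borel" by auto
  moreover have "steep_segments \<mu> j = listset ?Bs"
  proof (intro set_eqI)
    fix xs :: "real list"
    show "xs \<in> steep_segments \<mu> j \<longleftrightarrow> xs \<in> listset ?Bs"
    proof (cases "length xs = j")
      case True
      then have "last xs = xs ! (j - 1)" using assms by (subst last_conv_nth) auto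
      moreover obtain m where "j = Suc m" using assms by (cases j) auto
      ultimately show ?thesis using True
        by (auto simp: steep_segments_def listset_iff nth_append less_Suc_eq)
    next
      case False
      then show ?thesis using assms by (auto simp: steep_segments_def listset_iff)
    qed
  qed
  ultimately show ?thesis
    unfolding sets_segment_space
    by (intro sigma_sets.Basic CollectI exI[of _ ?Bs] conjI) (assumption | simp)+
qed

lemma walk_path_measurable:
  assumes X [measurable]: "\<And>i. i \<ge> 1 \<Longrightarrow> X i \<in> borel_measurable M" and j: "j \<ge> 1"
  shows "(\<lambda>\<omega>. map (walk X \<omega>) [1..<Suc j]) \<in> M \<rightarrow>\<^sub>M segment_space"
  unfolding segment_space_def
proof (rule measurable_sigma_sets[OF sets_measure_of[OF segment_generators] segment_generators])
  show "(\<lambda>\<omega>. map (walk X \<omega>) [1..<Suc j]) \<in> space M \<rightarrow> {xs. xs \<noteq> []}" using j by auto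
  have W [measurable]: "(\<lambda>\<omega>. walk X \<omega> n) \<in> borel_measurable M" for n
    unfolding walk_def by (intro borel_measurable_sum X) auto
  fix A assume "A \<in> {listset Bs | Bs. Bs \<noteq> [] \<and> set Bs \<subseteq> sets (borel :: real measure)}"
  then obtain Bs where Bs: "A = listset Bs" "set Bs \<subseteq> sets (borel :: real measure)" by auto
  have [measurable]: "i < length Bs \<Longrightarrow> Bs ! i \<in> sets borel" for i using Bs(2) by force
  have "(\<lambda>\<omega>. map (walk X \<omega>) [1..<Suc j]) -` A \<inter> space M =
      {\<omega> \<in> space M. length Bs = j \<and> (\<forall>i\<in>{..<length Bs}. walk X \<omega> (Suc i) \<in> Bs ! i)}"
    unfolding Bs(1) by (auto simp: listset_iff simp del: upt_Suc)
  also have "\<dots> \<in> sets M"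
  proof (cases "length Bs = j")
    case True
    have "{\<omega> \<in> space M. walk X \<omega> (Suc i) \<in> Bs ! i} \<in> sets M" if "i < length Bs" for i
      using that by measurable
    then show ?thesis using True by (auto intro!: sets.sets_Collect_finite_All)
  qed simp
  finally show "(\<lambda>\<omega>. map (walk X \<omega>) [1..<Suc j]) -` A \<inter> space M \<in> sets M" .
qed

lemma emeasure_face_intensity_on:
  assumes X: "\<And>i. i \<ge> 1 \<Longrightarrow> X i \<in> borel_measurable M" and j: "j \<ge> 1"
    and A: "A \<in> sets segment_space"
  shows "emeasure (face_intensity_on M X \<mu> j) A = ennreal (1 / real j) *
    (emeasure M {\<omega> \<in> below_chord M X j. map (walk X \<omega>) [1..<Suc j] \<in> A \<and>
        ereal (real j) * \<mu> < ereal (walk X \<omega> j)}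
      / emeasure M (below_chord M X j))"
proof -
  let ?f = "\<lambda>\<omega>. map (walk X \<omega>) [1..<Suc j]"
  have W [measurable]: "(\<lambda>\<omega>. walk X \<omega> n) \<in> borel_measurable M" for n
    unfolding walk_def by (intro borel_measurable_sum X) auto
  have B: "below_chord M X j \<in> sets M" unfolding below_chord_def by measurable
  note f = walk_path_measurable[of X M j, OF X j]
  have f': "?f \<in> uniform_measure M (below_chord M X j) \<rightarrow>\<^sub>M segment_space"
    using f by (simp cong: measurable_cong_sets)
  note R = steep_segments_sets[OF j, of \<mu>]
  have AR: "A \<inter> steep_segments \<mu> j \<in> sets segment_space" using A R by auto
  have "emeasure (density (chord_law M X j) (indicator (steep_segments \<mu> j))) A =
      emeasure (chord_law M X j) (A \<inter> steep_segments \<mu> j)"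
    using A R by (subst emeasure_density) (auto simp: chord_law_def indicator_inter_arith[symmetric] Int_commute)
  also have "\<dots> = emeasure (uniform_measure M (below_chord M X j))
      (?f -` (A \<inter> steep_segments \<mu> j) \<inter> space M)"
    unfolding chord_law_def using f' AR by (subst emeasure_distr) auto
  also have "\<dots> = emeasure M (below_chord M X j \<inter> (?f -` (A \<inter> steep_segments \<mu> j) \<inter> space M))
      / emeasure M (below_chord M X j)"
    using B measurable_sets[OF f AR] by simp
  also have "below_chord M X j \<inter> (?f -` (A \<inter> steep_segments \<mu> j) \<inter> space M) =
      {\<omega> \<in> below_chord M X j. ?f \<omega> \<in> A \<and> ereal (real j) * \<mu> < ereal (walk X \<omega> j)}"
    using j by (auto simp: steep_segments_def below_chord_def)
  finally show ?thesis by (simp add: face_intensity_on_def)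
qed

end

theory Submission
  imports Defs
begin

text \<open>
  Let \<open>N\<close> be the first time at which the slope \<open>S\<^sub>n / n\<close> is maximal. Up to \<open>N\<close> the walk stays
  strictly below its chord, after \<open>N\<close> it stays below the line of slope \<open>S\<^sub>N / N\<close> through its
  position at time \<open>N\<close>, and these two properties characterise \<open>N\<close>. The first face of the concave
  majorant is the path up to \<open>N\<close>, and the other faces are those of the path after \<open>N\<close>
  (\<open>face_segment_first_face\<close>). The two pieces are built from independent steps. Hence the law of the
  list of faces is governed by one measure, \<open>face_measure\<close>: the law of the first \<open>j\<close> steps on the
  event that they stay below their chord, summed over \<open>j\<close>.

  Fix a slope \<open>a > \<mu>\<close> and a function \<open>h\<close> of faces with values in \<open>[0, 1]\<close>, and count only faces of
  slope greater than \<open>a\<close>. Let \<open>f\<^sub>K b\<close> be the expectation of the product of \<open>h\<close> over those of the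
  first \<open>K\<close> faces, on the event that the walk stays below the line of slope \<open>b\<close>. Cutting off the
  first face gives \<open>f\<^sub>K\<^sub>+\<^sub>1 b = p + \<integral> h z * f\<^sub>K (slope z)\<close>, where \<open>p\<close> is the probability to stay below
  the line of slope \<open>a\<close> and the integral is with respect to \<open>face_measure\<close> over the faces \<open>z\<close> with
  slope in \<open>(a, b]\<close> (\<open>restricted_mean_recursion\<close>). The slope has no atoms, so the iterates are the
  partial sums of an exponential series and \<open>f\<^sub>K \<infinity>\<close> tends to \<open>p * exp (\<integral> h)\<close>
  (\<open>volterra_iterates_limit\<close>); the factor \<open>1 / k!\<close> of this series is the effect of listing \<open>k\<close>
  exchangeable faces in the order of their slopes. The choice \<open>h = 1\<close> gives \<open>p\<close>, and the limit becomes
  \<open>exp (- \<integral> (1 - h))\<close>. Letting \<open>a\<close> decrease to \<open>\<mu>\<close> one obtains the Laplace functional of a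
  Poisson process whose intensity is \<open>face_measure\<close> on the slopes above \<open>\<mu>\<close> (\<open>void_functional\<close>). The
  joint law of the numbers of points in disjoint sets follows by inverting generating functions in one
  variable at a time (\<open>mixed_generating_function\<close>).

  Two facts about the mean are used: the walk minus a line of slope \<open>a > \<mu>\<close> is bounded above, and from
  no point on does the walk stay below the line of slope \<open>\<mu>\<close> through that point. Then the supremum of
  the slopes seen from each point is attained, so that the majorant exists and has infinitely many
  faces, all steeper than \<open>\<mu>\<close> (\<open>AE_regular\<close>). Both facts come from the identity
  \<open>M = max 0 (X\<^sub>1 - a + M')\<close> for the supremum \<open>M\<close> of the walk minus the line, in which \<open>M'\<close> is a copy
  of \<open>M\<close> that is independent of \<open>X\<^sub>1\<close>, by comparing the expectations of its two sides
  (\<open>AE_excess_finite\<close>, \<open>AE_not_dominated_driftless\<close>).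

  Finally, of the \<open>j\<close> cyclic shifts of the first \<open>j\<close> steps exactly one stays below its chord, so this
  event has probability \<open>1 / j\<close> (\<open>prob_below\<close>). The factor \<open>1 / j\<close> in the intensity is therefore what
  turns the conditional law given this event into \<open>face_measure\<close>.
\<close>

section \<open>Least concave majorants and contact times\<close>

lemma concave_on_affine: "concave_on {0::real..} (\<lambda>x. \<alpha> + c * x)"
proof -
  have "u * (\<alpha> + c * x) + v * (\<alpha> + c * y) = \<alpha> + c * (u * x + v * y)" if "u + v = 1" for u v x y
  proof -
    have v: "v = 1 - u" using that by simp
    show ?thesis unfolding v by (simp add: algebra_simps)
  qed
  then show ?thesis by (simp add: concave_on_iff)
qed

text \<open>The least one is the infimum of all concave majorants. Each of them is bounded below by the values
  of the sequence at the two integers next to its argument, which makes the infimum finite.\<close>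

lemma concave_majorant_exists:
  fixes s :: "nat \<Rightarrow> real"
  assumes bd: "\<And>n. s n \<le> \<alpha> + c * real n"
  shows "\<exists>C. is_concave_majorant s C"
proof -
  define \<D> where "\<D> = {D. concave_on {0..} D \<and> (\<forall>j. s j \<le> D (real j))}"
  define C where "C x = (INF D\<in>\<D>. D x)" for x :: real
  have line: "(\<lambda>x. \<alpha> + c * x) \<in> \<D>"
    using bd concave_on_affine by (auto simp: \<D>_def)
  have below: "min (s (nat \<lfloor>x\<rfloor>)) (s (Suc (nat \<lfloor>x\<rfloor>))) \<le> D x" if D: "D \<in> \<D>" and x: "0 \<le> x" for D x
  proof -
    define n t where "n = nat \<lfloor>x\<rfloor>" and "t = x - real n"
    have t: "0 \<le> t" "t \<le> 1" using x unfolding t_def n_def by linarith+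
    have "x = (1 - t) *\<^sub>R real n + t *\<^sub>R real (Suc n)" by (simp add: t_def algebra_simps)
    with concave_onD[of "{0..}" D t "real n" "real (Suc n)"] D t
    have "(1 - t) * D (real n) + t * D (real (Suc n)) \<le> D x" by (auto simp: \<D>_def)
    moreover have "s n \<le> D (real n)" "s (Suc n) \<le> D (real (Suc n))"
      using D by (auto simp: \<D>_def simp del: of_nat_Suc)
    moreover have "(1 - t) * min (s n) (s (Suc n)) \<le> (1 - t) * D (real n)"
      "t * min (s n) (s (Suc n)) \<le> t * D (real (Suc n))"
      using calculation(2,3) t by (intro mult_left_mono; linarith)+
    ultimately show ?thesis unfolding n_def[symmetric] by (simp add: algebra_simps)
  qed
  have bdd: "bdd_below ((\<lambda>D. D x) ` \<D>)" if "0 \<le> x" for x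
    using below[OF _ that] by (rule bdd_belowI2)
  have "concave_on {0..} C"
  proof (rule concave_on_linorderI)
    fix t x y :: real assume t: "0 < t" "t < 1" and xy: "x \<in> {0..}" "y \<in> {0..}"
    show "(1 - t) * C x + t * C y \<le> C ((1 - t) *\<^sub>R x + t *\<^sub>R y)"
      unfolding C_def[of "(1 - t) *\<^sub>R x + t *\<^sub>R y"]
    proof (rule cINF_greatest)
      fix D assume D: "D \<in> \<D>"
      have "(1 - t) * C x \<le> (1 - t) * D x" "t * C y \<le> t * D y"
        unfolding C_def using t xy by (auto intro!: mult_left_mono cINF_lower bdd D)
      moreover have "(1 - t) * D x + t * D y \<le> D ((1 - t) *\<^sub>R x + t *\<^sub>R y)"
        using D t xy concave_onD[of "{0..}" D t x y] by (auto simp: \<D>_def)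
      ultimately show "(1 - t) * C x + t * C y \<le> D ((1 - t) *\<^sub>R x + t *\<^sub>R y)" by linarith
    qed (use line in auto)
  qed (rule convex_real_interval)
  moreover have "s j \<le> C (real j)" for j
    unfolding C_def using line by (intro cINF_greatest) (auto simp: \<D>_def)
  moreover have "C x \<le> D x" if "D \<in> \<D>" "x \<ge> 0" for D x
    unfolding C_def using that by (intro cINF_lower bdd)
  ultimately have "is_concave_majorant s C"
    unfolding is_concave_majorant_def by (auto simp: \<D>_def)
  then show ?thesis by blast
qed

text \<open>Contact means that a line through the point lies above the sequence. For a concave \<open>C\<close> that touches
  at \<open>j\<close>, the slope \<open>C (j + 1) - C j\<close> serves on both sides of \<open>j\<close>, also when \<open>j = 0\<close>. Conversely the
  line is itself a concave majorant.\<close>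

lemma contact_times_iff:
  "j \<in> contact_times s \<longleftrightarrow> (\<exists>c. \<forall>n. s n \<le> s j + c * (real n - real j))"
proof
  assume "j \<in> contact_times s"
  then obtain C where C: "concave_on {0..} C" "\<And>n. s n \<le> C (real n)" and eq: "s j = C (real j)"
    by (auto simp: contact_times_def is_concave_majorant_def)
  have "C (real n) \<le> C (real j) + (C (real j + 1) - C (real j)) * (real n - real j)" for n
  proof -
    consider "n = j" | "n = Suc j" | "n > Suc j" | "n < j" by linarith
    then show ?thesis
    proof cases
      case 3
      let ?t = "1 / (real n - real j)"
      have t: "0 < ?t" "?t < 1" using 3 by auto
      have "(1 - ?t) *\<^sub>R real j + ?t *\<^sub>R real n = real j + ?t * (real n - real j)"
        by (simp only: real_scaleR_def) algebra
      also have "\<dots> = real j + 1" using 3 by simp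
      finally have "(1 - ?t) *\<^sub>R real j + ?t *\<^sub>R real n = real j + 1" .
      with concave_onD[OF C(1), of ?t "real j" "real n"] t
      have "(1 - ?t) * C (real j) + ?t * C (real n) \<le> C (real j + 1)" by auto
      then have "(real n - real j) * ((1 - ?t) * C (real j) + ?t * C (real n))
          \<le> (real n - real j) * C (real j + 1)" using 3 by (intro mult_left_mono) auto
      then have "((real n - real j) * (1 - ?t)) * C (real j) + ((real n - real j) * ?t) * C (real n)
          \<le> (real n - real j) * C (real j + 1)" by (simp only: distrib_left mult.assoc)
      moreover have "(real n - real j) * (1 - ?t) = real n - real j - 1" "(real n - real j) * ?t = 1"
        using 3 by (auto simp: field_simps)
      ultimately have "(real n - real j - 1) * C (real j) + 1 * C (real n)
          \<le> (real n - real j) * C (real j + 1)" by (simp only:)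
      then show ?thesis by (simp add: algebra_simps)
    next
      case 4
      let ?t = "(real j - real n) / (real j - real n + 1)"
      have t: "0 < ?t" "?t < 1" using 4 by auto
      have "(1 - ?t) *\<^sub>R real n + ?t *\<^sub>R (real j + 1) = real n + ?t * (real j - real n + 1)"
        by (simp only: real_scaleR_def) algebra
      also have "\<dots> = real j" using 4 by simp
      finally have "(1 - ?t) *\<^sub>R real n + ?t *\<^sub>R (real j + 1) = real j" .
      with concave_onD[OF C(1), of ?t "real n" "real j + 1"] t
      have "(1 - ?t) * C (real n) + ?t * C (real j + 1) \<le> C (real j)" by auto
      then have "(real j - real n + 1) * ((1 - ?t) * C (real n) + ?t * C (real j + 1))
          \<le> (real j - real n + 1) * C (real j)" using 4 by (intro mult_left_mono) auto
      then have "((real j - real n + 1) * (1 - ?t)) * C (real n)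
            + ((real j - real n + 1) * ?t) * C (real j + 1)
          \<le> (real j - real n + 1) * C (real j)" by (simp only: distrib_left mult.assoc)
      moreover have "(real j - real n + 1) * (1 - ?t) = 1"
        "(real j - real n + 1) * ?t = real j - real n" using 4 by (auto simp: field_simps)
      ultimately have "1 * C (real n) + (real j - real n) * C (real j + 1)
          \<le> (real j - real n + 1) * C (real j)" by (simp only:)
      then show ?thesis by (simp add: algebra_simps)
    qed (auto simp: algebra_simps)
  qed
  then have "\<forall>n. s n \<le> s j + (C (real j + 1) - C (real j)) * (real n - real j)"
    using C(2) eq by (metis order_trans)
  then show "\<exists>c. \<forall>n. s n \<le> s j + c * (real n - real j)" ..
next
  assume "\<exists>c. \<forall>n. s n \<le> s j + c * (real n - real j)"
  then obtain c where c: "\<And>n. s n \<le> s j + c * (real n - real j)" by blast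
  then have c': "\<And>n. s n \<le> (s j - c * real j) + c * real n" by (simp add: algebra_simps)
  obtain C where C: "is_concave_majorant s C" using concave_majorant_exists[OF c'] by blast
  have "\<forall>x\<ge>0. C x \<le> (s j - c * real j) + c * x"
    using C c' concave_on_affine[of "s j - c * real j" c] unfolding is_concave_majorant_def by blast
  then have "C (real j) \<le> s j" by (auto dest: spec[of _ "real j"])
  moreover have "s j \<le> C (real j)" using C by (simp add: is_concave_majorant_def)
  ultimately show "j \<in> contact_times s" using C by (auto simp: contact_times_def)
qed

lemma enumerate_translate:
  fixes S :: "nat set"
  assumes "infinite S"
  shows "enumerate ((+) N ` S) i = N + enumerate S i"
proof (induction i)
  case 0
  show ?case unfolding enumerate_0 
    by (rule Least_equality)
      (use assms enumerate_in_set[OF assms, of 0] in \<open>auto simp: enumerate_0 intro: Least_le\<close>)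
next
  case (Suc i)
  have inf: "infinite ((+) N ` S)" using assms by (simp add: finite_image_iff)
  show ?case unfolding enumerate_Suc''[OF inf] Suc.IH
  proof (rule Least_equality)
    show "N + enumerate S (Suc i) \<in> (+) N ` S \<and> N + enumerate S i < N + enumerate S (Suc i)"
      using assms by (auto intro: enumerate_in_set enumerate_step)
    fix y assume y: "y \<in> (+) N ` S \<and> N + enumerate S i < y"
    then obtain z where "y = N + z" "z \<in> S" "enumerate S i < z" by auto
    then show "N + enumerate S (Suc i) \<le> y" 
      unfolding enumerate_Suc''[OF assms] by (auto intro: Least_le)
  qed
qed

lemma enumerate_insert_0_translate:
  fixes S :: "nat set"
  assumes "infinite S" "N > 0"
  shows "enumerate (insert 0 ((+) N ` S)) 0 = 0"
    "enumerate (insert 0 ((+) N ` S)) (Suc i) = N + enumerate S i"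
proof -
  show 0: "enumerate (insert 0 ((+) N ` S)) 0 = 0"
    unfolding enumerate_0 by (rule Least_equality) auto
  show "enumerate (insert 0 ((+) N ` S)) (Suc i) = N + enumerate S i"
    unfolding enumerate_Suc' 0 enumerate_translate[OF assms(1), symmetric] using assms(2)
    by (intro arg_cong2[where f=enumerate]) auto
qed

section \<open>Faces of a path\<close>

text \<open>Paths are given by their steps, numbered from \<open>0\<close>: cutting a path at time \<open>m\<close> and moving the cut to
  the origin is to drop \<open>m\<close> steps.\<close>

definition walk_of :: "(nat \<Rightarrow> real) \<Rightarrow> nat \<Rightarrow> real" where
  "walk_of x n = (\<Sum>i<n. x i)"

definition drop_steps :: "nat \<Rightarrow> (nat \<Rightarrow> 'a) \<Rightarrow> nat \<Rightarrow> 'a" where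
  "drop_steps m x = (\<lambda>i. x (m + i))"

definition segment :: "nat \<Rightarrow> (nat \<Rightarrow> real) \<Rightarrow> real list" where
  "segment j x = map (walk_of x) [1..<Suc j]"

definition below :: "(nat \<Rightarrow> real) \<Rightarrow> nat \<Rightarrow> bool" where
  "below x j \<longleftrightarrow> (\<forall>k. 1 \<le> k \<and> k < j \<longrightarrow> walk_of x k < (real k / real j) * walk_of x j)"

definition slope :: "real list \<Rightarrow> real" where
  "slope z = last z / real (length z)"

text \<open>The bound is extended because \<open>\<infinity>\<close> stands for no restriction and the mean may be \<open>-\<infinity>\<close>.\<close>

definition dominated :: "(nat \<Rightarrow> real) \<Rightarrow> ereal \<Rightarrow> bool" where
  "dominated x b \<longleftrightarrow> (\<forall>n\<ge>1. ereal (walk_of x n / real n) \<le> b)"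

text \<open>From each point of the path the supremum of the slopes ahead is attained, so each face ends.\<close>

definition regular :: "(nat \<Rightarrow> real) \<Rightarrow> bool" where
  "regular x \<longleftrightarrow> (\<forall>m. \<exists>N\<ge>1. dominated (drop_steps m x) (walk_of (drop_steps m x) N / N))"

text \<open>The condition is split into one on the first \<open>N\<close> steps and one on the later steps; only the slope
  of the first part occurs in the second.\<close>

definition first_face :: "(nat \<Rightarrow> real) \<Rightarrow> nat \<Rightarrow> bool" where
  "first_face x N \<longleftrightarrow> N \<ge> 1 \<and> below x N \<and> dominated (drop_steps N x) (walk_of x N / N)"

lemma walk_of_0 [simp]: "walk_of x 0 = 0" and walk_of_Suc: "walk_of x (Suc n) = walk_of x n + x n"
  by (simp_all add: walk_of_def)

lemma walk_of_add: "walk_of x (m + n) = walk_of x m + walk_of (drop_steps m x) n"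
  by (induction n) (simp_all add: walk_of_Suc drop_steps_def)

lemma drop_steps_drop_steps: "drop_steps k (drop_steps m x) = drop_steps (m + k) x"
  by (simp add: drop_steps_def add.assoc)

lemma drop_steps_0 [simp]: "drop_steps 0 x = x" by (simp add: drop_steps_def)

lemma regular_drop_steps: "regular x \<Longrightarrow> regular (drop_steps m x)"
  unfolding regular_def drop_steps_drop_steps by blast

lemma slope_segment: "j \<ge> 1 \<Longrightarrow> slope (segment j x) = walk_of x j / real j"
  by (simp add: slope_def segment_def)

lemma dominated_iff: "dominated x (ereal b) \<longleftrightarrow> (\<forall>n. walk_of x n \<le> b * real n)"
proof -
  have "(walk_of x n / real n \<le> b) = (walk_of x n \<le> b * real n)" if "n \<ge> 1" for n
    using that by (simp add: field_simps)
  then show ?thesis by (auto simp: dominated_def not_less_eq_eq) (metis One_nat_def less_one not_less walk_of_0 of_nat_0 mult_zero_right order_refl)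
qed

lemma dominated_mono: "dominated x c \<Longrightarrow> c \<le> b \<Longrightarrow> dominated x b"
  unfolding dominated_def by (meson order_trans)

text \<open>The end of the face is the first time of maximal slope. All earlier slopes are then strictly
  smaller, also if the maximum is attained several times.\<close>

lemma first_face_exists:
  assumes "regular x"
  obtains N where "first_face x N" "dominated x (walk_of x N / N)"
proof -
  define N where "N = (LEAST N. N \<ge> 1 \<and> dominated x (walk_of x N / N))"
  have "\<exists>N. N \<ge> 1 \<and> dominated x (walk_of x N / N)"
    using assms unfolding regular_def by (metis drop_steps_0)
  then have N: "N \<ge> 1" "dominated x (walk_of x N / N)"
    unfolding N_def by (metis (mono_tags, lifting) LeastI_ex)+
  have least: "\<not> dominated x (walk_of x k / k)" if "1 \<le> k" "k < N" for k
    using that not_less_Least unfolding N_def by blast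
  let ?b = "walk_of x N / N"
  have dom: "walk_of x n \<le> ?b * n" for n using N(2) by (simp add: dominated_iff)
  have "below x N" unfolding below_def
  proof (intro allI impI, rule ccontr)
    fix k assume k: "1 \<le> k \<and> k < N" and "\<not> walk_of x k < real k / real N * walk_of x N"
    with dom[of k] have "walk_of x k / k = ?b" using N(1) by (simp add: field_simps)
    then show False using least[of k] k N(2) by simp
  qed
  moreover have "dominated (drop_steps N x) ?b" unfolding dominated_iff
  proof
    fix n 
    define b where "b = walk_of x N / N"
    have "walk_of x N = b * N" using N(1) by (simp add: b_def)
    then show "walk_of (drop_steps N x) n \<le> ?b * n"
      using dom[of "N + n"] unfolding walk_of_add b_def[symmetric] by (simp add: algebra_simps)
  qed
  ultimately show ?thesis using that N by (auto simp: first_face_def)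
qed

lemma first_face_dominated:
  assumes "first_face x N" shows "dominated x (walk_of x N / N)"
  unfolding dominated_iff
proof
  fix n
  from assms have N: "N \<ge> 1" "below x N" "dominated (drop_steps N x) (walk_of x N / N)" by (auto simp: first_face_def)
  show "walk_of x n \<le> walk_of x N / N * n"
  proof (cases "n < N")
    case True
    then show ?thesis using N(2) unfolding below_def by (cases "n = 0") (auto simp: field_simps dest!: spec[of _ n])
  next
    case False
    then obtain k where k: "n = N + k" by (auto simp: le_iff_add not_less)
    define b where "b = walk_of x N / N"
    have "walk_of x N = b * N" using N(1) by (simp add: b_def)
    moreover have "walk_of (drop_steps N x) k \<le> b * k" using N(3) by (simp add: dominated_iff b_def)
    ultimately show ?thesis unfolding k walk_of_add b_def[symmetric] by (simp add: algebra_simps)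
  qed
qed

text \<open>Both slopes are maximal, hence equal, and then the end of the shorter face would lie on the chord
  of the longer one.\<close>

lemma first_face_unique:
  assumes "first_face x M" "first_face x N" shows "M = N"
proof -
  have False if "first_face x M" "first_face x N" "M < N" for M N
  proof -
    have "1 \<le> M" "1 \<le> N" "walk_of x M < M / N * walk_of x N" using that by (auto simp: first_face_def below_def)
    moreover have "walk_of x N \<le> walk_of x M / M * N"
      using first_face_dominated[OF that(1)] by (simp add: dominated_iff)
    ultimately show False using that by (simp add: field_simps)
  qed
  then show ?thesis using assms by (meson linorder_neqE_nat)
qed

text \<open>Within the first face the path is strictly below a chord, so no line above the path touches it
  there. A line that touches later, and lies above the path from \<open>N\<close> on, has slope at most that of the
  first face; going back in time from \<open>N\<close> it therefore stays above the chord of the first face.\<close>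

lemma contact_times_first_face:
  assumes "first_face x N"
  shows "contact_times (walk_of x) = insert 0 ((+) N ` contact_times (walk_of (drop_steps N x)))"
proof -
  from assms have N: "N \<ge> 1" "below x N" "dominated (drop_steps N x) (walk_of x N / N)" by (auto simp: first_face_def)
  define b where "b = walk_of x N / N"
  let ?y = "drop_steps N x"
  have pN: "walk_of x N = b * N" using N(1) by (simp add: b_def)
  have dom: "walk_of x n \<le> b * n" for n using first_face_dominated[OF assms] by (simp add: dominated_iff b_def)
  have dom': "walk_of ?y n \<le> b * n" for n using N(3) by (simp add: dominated_iff b_def)
  have c0: "0 \<in> contact_times (walk_of x)" unfolding contact_times_iff using dom by (intro exI[of _ b]) auto
  have mid: "j \<notin> contact_times (walk_of x)" if "0 < j" "j < N" for j
  proof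
    assume "j \<in> contact_times (walk_of x)"
    then obtain c where c: "\<And>n. walk_of x n \<le> walk_of x j + c * (real n - real j)" by (auto simp: contact_times_iff)
    have "walk_of x j < b * j" using N(2) that by (auto simp: below_def b_def field_simps)
    then have "c * j < b * j" "b * (real N - j) < c * (real N - j)"
      using c[of 0] c[of N] pN by (auto simp: algebra_simps)
    then show False using that by simp
  qed
  have big: "N + k \<in> contact_times (walk_of x) \<longleftrightarrow> k \<in> contact_times (walk_of ?y)" for k
  proof
    assume "N + k \<in> contact_times (walk_of x)"
    then obtain c where c: "\<And>n. walk_of x n \<le> walk_of x (N + k) + c * (real n - real (N + k))" by (auto simp: contact_times_iff)
    have "walk_of ?y n \<le> walk_of ?y k + c * (real n - real k)" for n
      using c[of "N + n"] walk_of_add[of x N n] walk_of_add[of x N k] by (simp add: algebra_simps)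
    then show "k \<in> contact_times (walk_of ?y)" unfolding contact_times_iff by blast
  next
    assume k: "k \<in> contact_times (walk_of ?y)"
    then obtain c where c: "\<And>n. walk_of ?y n \<le> walk_of ?y k + c * (real n - real k)" by (auto simp: contact_times_iff)
    show "N + k \<in> contact_times (walk_of x)"
    proof (cases "k = 0")
      case True
        have "walk_of x n \<le> walk_of x (N + k) + b * (real n - real (N + k))" for n
        using dom[of n] pN True by (simp add: algebra_simps)
      then show ?thesis unfolding contact_times_iff by blast
    next
      case False
      from c[of 0] dom'[of k] have "c * k \<le> b * k" by (simp add: algebra_simps)
      then have cb: "c \<le> b" by (rule mult_right_le_imp_le) (use False in simp)
      have "walk_of x n \<le> walk_of x (N + k) + c * (real n - real (N + k))" for n
      proof (cases "n < N")
        case True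
        have "walk_of x n \<le> b * n" by (rule dom)
        also have "\<dots> = walk_of x N - b * (real N - n)" using pN by (simp add: algebra_simps)
        also have "\<dots> \<le> walk_of x N - c * (real N - n)"
          using cb True by (intro diff_left_mono mult_right_mono) auto
        also have "\<dots> \<le> walk_of x N + walk_of ?y k - c * k - c * (real N - n)"
          using c[of 0] by (simp add: algebra_simps)
        finally show ?thesis unfolding walk_of_add by (simp add: algebra_simps)
      next
        case False
        then show ?thesis using c[of "n - N"] walk_of_add[of x N "n - N"] unfolding walk_of_add[of x N k]
          by (simp add: algebra_simps of_nat_diff)
      qed
      then show ?thesis unfolding contact_times_iff by blast
    qed
  qed
  show ?thesis
  proof (intro set_eqI)
    fix j
    consider "j = 0" | "0 < j" "j < N" | k where "j = N + k" by (metis le_iff_add not_gr0 not_le)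
    then show "j \<in> contact_times (walk_of x) \<longleftrightarrow> j \<in> insert 0 ((+) N ` contact_times (walk_of ?y))"
      by cases (use c0 mid big N(1) in auto)
  qed
qed

lemma infinite_contact_times:
  assumes "regular x" shows "infinite (contact_times (walk_of x))"
proof -
  have "\<exists>j>n. j \<in> contact_times (walk_of x)" if "regular x" for n x
    using that
  proof (induction n arbitrary: x)
    case 0
    obtain N where N: "first_face x N" using first_face_exists[OF 0] .
    obtain N' where N': "first_face (drop_steps N x) N'" using first_face_exists[OF regular_drop_steps[OF 0]] .
    show ?case using contact_times_first_face[OF N] contact_times_first_face[OF N'] N
      by (intro exI[of _ N]) (auto simp: first_face_def)
  next
    case (Suc n)
    obtain N where N: "first_face x N" using first_face_exists[OF Suc.prems] .
    obtain j where "j > n" "j \<in> contact_times (walk_of (drop_steps N x))"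
      using Suc.IH[OF regular_drop_steps[OF Suc.prems]] by blast
    then show ?case using contact_times_first_face[OF N] N
      by (intro exI[of _ "N + j"]) (auto simp: first_face_def)
  qed
  then show ?thesis using assms unfolding infinite_nat_iff_unbounded by blast
qed

lemma contact_time_first_face:
  assumes "regular x" "first_face x N"
  shows "contact_time (walk_of x) 0 = 0"
    "contact_time (walk_of x) (Suc i) = N + contact_time (walk_of (drop_steps N x)) i"
  using enumerate_insert_0_translate[OF infinite_contact_times[OF regular_drop_steps[OF assms(1), of N]], of N] assms(2)
  unfolding contact_time_def contact_times_first_face[OF assms(2)] by (auto simp: first_face_def)

lemma contact_time_0: "regular x \<Longrightarrow> contact_time (walk_of x) 0 = 0"
  by (metis contact_time_first_face(1) first_face_exists)

lemma face_segment_walk_of: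
  "face_segment (walk_of x) i = (let a = contact_time (walk_of x) i; N = contact_time (walk_of x) (Suc i) - a
     in segment N (drop_steps a x))"
  by (simp add: face_segment_def segment_def walk_of_add Let_def del: upt_Suc)

lemma face_segment_first_face:
  assumes "regular x" "first_face x N"
  shows "face_segment (walk_of x) 0 = segment N x"
    "face_segment (walk_of x) (Suc i) = face_segment (walk_of (drop_steps N x)) i"
proof -
  note 1 = contact_time_first_face[OF assms]
  have 2: "contact_time (walk_of (drop_steps N x)) 0 = 0" using contact_time_0 regular_drop_steps assms by blast
  show "face_segment (walk_of x) 0 = segment N x"
    unfolding face_segment_walk_of 1 2 Let_def by simp
  show "face_segment (walk_of x) (Suc i) = face_segment (walk_of (drop_steps N x)) i"
    unfolding face_segment_walk_of 1 2 Let_def by (simp add: drop_steps_drop_steps add.commute)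
qed

lemma face_segment_neq_Nil: "regular x \<Longrightarrow> face_segment (walk_of x) i \<noteq> []"
proof (induction i arbitrary: x)
  case 0
  obtain N where "first_face x N" using first_face_exists[OF 0] .
  then show ?case by (simp add: face_segment_first_face[OF 0] segment_def first_face_def)
next
  case (Suc i)
  obtain N where N: "first_face x N" using first_face_exists[OF Suc.prems] .
  show ?case using Suc.IH[OF regular_drop_steps[OF Suc.prems]] by (simp add: face_segment_first_face[OF Suc.prems N])
qed

text \<open>The rest of the path is dominated by the slope of the first face, so slopes never increase.\<close>

lemma slope_face_segment_le:
  assumes "regular x" "dominated x b" shows "ereal (slope (face_segment (walk_of x) i)) \<le> b"
  using assms
proof (induction i arbitrary: x)
  case 0
  obtain N where "first_face x N" using first_face_exists[OF 0(1)] .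
  then show ?case using 0 by (simp add: face_segment_first_face[OF 0(1)] first_face_def slope_segment dominated_def)
next
  case (Suc i)
  obtain N where N: "first_face x N" using first_face_exists[OF Suc.prems(1)] .
  then have "dominated (drop_steps N x) b" using Suc.prems(2) unfolding first_face_def dominated_def 
    by (meson order_trans)
  then show ?case using Suc.IH[OF regular_drop_steps[OF Suc.prems(1)]] by (simp add: face_segment_first_face[OF Suc.prems(1) N])
qed

lemma slope_face_segment_gt:
  assumes "regular x" "\<And>m. \<not> dominated (drop_steps m x) b" shows "b < ereal (slope (face_segment (walk_of x) i))"
  using assms
proof (induction i arbitrary: x)
  case 0
  obtain N where N: "first_face x N" using first_face_exists[OF 0(1)] .
  have "b < walk_of x N / N" using first_face_dominated[OF N] 0(2)[of 0] unfolding dominated_def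
    by (metis linorder_not_less order_trans drop_steps_0)
  then show ?case using N by (simp add: face_segment_first_face[OF 0(1)] first_face_def slope_segment)
next
  case (Suc i)
  obtain N where N: "first_face x N" using first_face_exists[OF Suc.prems(1)] .
  show ?case unfolding face_segment_first_face[OF Suc.prems(1) N]
    by (rule Suc.IH[OF regular_drop_steps[OF Suc.prems(1)]]) (simp add: Suc.prems(2) drop_steps_drop_steps)
qed

section \<open>A linear Volterra equation\<close>

lemma distribution_function_measurable:
  fixes \<nu> :: "ereal measure"
  assumes "finite_measure \<nu>" and [measurable_cong]: "sets \<nu> = sets borel"
  shows "(\<lambda>u. measure \<nu> {..u}) \<in> borel_measurable borel"
proof -
  interpret finite_measure \<nu> by fact
  have "measure \<nu> {..u} = enn2real (\<integral>\<^sup>+v. (if v \<le> u then 1 else 0) \<partial>\<nu>)" for u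
  proof -
    have "(\<integral>\<^sup>+v. (if v \<le> u then 1 else 0) \<partial>\<nu>) = (\<integral>\<^sup>+v. indicator {..u} v \<partial>\<nu>)"
      by (intro nn_integral_cong) (auto simp: indicator_def)
    then show ?thesis using assms(2) by (simp add: measure_def)
  qed
  then show ?thesis by simp
qed

text \<open>This is \<open>\<phi>\<^sup>k d\<phi> = d(\<phi>\<^sup>k\<^sup>+\<^sup>1) / (k + 1)\<close> for the distribution function \<open>\<phi>\<close>. In the induction the
  range \<open>u \<le> b\<close> is split at a point \<open>v \<le> b\<close>, where the absence of atoms is used, and the result is
  integrated over \<open>v\<close>. By Fubini the integral for \<open>k + 1\<close> appears twice, with the factors
  \<open>1 / (k + 1)\<close> and \<open>1\<close>.\<close>

lemma nn_integral_distribution_function_power: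
  fixes \<nu> :: "ereal measure"
  assumes "finite_measure \<nu>" and sets [measurable_cong]: "sets \<nu> = sets borel"
    and no_atoms: "\<And>x. emeasure \<nu> {x} = 0"
  shows "(\<integral>\<^sup>+u. ennreal (measure \<nu> {..u} ^ k) * indicator {..b} u \<partial>\<nu>) =
    ennreal (measure \<nu> {..b} ^ Suc k / real (Suc k))"
proof (induction k arbitrary: b)
  interpret finite_measure \<nu> by fact
  case 0
  show ?case using sets by (simp add: emeasure_eq_measure)
next
  interpret finite_measure \<nu> by fact
  interpret pair_sigma_finite \<nu> \<nu> ..
  define \<phi> where "\<phi> u = measure \<nu> {..u}" for u
  have [measurable]: "\<phi> \<in> borel_measurable borel"
    unfolding \<phi>_def by (rule distribution_function_measurable) fact+
  have \<phi>0: "0 \<le> \<phi> u" for u by (simp add: \<phi>_def)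
  case (Suc k)
  let ?i = "\<lambda>P. if P then 1 else 0 :: ennreal"
  define A where "A k b = (\<integral>\<^sup>+u. ennreal (\<phi> u ^ k) * ?i (u \<le> b) \<partial>\<nu>)" for k b
  have A_eq: "A k b = (\<integral>\<^sup>+u. ennreal (\<phi> u ^ k) * indicator {..b} u \<partial>\<nu>)" for k b
    unfolding A_def by (intro nn_integral_cong) (auto simp: indicator_def)
  have IH: "A k b = ennreal (\<phi> b ^ Suc k / real (Suc k))" for b
    using Suc unfolding A_eq \<phi>_def .
  have mass: "(\<integral>\<^sup>+v. ?i (v \<le> u) \<partial>\<nu>) = ennreal (\<phi> u)" for u
  proof -
    have "(\<integral>\<^sup>+v. ?i (v \<le> u) \<partial>\<nu>) = (\<integral>\<^sup>+v. indicator {..u} v \<partial>\<nu>)"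
      by (intro nn_integral_cong) (auto simp: indicator_def)
    then show ?thesis using sets by (simp add: \<phi>_def emeasure_eq_measure)
  qed
  define G where "G v = (\<integral>\<^sup>+u. ennreal (\<phi> u ^ k) * ?i (u \<le> b) * ?i (v \<le> u) \<partial>\<nu>)" for v
  have "A (Suc k) b = (\<integral>\<^sup>+u. \<integral>\<^sup>+v. ennreal (\<phi> u ^ k) * ?i (u \<le> b) * ?i (v \<le> u) \<partial>\<nu> \<partial>\<nu>)"
    unfolding A_def using \<phi>0
    by (subst nn_integral_cmult)
      (auto simp: mass ennreal_mult[symmetric] mult.commute intro!: nn_integral_cong)
  also have "\<dots> = (\<integral>\<^sup>+v. G v \<partial>\<nu>)" unfolding G_def
    by (subst Fubini') measurable
  finally have AG: "A (Suc k) b = (\<integral>\<^sup>+v. G v \<partial>\<nu>)" .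
  have split: "A k b * ?i (v \<le> b) = A k v * ?i (v \<le> b) + G v" for v
  proof (cases "v \<le> b")
    case True
    have "AE u in \<nu>. u \<noteq> v" by (rule AE_I[of _ _ "{v}"]) (auto simp: no_atoms sets)
    then have "A k b = (\<integral>\<^sup>+u. ennreal (\<phi> u ^ k) * ?i (u \<le> v) + ennreal (\<phi> u ^ k) * ?i (u \<le> b) * ?i (v \<le> u) \<partial>\<nu>)"
      unfolding A_def
    proof (rule nn_integral_cong_AE[OF eventually_mono])
      fix u assume "u \<noteq> v"
      then show "ennreal (\<phi> u ^ k) * ?i (u \<le> b) =
          ennreal (\<phi> u ^ k) * ?i (u \<le> v) + ennreal (\<phi> u ^ k) * ?i (u \<le> b) * ?i (v \<le> u)"
        using True by auto
    qed
    also have "\<dots> = A k v + G v" unfolding A_def G_def by (subst nn_integral_add) measurable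
    finally show ?thesis using True by simp
  next
    case False
    then have "G v = 0" unfolding G_def by (intro nn_integral_zero') auto
    then show ?thesis using False by simp
  qed
  have [measurable]: "A k \<in> borel_measurable borel" for k unfolding A_def by measurable
  have [measurable]: "G \<in> borel_measurable borel" unfolding G_def by measurable
  have "A k b * ennreal (\<phi> b) = (\<integral>\<^sup>+v. A k b * ?i (v \<le> b) \<partial>\<nu>)"
    by (subst nn_integral_cmult) (auto simp: mass)
  also have "\<dots> = (\<integral>\<^sup>+v. A k v * ?i (v \<le> b) \<partial>\<nu>) + A (Suc k) b"
    unfolding split AG by (subst nn_integral_add) measurable
  also have "(\<integral>\<^sup>+v. A k v * ?i (v \<le> b) \<partial>\<nu>) = ennreal (1 / real (Suc k)) * A (Suc k) b"
    unfolding IH A_def[of "Suc k"] using \<phi>0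
    by (subst nn_integral_cmult[symmetric]) (auto simp: ennreal_mult[symmetric] intro!: nn_integral_cong)
  finally have eq: "ennreal (\<phi> b ^ Suc (Suc k) / real (Suc k)) = ennreal (1 / real (Suc k)) * A (Suc k) b + A (Suc k) b"
    unfolding IH using \<phi>0 by (simp add: ennreal_mult[symmetric] mult.commute)
  then have "A (Suc k) b \<noteq> top" by (metis ennreal_add_eq_top ennreal_neq_top)
  then obtain a where a: "A (Suc k) b = ennreal a" "0 \<le> a" by (cases "A (Suc k) b") auto
  have "\<phi> b ^ Suc (Suc k) / real (Suc k) = 1 / real (Suc k) * a + a"
    using eq a \<phi>0 by (simp add: ennreal_mult[symmetric] ennreal_plus[symmetric] del: ennreal_plus)
  then have "a = \<phi> b ^ Suc (Suc k) / real (Suc (Suc k))" by (simp add: field_simps)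
  then show ?case using a unfolding A_eq \<phi>_def by simp
qed

text \<open>After \<open>K\<close> steps the iterate lies between \<open>c\<close> times the first \<open>K\<close> terms of the exponential series and
  the same plus the next term of the series.\<close>

lemma volterra_iterates_limit:
  fixes \<nu> :: "ereal measure" and f :: "nat \<Rightarrow> ereal \<Rightarrow> ennreal"
  assumes fin: "finite_measure \<nu>" and sets [measurable_cong]: "sets \<nu> = sets borel"
    and no_atoms: "\<And>x. emeasure \<nu> {x} = 0"
    and c: "0 \<le> c" and f0: "\<And>b. b \<ge> a \<Longrightarrow> ennreal c \<le> f 0 b" "\<And>b. b \<ge> a \<Longrightarrow> f 0 b \<le> 1"
    and supp: "emeasure \<nu> {..<a} = 0"
    and rec: "\<And>K b. b \<ge> a \<Longrightarrow> f (Suc K) b = ennreal c + (\<integral>\<^sup>+u. f K u * indicator {..b} u \<partial>\<nu>)"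
    and b: "b \<ge> a"
  shows "(\<lambda>K. f K b) \<longlonglongrightarrow> ennreal (c * exp (measure \<nu> {..b}))"
proof -
  interpret finite_measure \<nu> by fact
  define \<phi> where "\<phi> u = measure \<nu> {..u}" for u
  have [measurable]: "\<phi> \<in> borel_measurable borel"
    unfolding \<phi>_def by (rule distribution_function_measurable) fact+
  have \<phi>0: "0 \<le> \<phi> u" for u by (simp add: \<phi>_def)
  define P where "P K u = (\<Sum>k<K. \<phi> u ^ k / fact k)" for K u
  have P0: "0 \<le> P K u" for K u unfolding P_def using \<phi>0 by (intro sum_nonneg) auto
  have [measurable]: "P K \<in> borel_measurable borel" for K unfolding P_def by measurable
  have AE_a: "AE u in \<nu>. a \<le> u" by (rule AE_I[of _ _ "{..<a}"]) (auto simp: supp sets)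
  have pow: "(\<integral>\<^sup>+u. ennreal (\<phi> u ^ k / fact k) * indicator {..b} u \<partial>\<nu>) = ennreal (\<phi> b ^ Suc k / fact (Suc k))" for k b
  proof -
    have "(\<integral>\<^sup>+u. ennreal (\<phi> u ^ k / fact k) * indicator {..b} u \<partial>\<nu>)
        = (\<integral>\<^sup>+u. ennreal (1 / fact k) * (ennreal (\<phi> u ^ k) * indicator {..b} u) \<partial>\<nu>)"
      using \<phi>0 by (intro nn_integral_cong) (simp add: ennreal_mult[symmetric] mult.assoc[symmetric])
    also have "\<dots> = ennreal (1 / fact k) * ennreal (\<phi> b ^ Suc k / real (Suc k))"
      unfolding nn_integral_distribution_function_power[OF fin sets no_atoms, of k b, folded \<phi>_def, symmetric]
      by (rule nn_integral_cmult) measurable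
    also have "\<dots> = ennreal (\<phi> b ^ Suc k / fact (Suc k))"
    proof -
      have "1 / fact k * (\<phi> b ^ Suc k / real (Suc k)) = \<phi> b ^ Suc k / fact (Suc k)"
        by (simp del: of_nat_Suc power_Suc)
      then show ?thesis using \<phi>0 by (subst ennreal_mult[symmetric]) (auto simp del: of_nat_Suc power_Suc)
    qed
    finally show ?thesis .
  qed
  have intP: "(\<integral>\<^sup>+u. ennreal (P K u) * indicator {..b} u \<partial>\<nu>) = ennreal (P (Suc K) b - 1)" for K b
  proof -
    have "(\<integral>\<^sup>+u. ennreal (P K u) * indicator {..b} u \<partial>\<nu>)
        = (\<integral>\<^sup>+u. (\<Sum>k<K. ennreal (\<phi> u ^ k / fact k) * indicator {..b} u) \<partial>\<nu>)"
    proof (intro nn_integral_cong)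
      fix u
      have "ennreal (P K u) = (\<Sum>k<K. ennreal (\<phi> u ^ k / fact k))"
        unfolding P_def by (rule sum_ennreal[symmetric]) (use \<phi>0 in auto)
      then show "ennreal (P K u) * indicator {..b} u = (\<Sum>k<K. ennreal (\<phi> u ^ k / fact k) * indicator {..b} u)"
        by (simp only: sum_distrib_right)
    qed
    also have "\<dots> = (\<Sum>k<K. ennreal (\<phi> b ^ Suc k / fact (Suc k)))"
      by (subst nn_integral_sum) (auto simp: pow simp del: fact_Suc power_Suc)
    also have "\<dots> = ennreal (P (Suc K) b - 1)"
    proof -
      have "P (Suc K) b = 1 + (\<Sum>k<K. \<phi> b ^ Suc k / fact (Suc k))"
        unfolding P_def by (subst sum.lessThan_Suc_shift) simp
      then show ?thesis using \<phi>0 by (subst sum_ennreal) (auto simp del: fact_Suc power_Suc)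
    qed
    finally show ?thesis .
  qed
  have P1: "1 \<le> P (Suc K) b" for K b
    unfolding P_def using \<phi>0 by (subst sum.lessThan_Suc_shift) (auto intro!: sum_nonneg)
  have bounds: "ennreal (c * P K b) \<le> f K b \<and> f K b \<le> ennreal (c * P K b + \<phi> b ^ K / fact K)" if "b \<ge> a" for K b
    using that
  proof (induction K arbitrary: b)
    case 0
    then show ?case using f0(2)[of b] by (simp add: P_def)
  next
    case (Suc K)
    have "ennreal (c * P (Suc K) b) = ennreal c + ennreal c * ennreal (P (Suc K) b - 1)"
      using c P1[of K b] mult_left_mono[OF P1[of K b] c]
      by (subst ennreal_mult[symmetric], simp, simp, subst ennreal_plus[symmetric]) (auto simp: algebra_simps)
    also have "ennreal c * ennreal (P (Suc K) b - 1) = (\<integral>\<^sup>+u. ennreal c * (ennreal (P K u) * indicator {..b} u) \<partial>\<nu>)"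
      unfolding intP[symmetric] by (rule nn_integral_cmult[symmetric]) measurable
    finally have eq: "ennreal (c * P (Suc K) b) = ennreal c + (\<integral>\<^sup>+u. ennreal c * (ennreal (P K u) * indicator {..b} u) \<partial>\<nu>)" .
    have "(\<integral>\<^sup>+u. ennreal c * (ennreal (P K u) * indicator {..b} u) \<partial>\<nu>) \<le> (\<integral>\<^sup>+u. f K u * indicator {..b} u \<partial>\<nu>)"
      using AE_a
    proof (intro nn_integral_mono_AE, elim eventually_mono)
      fix u assume "a \<le> u"
      then show "ennreal c * (ennreal (P K u) * indicator {..b} u) \<le> f K u * indicator {..b} u"
        using Suc.IH[of u] c P0[of K u] by (auto simp: indicator_def ennreal_mult)
    qed
    then have lower: "ennreal (c * P (Suc K) b) \<le> f (Suc K) b"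
      unfolding eq rec[OF Suc.prems] by (rule add_left_mono)
    have "(\<integral>\<^sup>+u. f K u * indicator {..b} u \<partial>\<nu>)
       \<le> (\<integral>\<^sup>+u. ennreal c * (ennreal (P K u) * indicator {..b} u) + ennreal (\<phi> u ^ K / fact K) * indicator {..b} u \<partial>\<nu>)"
      using AE_a
    proof (intro nn_integral_mono_AE, elim eventually_mono)
      fix u assume "a \<le> u"
      then show "f K u * indicator {..b} u \<le> ennreal c * (ennreal (P K u) * indicator {..b} u) + ennreal (\<phi> u ^ K / fact K) * indicator {..b} u"
        using Suc.IH[of u] c P0[of K u] \<phi>0[of u] by (auto simp: indicator_def ennreal_mult)
    qed
    also have "\<dots> = (\<integral>\<^sup>+u. ennreal c * (ennreal (P K u) * indicator {..b} u) \<partial>\<nu>) + ennreal (\<phi> b ^ Suc K / fact (Suc K))"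
      unfolding pow[symmetric] by (rule nn_integral_add) measurable
    finally have "f (Suc K) b \<le> ennreal (c * P (Suc K) b) + ennreal (\<phi> b ^ Suc K / fact (Suc K))"
      unfolding eq rec[OF Suc.prems] add.assoc by (rule add_left_mono)
    also have "\<dots> = ennreal (c * P (Suc K) b + \<phi> b ^ Suc K / fact (Suc K))"
      using c P0 \<phi>0 by (intro ennreal_plus[symmetric]) auto
    finally show ?case using lower by blast
  qed
  have "(\<lambda>k. \<phi> b ^ k / fact k) sums exp (\<phi> b)"
    using exp_converges[of "\<phi> b"] by (simp add: divide_inverse mult.commute)
  then have 0: "(\<lambda>k. \<phi> b ^ k / fact k) \<longlonglongrightarrow> 0" and "(\<lambda>K. P K b) \<longlonglongrightarrow> exp (\<phi> b)"
    unfolding P_def by (rule summable_LIMSEQ_zero[OF sums_summable], simp add: sums_def)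
  then have lim: "(\<lambda>K. c * P K b) \<longlonglongrightarrow> c * exp (\<phi> b)" by (intro tendsto_intros)
  from tendsto_add[OF lim 0] have lim': "(\<lambda>K. c * P K b + \<phi> b ^ K / fact K) \<longlonglongrightarrow> c * exp (\<phi> b)" by simp
  show ?thesis unfolding \<phi>_def[symmetric]
    by (rule tendsto_sandwich[OF _ _ tendsto_ennrealI[OF lim] tendsto_ennrealI[OF lim']])
      (use bounds[OF b] in auto)
qed

section \<open>Poisson processes from their void functional\<close>

text \<open>Suppose that the coefficients of the difference vanish before \<open>k\<close>. Dividing by \<open>t\<^sup>k\<close> and letting
  \<open>t\<close> decrease to \<open>0\<close> shows that the \<open>k\<close>-th one vanishes too.\<close>

lemma powser_unique_at_right:
  fixes a b :: "nat \<Rightarrow> real"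
  assumes bdd: "\<And>k. \<bar>a k\<bar> \<le> B" "\<And>k. \<bar>b k\<bar> \<le> B"
    and eq: "\<And>t. 0 < t \<Longrightarrow> t < 1 \<Longrightarrow> (\<Sum>k. a k * t ^ k) = (\<Sum>k. b k * t ^ k)"
  shows "a k = b k"
proof -
  define d where "d k = a k - b k" for k
  have sm: "summable (\<lambda>k. u k * t ^ k)" if "\<And>k. \<bar>u k\<bar> \<le> B'" "\<bar>t\<bar> < 1" for u :: "nat \<Rightarrow> real" and B' t
  proof (rule summable_comparison_test'[of "\<lambda>k. B' * \<bar>t\<bar> ^ k" 0])
    show "summable (\<lambda>k. B' * \<bar>t\<bar> ^ k)" using that by (intro summable_mult summable_geometric) auto
    show "norm (u k * t ^ k) \<le> B' * \<bar>t\<bar> ^ k" for k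
      using that(1)[of k] by (auto simp: abs_mult power_abs intro: mult_right_mono)
  qed
  have d_bdd: "\<bar>d k\<bar> \<le> 2 * B" for k using bdd[of k] unfolding d_def by linarith
  have zero: "(\<Sum>k. d k * t ^ k) = 0" if "0 < t" "t < 1" for t
  proof -
    have "(\<Sum>k. d k * t ^ k) = (\<Sum>k. a k * t ^ k - b k * t ^ k)" by (simp add: d_def algebra_simps)
    also have "\<dots> = (\<Sum>k. a k * t ^ k) - (\<Sum>k. b k * t ^ k)"
      using that bdd by (intro suminf_diff[symmetric] sm[where B'=B]) auto
    finally show ?thesis using eq that by simp
  qed
  have "d k = 0" for k
  proof (induction k rule: less_induct)
    case (less k)
    define g where "g t = (\<Sum>n. d (n + k) * t ^ n)" for t
    have "(\<lambda>n. d (n + k) * t ^ n) sums g t" if "norm t < 1" for t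
      unfolding g_def by (intro summable_sums sm[where B'="2 * B"]) (use that d_bdd in auto)
    then have "(g \<longlongrightarrow> d (0 + k)) (at 0)" by (intro powser_limit_0[of 1]) auto
    then have lim: "(g \<longlongrightarrow> d k) (at_right 0)" by (auto intro: tendsto_within_subset)
    have "g t = 0" if "0 < t" "t < 1" for t
    proof -
      have "(\<Sum>n. d n * t ^ n) = (\<Sum>n. d (n + k) * t ^ (n + k)) + (\<Sum>n<k. d n * t ^ n)"
        using that d_bdd by (intro suminf_split_initial_segment sm[where B'="2 * B"]) auto
      then have "0 = (\<Sum>n. t ^ k * (d (n + k) * t ^ n))"
        using zero that less by (simp add: power_add algebra_simps)
      also have "\<dots> = t ^ k * g t" unfolding g_def
        using that d_bdd by (intro suminf_mult sm[where B'="2 * B"]) auto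
      finally show ?thesis using that by auto
    qed
    then have "\<forall>\<^sub>F t in at_right 0. g t = 0"
      unfolding eventually_at_right_field by (intro exI[of _ 1]) auto
    then have "(g \<longlongrightarrow> 0) (at_right 0)" by (rule tendsto_eventually)
    with lim show ?case by (rule tendsto_unique[rotated]) simp
  qed
  then show ?thesis by (simp add: d_def)
qed

text \<open>The probability that a Poisson variable with mean \<open>L\<close> is \<open>0\<close>, where an infinite mean belongs to the
  constant \<open>\<infinity>\<close>.\<close>

definition void_prob :: "ennreal \<Rightarrow> real" where
  "void_prob L = (if L = \<infinity> then 0 else exp (- enn2real L))"

definition poisson_weight :: "ennreal \<Rightarrow> nat \<Rightarrow> real" where
  "poisson_weight L k = (if L = \<infinity> then 0 else enn2real L ^ k / fact k * exp (- enn2real L))"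

text \<open>The convention \<open>t\<^sup>\<infinity> = 0\<close> is the limit of the powers for \<open>t < 1\<close>.\<close>

definition pow_card :: "real \<Rightarrow> nat set \<Rightarrow> real" where
  "pow_card t I = (if finite I then t ^ card I else 0)"

lemma void_prob_add: "void_prob (K + L) = void_prob K * void_prob L"
  by (cases K; cases L) (auto simp: void_prob_def enn2real_plus exp_add[symmetric] ennreal_plus[symmetric] simp del: ennreal_plus)

lemma void_prob_sum: "finite J \<Longrightarrow> void_prob (\<Sum>l\<in>J. f l) = (\<Prod>l\<in>J. void_prob (f l))"
  by (induction J rule: finite_induct) (auto simp: void_prob_add, simp add: void_prob_def)

lemma void_prob_bounds: "0 \<le> void_prob L" "void_prob L \<le> 1"
  by (auto simp: void_prob_def)

lemma pow_card_bounds: "0 \<le> t \<Longrightarrow> t \<le> 1 \<Longrightarrow> 0 \<le> pow_card t I \<and> pow_card t I \<le> 1"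
  by (auto simp: pow_card_def power_le_one)

lemma tendsto_pow_card:
  assumes "0 \<le> t" "t < 1"
  shows "(\<lambda>K. \<Prod>i<K. if i \<in> I then t else 1) \<longlonglongrightarrow> pow_card t I"
proof -
  have eq: "(\<Prod>i<K. if i \<in> I then t else 1) = t ^ card (I \<inter> {..<K})" for K
    by (subst prod.inter_restrict[symmetric]) (auto simp: Int_commute)
  show ?thesis
  proof (cases "finite I")
    case True
    then obtain K0 where "I \<subseteq> {..<K0}" by (meson finite_nat_iff_bounded)
    then have "\<forall>K\<ge>K0. I \<inter> {..<K} = I" by auto
    then show ?thesis unfolding eq using True
      by (intro tendsto_eventually) (auto simp: pow_card_def eventually_sequentially intro!: exI[of _ K0])
  next
    case False
    have "filterlim (\<lambda>K. card (I \<inter> {..<K})) at_top sequentially"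
      unfolding filterlim_at_top
    proof
      fix n
      obtain B where B: "finite B" "card B = n" "B \<subseteq> I" using infinite_arbitrarily_large[OF False] by blast
      then obtain K0 where "B \<subseteq> {..<K0}" by (meson finite_nat_iff_bounded)
      then have "n \<le> card (I \<inter> {..<K})" if "K \<ge> K0" for K
        using B that by (subst B(2)[symmetric], intro card_mono) auto
      then show "\<forall>\<^sub>F K in sequentially. n \<le> card (I \<inter> {..<K})" by (auto simp: eventually_sequentially)
    qed
    moreover have "(\<lambda>n. t ^ n) \<longlonglongrightarrow> 0" using assms by (intro LIMSEQ_realpow_zero) auto
    ultimately show ?thesis unfolding eq using False by (auto simp: pow_card_def intro: filterlim_compose)
  qed
qed

lemma pow_card_sums:
  "(\<lambda>k. (if finite I \<and> card I = k then 1 else 0) * t ^ k) sums pow_card t I"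
proof (cases "finite I")
  case True
  have "(\<lambda>k. if k = card I then t ^ k else 0) sums (t ^ card I)" by (rule sums_single)
  also have "(\<lambda>k. if k = card I then t ^ k else 0) = (\<lambda>k. (if finite I \<and> card I = k then 1 else 0) * t ^ k)"
    using True by auto
  finally show ?thesis using True by (simp add: pow_card_def)
qed (simp add: pow_card_def)

lemma poisson_weight_sums:
  assumes "0 \<le> t" "t < 1"
  shows "(\<lambda>k. poisson_weight L k * t ^ k) sums void_prob (ennreal (1 - t) * L)"
proof (cases L)
  case (real r)
  have "(\<lambda>k. (r * t) ^ k / fact k) sums exp (r * t)"
    using exp_converges[of "r * t"] by (simp add: divide_inverse mult.commute)
  then have "(\<lambda>k. exp (- r) * ((r * t) ^ k / fact k)) sums (exp (- r) * exp (r * t))" by (rule sums_mult)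
  moreover have "exp (- r) * exp (r * t) = void_prob (ennreal (1 - t) * L)"
  proof -
    have "ennreal (1 - t) * L = ennreal ((1 - t) * r)" using real assms by (simp add: ennreal_mult)
    moreover have "0 \<le> (1 - t) * r" using real assms by simp
    ultimately have "void_prob (ennreal (1 - t) * L) = exp (- ((1 - t) * r))"
      by (simp only: void_prob_def enn2real_ennreal) simp
    then show ?thesis by (simp add: exp_add[symmetric] algebra_simps)
  qed
  ultimately show ?thesis using real by (simp add: poisson_weight_def power_mult_distrib algebra_simps)
next
  case top
  then show ?thesis using assms by (simp add: poisson_weight_def void_prob_def ennreal_mult_top)
qed

lemma poisson_weight_bounds: "\<bar>poisson_weight L k\<bar> \<le> 1"
proof -
  have "enn2real L ^ k / fact k \<le> exp (enn2real L)"
  proof -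
    have s: "(\<lambda>k. enn2real L ^ k / fact k) sums exp (enn2real L)"
      using exp_converges[of "enn2real L"] by (simp add: divide_inverse mult.commute)
    have "(\<Sum>n\<in>{k}. enn2real L ^ n / fact n) \<le> exp (enn2real L)"
      unfolding sums_unique[OF s] by (rule sum_le_suminf) (use s in \<open>auto intro: sums_summable\<close>)
    then show ?thesis by simp
  qed
  then have "enn2real L ^ k / fact k * exp (- enn2real L) \<le> exp (enn2real L) * exp (- enn2real L)"
    by (intro mult_right_mono) auto
  then show ?thesis by (auto simp: poisson_weight_def exp_minus)
qed

lemma tendsto_void_prob:
  assumes "L \<longlonglongrightarrow> l" shows "(\<lambda>n. void_prob (L n)) \<longlonglongrightarrow> void_prob l"
proof (cases l)
  case (real r)
  then have "eventually (\<lambda>n. L n < \<top>) sequentially"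
    using assms by (intro order_tendstoD(2)) auto
  then have "eventually (\<lambda>n. exp (- enn2real (L n)) = void_prob (L n)) sequentially"
    by eventually_elim (auto simp: void_prob_def)
  moreover have "(\<lambda>n. exp (- enn2real (L n))) \<longlonglongrightarrow> exp (- enn2real l)"
    using real assms by (intro tendsto_intros tendsto_enn2real) auto
  ultimately show ?thesis using real by (auto simp: void_prob_def intro: Lim_transform_eventually)
next
  case top
  show ?thesis unfolding LIMSEQ_iff
  proof (intro allI impI)
    fix e :: real assume e: "0 < e"
    \<comment> \<open>beyond \<open>- ln e\<close> the void probability is less than \<open>e\<close>\<close>
    have "eventually (\<lambda>n. ennreal (max 0 (- ln e)) < L n) sequentially"
      using assms top by (intro order_tendstoD(1)) auto
    then have "eventually (\<lambda>n. norm (void_prob (L n) - void_prob l) < e) sequentially"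
    proof eventually_elim
      case (elim n)
      show ?case
      proof (cases "L n")
        case (real r)
        with elim have "max 0 (- ln e) < r" by (metis ennreal_less_iff max.cobounded1)
        then have "- ln e < r" by simp
        then have "- r < ln e" by simp
        then have "exp (- r) < e" using e by (metis exp_less_cancel_iff exp_ln)
        then show ?thesis using real top by (simp add: void_prob_def)
      qed (use e top in \<open>auto simp: void_prob_def\<close>)
    qed
    then show "\<exists>N. \<forall>n\<ge>N. norm (void_prob (L n) - void_prob l) < e"
      by (simp add: eventually_sequentially)
  qed
qed

text \<open>For \<open>h = exp (- f)\<close> this is the Laplace functional of a Poisson process. The limit is the expectation
  of the product over all points, since the partial products decrease.\<close>

definition has_void_functional :: "'a measure \<Rightarrow> 'b measure \<Rightarrow> (nat \<Rightarrow> 'a \<Rightarrow> 'b) \<Rightarrow> bool" where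
  "has_void_functional M \<nu> Z \<longleftrightarrow>
    (\<forall>h :: 'b \<Rightarrow> real. h \<in> borel_measurable \<nu> \<and> (\<forall>z. 0 \<le> h z \<and> h z \<le> 1) \<longrightarrow>
      (\<lambda>K. \<integral>\<omega>. (\<Prod>i<K. h (Z i \<omega>)) \<partial>M) \<longlonglongrightarrow> void_prob (\<integral>\<^sup>+z. ennreal (1 - h z) \<partial>\<nu>))"

lemma point_count_eq_of_nat:
  "point_count Z A \<omega> = of_nat k \<longleftrightarrow> finite {i. Z i \<omega> \<in> A} \<and> card {i. Z i \<omega> \<in> A} = k"
  by (cases "finite {i. Z i \<omega> \<in> A}") (auto simp: point_count_def)

context prob_space
begin

text \<open>The events that a variable takes a given finite value, together with the empty set, are stable
  under intersection and generate all events of this variable: infinity is the remaining value.\<close>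

lemma indep_vars_ennreal_nat_valued:
  fixes X :: "'i \<Rightarrow> 'a \<Rightarrow> ennreal"
  assumes ev: "\<And>i k. i \<in> I \<Longrightarrow> {\<omega> \<in> space M. X i \<omega> = of_nat k} \<in> events"
    and range: "\<And>i \<omega>. i \<in> I \<Longrightarrow> \<omega> \<in> space M \<Longrightarrow> X i \<omega> = \<infinity> \<or> (\<exists>k. X i \<omega> = of_nat k)"
    and prod: "\<And>J k. finite J \<Longrightarrow> J \<subseteq> I \<Longrightarrow> J \<noteq> {} \<Longrightarrow>
      prob {\<omega> \<in> space M. \<forall>i\<in>J. X i \<omega> = of_nat (k i)} = (\<Prod>i\<in>J. prob {\<omega> \<in> space M. X i \<omega> = of_nat (k i)})"
  shows "indep_vars (\<lambda>_. borel) X I"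
proof -
  define E where "E i k = {\<omega> \<in> space M. X i \<omega> = of_nat k}" for i k
  define G where "G i = insert {} (range (E i))" for i
  have E_disj: "E i k \<inter> E i l = (if k = l then E i k else {})" for i k l
    by (auto simp: E_def)
  have G_ev: "G i \<subseteq> events" if "i \<in> I" for i using ev[OF that] by (auto simp: G_def E_def)
  have pre: "X i -` A \<inter> space M = (\<Union>k\<in>{k. of_nat k \<in> A}. E i k) \<union>
      (if \<infinity> \<in> A then space M - (\<Union>k. E i k) else {})" if "i \<in> I" for i A
  proof (intro set_eqI)
    fix \<omega>
    show "\<omega> \<in> X i -` A \<inter> space M \<longleftrightarrow> \<omega> \<in> (\<Union>k\<in>{k. of_nat k \<in> A}. E i k) \<union>
        (if \<infinity> \<in> A then space M - (\<Union>k. E i k) else {})"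
    proof (cases "\<omega> \<in> space M")
      case True
      then consider "X i \<omega> = \<infinity>" | k where "X i \<omega> = of_nat k" using range[OF \<open>i \<in> I\<close>] by blast
      then show ?thesis using True by cases (auto simp: E_def)
    qed (auto simp: E_def)
  qed
  have "indep_sets G I"
  proof (rule indep_setsI)
    fix A J assume J: "J \<noteq> {}" "J \<subseteq> I" "finite J" and A: "\<forall>j\<in>J. A j \<in> G j"
    show "prob (\<Inter>j\<in>J. A j) = (\<Prod>j\<in>J. prob (A j))"
    proof (cases "\<exists>j\<in>J. A j = {}")
      case True
      then have "(\<Inter>j\<in>J. A j) = {}" by blast
      moreover have "(\<Prod>j\<in>J. prob (A j)) = 0"
        using J(3) True by (intro prod_zero) (auto, metis measure_empty)
      ultimately show ?thesis by simp
    next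
      case False
      with A have "\<forall>j\<in>J. A j \<in> range (E j)" by (auto simp: G_def)
      then have "\<forall>j\<in>J. \<exists>k. A j = E j k" by blast
      then obtain k where k: "\<And>j. j \<in> J \<Longrightarrow> A j = E j (k j)" by metis
      have "(\<Inter>j\<in>J. A j) = {\<omega> \<in> space M. \<forall>i\<in>J. X i \<omega> = of_nat (k i)}"
        using J(1) k by (auto simp: E_def)
      then show ?thesis using prod[OF J(3,2,1), of k] k by (simp add: E_def cong: prod.cong)
    qed
  qed (rule G_ev)
  then have "indep_sets (\<lambda>i. sigma_sets (space M) (G i)) I"
    by (rule indep_sets_sigma) (auto simp: Int_stable_def G_def E_disj)
  then have indep: "indep_sets (\<lambda>i. {X i -` A \<inter> space M | A. A \<in> sets borel}) I"
  proof (rule indep_sets_mono_sets)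
    fix i assume i: "i \<in> I"
    interpret G: sigma_algebra "space M" "sigma_sets (space M) (G i)"
      using G_ev[OF i] sets.space_closed by (intro sigma_algebra_sigma_sets) blast
    have EG: "E i k \<in> sigma_sets (space M) (G i)" for k by (auto simp: G_def)
    show "{X i -` A \<inter> space M | A. A \<in> sets borel} \<subseteq> sigma_sets (space M) (G i)"
    proof safe
      fix A :: "ennreal set"
      have "X i -` A \<inter> space M = (\<Union>k\<in>{k. of_nat k \<in> A}. E i k) \<union>
          (if \<infinity> \<in> A then space M - (\<Union>k. E i k) else {})"
        by (rule pre[OF i])
      also have "\<dots> \<in> sigma_sets (space M) (G i)"
        using EG by (auto intro!: G.Un G.countable_UN' G.Diff)
      finally show "X i -` A \<inter> space M \<in> sigma_sets (space M) (G i)" .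
    qed
  qed
  have "X i \<in> borel_measurable M" if i: "i \<in> I" for i
  proof (rule measurableI)
    fix A :: "ennreal set" assume "A \<in> sets borel"
    have "X i -` A \<inter> space M = (\<Union>k\<in>{k. of_nat k \<in> A}. E i k) \<union>
        (if \<infinity> \<in> A then space M - (\<Union>k. E i k) else {})"
      by (rule pre[OF i])
    also have "\<dots> \<in> sets M" using ev[OF i] by (auto intro!: sets.Un sets.countable_UN' sets.Diff simp: E_def)
    finally show "X i -` A \<inter> space M \<in> sets M" .
  qed simp
  with indep show ?thesis unfolding indep_vars_def2 by simp
qed

text \<open>Both sides of \<open>gen\<close> are power series in \<open>t\<close> with bounded coefficients, and the claim equates these
  coefficients. The factor \<open>Y\<close> carries along the counts in other sets.\<close>

lemma pow_card_event_inversion: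
  fixes I :: "'a \<Rightarrow> nat set" and Y :: "'a \<Rightarrow> real"
  assumes [measurable]: "Y \<in> borel_measurable M" and Y: "\<And>\<omega>. 0 \<le> Y \<omega> \<and> Y \<omega> \<le> 1"
    and [measurable]: "\<And>k. {\<omega> \<in> space M. finite (I \<omega>) \<and> card (I \<omega>) = k} \<in> events"
    and gen: "\<And>t. 0 < t \<Longrightarrow> t < 1 \<Longrightarrow> (\<integral>\<omega>. Y \<omega> * pow_card t (I \<omega>) \<partial>M) = R * void_prob (ennreal (1 - t) * L)"
  shows "(\<integral>\<omega>. Y \<omega> * (if finite (I \<omega>) \<and> card (I \<omega>) = k then 1 else 0) \<partial>M) = R * poisson_weight L k"
proof -
  define i where "i k \<omega> = (if finite (I \<omega>) \<and> card (I \<omega>) = k then 1 else 0 :: real)" for k \<omega>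
  have [measurable]: "i k \<in> borel_measurable M" for k unfolding i_def by measurable
  define a where "a k = (\<integral>\<omega>. Y \<omega> * i k \<omega> \<partial>M)" for k
  have int: "integrable M (\<lambda>\<omega>. Y \<omega> * i k \<omega>)" for k
    using Y by (intro integrable_const_bound[of _ 1]) (auto simp: i_def abs_mult)
  have a_bdd: "\<bar>a k\<bar> \<le> 1" for k
  proof -
    have "0 \<le> a k" unfolding a_def using Y by (intro integral_nonneg_AE) (auto simp: i_def)
    moreover have "a k \<le> (\<integral>\<omega>. 1 \<partial>M)" unfolding a_def
      using Y by (intro integral_mono int) (auto simp: i_def)
    ultimately show ?thesis by (simp add: prob_space)
  qed
  have "a k = R * poisson_weight L k"
  proof (rule powser_unique_at_right[where B="1 + \<bar>R\<bar>"])
    show "\<bar>a k\<bar> \<le> 1 + \<bar>R\<bar>" for k using a_bdd[of k] by linarith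
    show "\<bar>R * poisson_weight L k\<bar> \<le> 1 + \<bar>R\<bar>" for k
      using mult_left_mono[OF poisson_weight_bounds[of L k], of "\<bar>R\<bar>"] by (simp add: abs_mult)
    fix t :: real assume t: "0 < t" "t < 1"
    have "(\<lambda>k. \<integral>\<omega>. Y \<omega> * i k \<omega> * t ^ k \<partial>M) sums (\<integral>\<omega>. (\<Sum>k. Y \<omega> * i k \<omega> * t ^ k) \<partial>M)"
    proof (rule sums_integral)
      show "integrable M (\<lambda>\<omega>. Y \<omega> * i k \<omega> * t ^ k)" for k using int by simp
      have le: "norm (Y \<omega> * i k \<omega> * t ^ k) \<le> t ^ k" for k \<omega>
        using Y[of \<omega>] t by (auto simp: i_def mult_left_le_one_le)
      show "AE \<omega> in M. summable (\<lambda>k. norm (Y \<omega> * i k \<omega> * t ^ k))"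
      proof (intro AE_I2)
        fix \<omega>
        have "summable (\<lambda>k. t ^ k)" using t by (intro summable_geometric) auto
        then show "summable (\<lambda>k. norm (Y \<omega> * i k \<omega> * t ^ k))"
          by (rule summable_comparison_test'[of _ 0]) (use le in \<open>simp only: real_norm_def abs_idempotent\<close>)
      qed
      have "(\<integral>\<omega>. norm (Y \<omega> * i k \<omega> * t ^ k) \<partial>M) \<le> t ^ k" for k
      proof -
        have "(\<integral>\<omega>. norm (Y \<omega> * i k \<omega> * t ^ k) \<partial>M) \<le> (\<integral>\<omega>. t ^ k \<partial>M)"
          using int by (intro integral_mono le integrable_norm) auto
        then show ?thesis by (simp add: prob_space)
      qed
      moreover have "0 \<le> (\<integral>\<omega>. norm (Y \<omega> * i k \<omega> * t ^ k) \<partial>M)" for k by (intro integral_nonneg_AE) auto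
      moreover have "summable (\<lambda>k. t ^ k)" using t by (intro summable_geometric) auto
      ultimately show "summable (\<lambda>k. \<integral>\<omega>. norm (Y \<omega> * i k \<omega> * t ^ k) \<partial>M)"
        using summable_comparison_test_ev[of "\<lambda>k. \<integral>\<omega>. norm (Y \<omega> * i k \<omega> * t ^ k) \<partial>M" "\<lambda>k. t ^ k"]
        by (metis (no_types, lifting) abs_of_nonneg always_eventually real_norm_def)
    qed
    moreover have "(\<integral>\<omega>. Y \<omega> * i k \<omega> * t ^ k \<partial>M) = a k * t ^ k" for k by (simp add: a_def)
    moreover have "(\<Sum>k. Y \<omega> * i k \<omega> * t ^ k) = Y \<omega> * pow_card t (I \<omega>)" for \<omega>
      using sums_mult[OF pow_card_sums[of "I \<omega>" t], of "Y \<omega>"]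
      by (intro sums_unique[symmetric]) (simp add: i_def mult.assoc)
    ultimately have "(\<lambda>k. a k * t ^ k) sums (R * void_prob (ennreal (1 - t) * L))" using gen t by simp
    moreover have "(\<lambda>k. R * poisson_weight L k * t ^ k) sums (R * void_prob (ennreal (1 - t) * L))"
      using sums_mult[OF poisson_weight_sums[of t L], of R] t by (simp add: mult.assoc)
    ultimately show "(\<Sum>k. a k * t ^ k) = (\<Sum>k. R * poisson_weight L k * t ^ k)"
      by (simp add: sums_iff)
  qed
  then show ?thesis by (simp add: a_def i_def)
qed

context
  fixes \<nu> :: "'b measure" and Z :: "nat \<Rightarrow> 'a \<Rightarrow> 'b"
  assumes Z_events: "\<And>i A. A \<in> sets \<nu> \<Longrightarrow> {\<omega> \<in> space M. Z i \<omega> \<in> A} \<in> events"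
    and void: "has_void_functional M \<nu> Z"
begin

lemma count_event: "A \<in> sets \<nu> \<Longrightarrow> {\<omega> \<in> space M. finite {i. Z i \<omega> \<in> A} \<and> card {i. Z i \<omega> \<in> A} = k} \<in> events"
proof -
  assume A: "A \<in> sets \<nu>"
  have [measurable]: "Measurable.pred M (\<lambda>\<omega>. Z i \<omega> \<in> A)" for i using Z_events[OF A] by (simp add: pred_def)
  show ?thesis by measurable
qed

lemma pow_card_measurable:
  "A \<in> sets \<nu> \<Longrightarrow> (\<lambda>\<omega>. pow_card t {i. Z i \<omega> \<in> A}) \<in> borel_measurable M"
proof -
  assume A: "A \<in> sets \<nu>"
  have [measurable]: "Measurable.pred M (\<lambda>\<omega>. Z i \<omega> \<in> A)" for i using Z_events[OF A] by (simp add: pred_def)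
  show ?thesis unfolding pow_card_def by measurable
qed

text \<open>Apply the void functional to the function that is \<open>t l\<close> on \<open>A l\<close> and \<open>1\<close> outside these disjoint sets.\<close>

lemma joint_generating_function:
  assumes J: "finite J" and A: "\<And>l. l \<in> J \<Longrightarrow> A l \<in> sets \<nu>" and disj: "disjoint_family_on A J"
    and t: "\<And>l. l \<in> J \<Longrightarrow> 0 \<le> t l \<and> t l < 1"
  shows "(\<integral>\<omega>. (\<Prod>l\<in>J. pow_card (t l) {i. Z i \<omega> \<in> A l}) \<partial>M) =
    (\<Prod>l\<in>J. void_prob (ennreal (1 - t l) * emeasure \<nu> (A l)))"
proof -
  define h where "h z = (\<Prod>l\<in>J. if z \<in> A l then t l else 1)" for z
  have hm: "h \<in> borel_measurable \<nu>"
    unfolding h_def using A by (intro borel_measurable_prod measurable_If_set) auto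
  have h: "0 \<le> h z \<and> h z \<le> 1" for z
    unfolding h_def using t by (intro conjI prod_nonneg prod_le_1) (auto intro: less_imp_le)
  have 1: "ennreal (1 - h z) = (\<Sum>l\<in>J. ennreal (1 - t l) * indicator (A l) z)" for z
  proof (cases "\<exists>l\<in>J. z \<in> A l")
    case True
    then obtain l where l: "l \<in> J" "z \<in> A l" by blast
    then have other: "z \<notin> A k" if "k \<in> J - {l}" for k
      using that disj by (auto simp: disjoint_family_on_def)
    have "h z = t l" unfolding h_def using l other J by (simp add: prod.remove[of J l])
    moreover have "(\<Sum>l\<in>J. ennreal (1 - t l) * indicator (A l) z) = ennreal (1 - t l)"
    proof -
      have "(\<Sum>k\<in>J - {l}. ennreal (1 - t k) * indicator (A k) z) = 0"
        using other by (intro sum.neutral) auto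
      then show ?thesis using l J by (subst sum.remove[of J l]) auto
    qed
    ultimately show ?thesis by simp
  next
    case False
    then have "h z = 1" unfolding h_def by (intro prod.neutral) auto
    with False show ?thesis by (auto intro!: sum.neutral[symmetric])
  qed
  have "(\<integral>\<^sup>+z. ennreal (1 - h z) \<partial>\<nu>) = (\<Sum>l\<in>J. ennreal (1 - t l) * emeasure \<nu> (A l))"
    unfolding 1 using A by (subst nn_integral_sum) (auto simp: nn_integral_cmult_indicator)
  then have lim: "(\<lambda>K. \<integral>\<omega>. (\<Prod>i<K. h (Z i \<omega>)) \<partial>M) \<longlonglongrightarrow> (\<Prod>l\<in>J. void_prob (ennreal (1 - t l) * emeasure \<nu> (A l)))"
    using void h hm J unfolding has_void_functional_def by (auto simp: void_prob_sum)
  have swap: "(\<Prod>i<K. h (Z i \<omega>)) = (\<Prod>l\<in>J. \<Prod>i<K. if i \<in> {i. Z i \<omega> \<in> A l} then t l else 1)" for K \<omega>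
    unfolding h_def by (subst prod.swap) simp
  have [measurable]: "Measurable.pred M (\<lambda>\<omega>. Z i \<omega> \<in> A l)" if "l \<in> J" for i l
    using Z_events[OF A[OF that]] by (simp add: pred_def)
  have "(\<lambda>K. \<integral>\<omega>. (\<Prod>i<K. h (Z i \<omega>)) \<partial>M) \<longlonglongrightarrow> (\<integral>\<omega>. (\<Prod>l\<in>J. pow_card (t l) {i. Z i \<omega> \<in> A l}) \<partial>M)"
  proof (rule integral_dominated_convergence[where w="\<lambda>_. 1"])
    show "(\<lambda>\<omega>. \<Prod>l\<in>J. pow_card (t l) {i. Z i \<omega> \<in> A l}) \<in> borel_measurable M"
      using A by (intro borel_measurable_prod pow_card_measurable)
    show "(\<lambda>\<omega>. \<Prod>i<K. h (Z i \<omega>)) \<in> borel_measurable M" for K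
      unfolding h_def by measurable
    show "AE \<omega> in M. (\<lambda>K. \<Prod>i<K. h (Z i \<omega>)) \<longlonglongrightarrow> (\<Prod>l\<in>J. pow_card (t l) {i. Z i \<omega> \<in> A l})"
      unfolding swap using t by (intro AE_I2 tendsto_prod tendsto_pow_card) auto
    show "AE \<omega> in M. norm (\<Prod>i<K. h (Z i \<omega>)) \<le> 1" for K
      using h by (auto simp: abs_prod intro!: prod_le_1)
  qed simp
  with lim show ?thesis by (rule LIMSEQ_unique[rotated])
qed

text \<open>The generating function is inverted in one variable after the other; \<open>J\<close> contains the variables for
  which this has been done.\<close>

lemma mixed_generating_function:
  assumes "finite J" "finite J'" and "J \<inter> J' = {}"
    and "\<And>l. l \<in> J \<union> J' \<Longrightarrow> A l \<in> sets \<nu>" and "disjoint_family_on A (J \<union> J')"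
    and "\<And>l. l \<in> J' \<Longrightarrow> 0 \<le> t l \<and> t l < 1"
  shows "(\<integral>\<omega>. (\<Prod>l\<in>J. if finite {i. Z i \<omega> \<in> A l} \<and> card {i. Z i \<omega> \<in> A l} = k l then 1 else 0) *
      (\<Prod>l\<in>J'. pow_card (t l) {i. Z i \<omega> \<in> A l}) \<partial>M) =
    (\<Prod>l\<in>J. poisson_weight (emeasure \<nu> (A l)) (k l)) *
      (\<Prod>l\<in>J'. void_prob (ennreal (1 - t l) * emeasure \<nu> (A l)))"
  using assms
proof (induction J arbitrary: J' t rule: finite_induct)
  case empty
  then show ?case by (simp add: joint_generating_function)
next
  case (insert m J)
  let ?i = "\<lambda>l \<omega>. if finite {i. Z i \<omega> \<in> A l} \<and> card {i. Z i \<omega> \<in> A l} = k l then 1 else 0 :: real"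
  define Y where "Y \<omega> = (\<Prod>l\<in>J. ?i l \<omega>) * (\<Prod>l\<in>J'. pow_card (t l) {i. Z i \<omega> \<in> A l})" for \<omega>
  define R where "R = (\<Prod>l\<in>J. poisson_weight (emeasure \<nu> (A l)) (k l)) *
      (\<Prod>l\<in>J'. void_prob (ennreal (1 - t l) * emeasure \<nu> (A l)))"
  have [measurable]: "?i l \<in> borel_measurable M" if "l \<in> insert m J" for l
    using count_event[of "A l" "k l"] insert.prems that by (intro measurable_If) (auto simp: pred_def)
  have Ym: "Y \<in> borel_measurable M" unfolding Y_def
    using insert.prems by (intro borel_measurable_times borel_measurable_prod pow_card_measurable) auto
  have Yb: "0 \<le> Y \<omega> \<and> Y \<omega> \<le> 1" for \<omega>
  proof -
    have "0 \<le> (\<Prod>l\<in>J. ?i l \<omega>)" "(\<Prod>l\<in>J. ?i l \<omega>) \<le> 1" by (auto intro!: prod_nonneg prod_le_1)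
    moreover have "0 \<le> (\<Prod>l\<in>J'. pow_card (t l) {i. Z i \<omega> \<in> A l})" "(\<Prod>l\<in>J'. pow_card (t l) {i. Z i \<omega> \<in> A l}) \<le> 1"
    proof -
      have "0 \<le> pow_card (t l) I \<and> pow_card (t l) I \<le> 1" if "l \<in> J'" for l I
        using insert.prems(5)[OF that] by (intro pow_card_bounds) auto
      then show "0 \<le> (\<Prod>l\<in>J'. pow_card (t l) {i. Z i \<omega> \<in> A l})" "(\<Prod>l\<in>J'. pow_card (t l) {i. Z i \<omega> \<in> A l}) \<le> 1"
        by (auto intro!: prod_nonneg prod_le_1)
    qed
    ultimately show ?thesis unfolding Y_def by (auto intro: mult_le_one)
  qed
  have gen: "(\<integral>\<omega>. Y \<omega> * pow_card s {i. Z i \<omega> \<in> A m} \<partial>M) = R * void_prob (ennreal (1 - s) * emeasure \<nu> (A m))"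
    if "0 < s" "s < 1" for s
  proof -
    have m: "m \<notin> J'" using insert.prems by auto
    then have ne: "l \<in> J' \<Longrightarrow> l \<noteq> m" for l by blast
    have "(\<integral>\<omega>. (\<Prod>l\<in>J. ?i l \<omega>) * (\<Prod>l\<in>insert m J'. pow_card ((t(m := s)) l) {i. Z i \<omega> \<in> A l}) \<partial>M) =
      (\<Prod>l\<in>J. poisson_weight (emeasure \<nu> (A l)) (k l)) *
      (\<Prod>l\<in>insert m J'. void_prob (ennreal (1 - (t(m := s)) l) * emeasure \<nu> (A l)))"
      using insert that by (intro insert.IH) auto
    then show ?thesis unfolding Y_def R_def prod.insert[OF insert.prems(1) m]
      by (simp add: ne mult_ac cong: prod.cong)
  qed
  have "(\<integral>\<omega>. Y \<omega> * ?i m \<omega> \<partial>M) = R * poisson_weight (emeasure \<nu> (A m)) (k m)"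
    using insert.prems by (intro pow_card_event_inversion Ym Yb gen count_event) auto
  then show ?case unfolding Y_def R_def using insert.hyps by (simp add: mult_ac)
qed

lemma joint_count_prob:
  assumes "finite J" "\<And>l. l \<in> J \<Longrightarrow> A l \<in> sets \<nu>" "disjoint_family_on A J"
  shows "prob {\<omega> \<in> space M. \<forall>l\<in>J. point_count Z (A l) \<omega> = of_nat (k l)} =
    (\<Prod>l\<in>J. poisson_weight (emeasure \<nu> (A l)) (k l))"
proof -
  let ?S = "{\<omega> \<in> space M. \<forall>l\<in>J. finite {i. Z i \<omega> \<in> A l} \<and> card {i. Z i \<omega> \<in> A l} = k l}"
  have "?S \<in> events" using assms by (intro sets.sets_Collect_finite_All count_event) auto
  have "prob ?S = (\<integral>\<omega>. indicator ?S \<omega> \<partial>M)" using \<open>?S \<in> events\<close> by simp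
  also have "\<dots> = (\<integral>\<omega>. (\<Prod>l\<in>J. if finite {i. Z i \<omega> \<in> A l} \<and> card {i. Z i \<omega> \<in> A l} = k l then 1 else 0) \<partial>M)"
    using assms(1) by (intro Bochner_Integration.integral_cong) (auto simp: indicator_def prod_zero_iff)
  also have "\<dots> = (\<Prod>l\<in>J. poisson_weight (emeasure \<nu> (A l)) (k l))"
    using mixed_generating_function[of J "{}" A undefined k] assms by simp
  also have "?S = {\<omega> \<in> space M. \<forall>l\<in>J. point_count Z (A l) \<omega> = of_nat (k l)}"
    by (auto simp: point_count_eq_of_nat)
  finally show ?thesis .
qed

end

end

lemma (in prob_space) lists_poisson_processI:
  assumes sp: "\<And>i. AE \<omega> in M. Z i \<omega> \<in> space \<nu>"
    and Z_events: "\<And>i A. A \<in> sets \<nu> \<Longrightarrow> {\<omega> \<in> space M. Z i \<omega> \<in> A} \<in> events"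
    and void: "has_void_functional M \<nu> Z"
  shows "lists_poisson_process M \<nu> Z"
proof -
  have event: "{\<omega> \<in> space M. point_count Z A \<omega> = of_nat k} \<in> events" if "A \<in> sets \<nu>" for A k
    unfolding point_count_eq_of_nat by (rule count_event[OF Z_events void that])
  have range: "point_count Z A \<omega> = \<infinity> \<or> (\<exists>k. point_count Z A \<omega> = of_nat k)" for A \<omega>
    by (cases "finite {i. Z i \<omega> \<in> A}") (auto simp: point_count_def)
  have joint: "prob {\<omega> \<in> space M. \<forall>l\<in>J. point_count Z (A l) \<omega> = of_nat (k l)} =
      (\<Prod>l\<in>J. poisson_weight (emeasure \<nu> (A l)) (k l))"
    if "finite J" "\<And>l. l \<in> J \<Longrightarrow> A l \<in> sets \<nu>" "disjoint_family_on A J" for J :: "nat set" and A k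
    using joint_count_prob[OF Z_events void that] by blast
  have single: "prob {\<omega> \<in> space M. point_count Z A \<omega> = of_nat k} = poisson_weight (emeasure \<nu> A) k"
    if "A \<in> sets \<nu>" for A k
    using joint[of "{0}" "\<lambda>_. A" "\<lambda>_. k"] that by (simp add: disjoint_family_on_def)
  show ?thesis unfolding lists_poisson_process_def
  proof (intro conjI allI ballI impI)
    fix A and k :: nat assume A: "A \<in> sets \<nu>" "emeasure \<nu> A < \<infinity>"
    then show "prob {\<omega> \<in> space M. point_count Z A \<omega> = of_nat k} =
        measure \<nu> A ^ k / fact k * exp (- measure \<nu> A)"
      unfolding single[OF A(1)] using A(2) by (auto simp: poisson_weight_def measure_def)
  next
    fix A assume A: "A \<in> sets \<nu>" "emeasure \<nu> A = \<infinity>"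
    have "AE \<omega> in M. point_count Z A \<omega> \<noteq> of_nat k" for k
      using event[OF A(1), of k] single[OF A(1), of k] A(2)
      by (subst AE_iff_measurable[OF _ refl]) (auto simp: emeasure_eq_measure poisson_weight_def)
    then have "AE \<omega> in M. \<forall>k. point_count Z A \<omega> \<noteq> of_nat k" unfolding AE_all_countable by blast
    then show "AE \<omega> in M. point_count Z A \<omega> = \<infinity>" by eventually_elim (use range in blast)
  next
    fix n :: nat and A assume A: "(\<forall>i<n. A i \<in> sets \<nu>) \<and> disjoint_family_on A {..<n}"
    show "indep_vars (\<lambda>_. borel) (\<lambda>i. point_count Z (A i)) {..<n}"
    proof (rule indep_vars_ennreal_nat_valued)
      fix J k assume J: "finite J" "J \<subseteq> {..<n}"
      then have "disjoint_family_on A J" using A disjoint_family_on_mono by blast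
      with J A show "prob {\<omega> \<in> space M. \<forall>i\<in>J. point_count Z (A i) \<omega> = of_nat (k i)} =
          (\<Prod>i\<in>J. prob {\<omega> \<in> space M. point_count Z (A i) \<omega> = of_nat (k i)})"
        by (subst joint) (auto simp: single intro!: prod.cong)
    qed (use A event range in auto)
  qed (use sp Z_events in auto)
qed

section \<open>Independent steps without atoms\<close>

text \<open>A line of the required kind exists if and only if no slope from \<open>j\<close> to the right exceeds a slope from
  the left to \<open>j\<close>; the bound \<open>K\<close> is for \<open>j = 0\<close>, where there is nothing on the left. These are countably
  many conditions, so contact times are measurable on the whole space, exceptional paths included.\<close>

lemma contact_times_iff_countable:
  "j \<in> contact_times s \<longleftrightarrow> (\<exists>K::nat. \<forall>n>j. s n - s j \<le> real K * (real n - real j)) \<and>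
     (\<forall>i<j. \<forall>n>j. (s n - s j) * (real j - real i) \<le> (s j - s i) * (real n - real j))"
  (is "_ \<longleftrightarrow> ?A \<and> ?B")
proof
  assume "j \<in> contact_times s"
  then obtain c where c: "\<And>n. s n \<le> s j + c * (real n - real j)" by (auto simp: contact_times_iff)
  obtain K :: nat where K: "c \<le> real K" using real_arch_simple by blast
  have "s n - s j \<le> real K * (real n - real j)" if "n > j" for n
    using c[of n] mult_right_mono[OF K, of "real n - real j"] that by linarith
  moreover have "(s n - s j) * (real j - real i) \<le> (s j - s i) * (real n - real j)" if "i < j" "j < n" for i n
  proof -
    have "(s n - s j) * (real j - real i) \<le> (c * (real n - real j)) * (real j - real i)"
      using c[of n] that by (intro mult_right_mono) auto
    also have "\<dots> = (c * (real j - real i)) * (real n - real j)" by simp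
    also have "\<dots> \<le> (s j - s i) * (real n - real j)"
      using c[of i] that by (intro mult_right_mono) (auto simp: algebra_simps)
    finally show ?thesis .
  qed
  ultimately show "?A \<and> ?B" by blast
next
  assume AB: "?A \<and> ?B"
  then obtain K :: nat where K: "\<And>n. n > j \<Longrightarrow> s n - s j \<le> real K * (real n - real j)" by blast
  define c where "c = (SUP n\<in>{j<..}. (s n - s j) / (real n - real j))"
  have bdd: "bdd_above ((\<lambda>n. (s n - s j) / (real n - real j)) ` {j<..})"
    using K by (intro bdd_aboveI2[of _ _ "real K"]) (auto simp: divide_le_eq)
  have "s n \<le> s j + c * (real n - real j)" for n
  proof -
    consider "n > j" | "n = j" | "n < j" by linarith
    then show ?thesis
    proof cases
      case 1
      have "(s n - s j) / (real n - real j) \<le> c" unfolding c_def using 1 by (intro cSUP_upper bdd) auto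
      then show ?thesis using 1 by (simp add: divide_le_eq)
    next
      case 3
      have "c \<le> (s j - s n) / (real j - real n)" unfolding c_def
      proof (rule cSUP_least)
        fix k assume "k \<in> {j<..}"
        then have "(s k - s j) * (real j - real n) \<le> (s j - s n) * (real k - real j)" "j < k"
          using AB 3 by auto
        then show "(s k - s j) / (real k - real j) \<le> (s j - s n) / (real j - real n)"
          using 3 pos_divide_le_eq[of "real k - real j"] pos_le_divide_eq[of "real j - real n"]
          by (simp add: times_divide_eq_left)
      qed auto
      then show ?thesis using 3 by (simp add: le_divide_eq algebra_simps)
    qed simp
  qed
  then show "j \<in> contact_times s" unfolding contact_times_iff by blast
qed

lemma measurable_enumerate:
  fixes A :: "'a \<Rightarrow> nat set"
  assumes "\<And>n. Measurable.pred N (\<lambda>x. n \<in> A x)"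
  shows "(\<lambda>x. enumerate (A x) i) \<in> N \<rightarrow>\<^sub>M count_space UNIV"
  using assms
proof (induction i arbitrary: A)
  case 0
  note [measurable] = 0
  show ?case unfolding enumerate_0 by measurable
next
  case (Suc i)
  note [measurable] = Suc.prems
  show ?case unfolding enumerate_Suc by (rule Suc.IH) measurable
qed

lemma slope_measurable [measurable]: "slope \<in> borel_measurable segment_space"
proof (rule borel_measurableI_greater)
  fix a
  have "{z \<in> space segment_space. a < slope z} = (\<Union>j. steep_segments (ereal a) (Suc j))"
  proof (intro set_eqI iffI)
    fix z assume z: "z \<in> {z \<in> space segment_space. a < slope z}"
    then obtain j where "length z = Suc j" by (cases z) (auto simp: space_segment_space)
    then show "z \<in> (\<Union>j. steep_segments (ereal a) (Suc j))"
      using z by (auto simp: steep_segments_def slope_def field_simps)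
  qed (auto simp: steep_segments_def slope_def field_simps space_segment_space)
  also have "\<dots> \<in> sets segment_space" by (intro sets.countable_UN) (auto intro: steep_segments_sets)
  finally show "{z \<in> space segment_space. a < slope z} \<in> sets segment_space" .
qed

locale continuous_walk = sequence_space D for D :: "real measure" +
  assumes sets_D [simp]: "sets D = sets borel"
    and no_atoms: "emeasure D {x} = 0"
begin

lemma space_D [simp]: "space D = UNIV"
  using sets_eq_imp_space_eq[OF sets_D] by simp

lemma space_S [simp]: "space S = UNIV"
  by (simp add: space_PiM)

lemma coordinate_measurable [measurable]: "(\<lambda>x. x i) \<in> borel_measurable S"
  using measurable_component_singleton[of i UNIV "\<lambda>_. D"] by (simp cong: measurable_cong_sets)

lemma drop_steps_measurable [measurable]: "drop_steps m \<in> S \<rightarrow>\<^sub>M S"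
  unfolding drop_steps_def by (rule measurable_PiM_single') (auto simp: space_PiM)

lemma walk_of_measurable [measurable (raw)]:
  assumes [measurable]: "f \<in> N \<rightarrow>\<^sub>M S"
  shows "(\<lambda>z. walk_of (f z) n) \<in> borel_measurable N"
  unfolding walk_of_def by (intro borel_measurable_sum measurable_compose[OF assms] coordinate_measurable)

lemma dominated_measurable [measurable (raw)]:
  assumes [measurable]: "f \<in> N \<rightarrow>\<^sub>M S" "g \<in> borel_measurable N"
  shows "Measurable.pred N (\<lambda>z. dominated (f z) (g z))"
  unfolding dominated_def by measurable

lemma below_measurable [measurable (raw)]:
  assumes [measurable]: "f \<in> N \<rightarrow>\<^sub>M S"
  shows "Measurable.pred N (\<lambda>z. below (f z) j)"
  unfolding below_def by measurable

lemma segment_measurable [measurable]: "segment (Suc j) \<in> S \<rightarrow>\<^sub>M segment_space"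
proof -
  have eq: "walk (\<lambda>i x. x (i - 1)) x = walk_of x" for x :: "nat \<Rightarrow> real"
  proof
    fix n show "walk (\<lambda>i x. x (i - 1)) x n = walk_of x n"
      by (induction n) (simp_all add: walk_def walk_of_def)
  qed
  have "(\<lambda>x. map (walk (\<lambda>i x. x (i - 1)) x) [1..<Suc (Suc j)]) \<in> S \<rightarrow>\<^sub>M segment_space"
    using walk_path_measurable[of "\<lambda>i x. x (i - 1)" S "Suc j"] coordinate_measurable by simp
  then show ?thesis unfolding eq by (simp add: segment_def[abs_def])
qed

lemma contact_time_measurable [measurable]:
  "(\<lambda>x. contact_time (walk_of x) i) \<in> S \<rightarrow>\<^sub>M count_space UNIV"
proof -
  have 1: "Measurable.pred S (\<lambda>x. walk_of x n - walk_of x j \<le> real K * (real n - real j))" for n j K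
    by measurable
  have 2: "Measurable.pred S (\<lambda>x. (walk_of x n - walk_of x j) * (real j - real i)
      \<le> (walk_of x j - walk_of x i) * (real n - real j))" for n j i
    unfolding pred_def by (intro borel_measurable_le borel_measurable_times borel_measurable_diff
      borel_measurable_const walk_of_measurable measurable_ident_sets refl)
  have "Measurable.pred S (\<lambda>x. j \<in> contact_times (walk_of x))" for j
    unfolding contact_times_iff_countable
    by (intro pred_intros_logic pred_intros_countable pred_intros_imp' 1 2)
  then show ?thesis unfolding contact_time_def by (rule measurable_enumerate)
qed

text \<open>For fixed values of the two contact times that bound it, the segment is a measurable function of the
  path, and these times have countably many values. On exceptional paths the segment may be the empty
  list, which lies outside \<open>segment_space\<close>; there \<open>h\<close> takes the value \<open>h []\<close>.\<close>

lemma face_segment_measurable: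
  assumes [measurable]: "h \<in> segment_space \<rightarrow>\<^sub>M N" and nil: "h [] \<in> space N"
  shows "(\<lambda>x. h (face_segment (walk_of x) i)) \<in> S \<rightarrow>\<^sub>M N"
proof -
  have [measurable]: "(\<lambda>x. h (segment j (drop_steps a x))) \<in> S \<rightarrow>\<^sub>M N" for j a
  proof (cases j)
    case 0
    then show ?thesis using nil by (simp add: segment_def)
  next
    case (Suc k)
    then show ?thesis by simp
  qed
  have "(\<lambda>x. h (segment (contact_time (walk_of x) (Suc i) - a) (drop_steps a x))) \<in> S \<rightarrow>\<^sub>M N" for a
    by (rule measurable_compose_countable[where f="\<lambda>b x. h (segment (b - a) (drop_steps a x))"]) measurable
  then have "(\<lambda>x. h (segment (contact_time (walk_of x) (Suc i) - contact_time (walk_of x) i)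
      (drop_steps (contact_time (walk_of x) i) x))) \<in> S \<rightarrow>\<^sub>M N"
    by (rule measurable_compose_countable[where f="\<lambda>a x. h (segment (contact_time (walk_of x) (Suc i) - a) (drop_steps a x))"])
      measurable
  then show ?thesis unfolding face_segment_walk_of Let_def .
qed

text \<open>The steps from \<open>j\<close> on are independent of the first \<open>j\<close> steps and have the law of the whole sequence.\<close>

lemma nn_integral_split:
  assumes [measurable]: "f \<in> borel_measurable S"
  shows "(\<integral>\<^sup>+x. f x \<partial>S) = (\<integral>\<^sup>+x. \<integral>\<^sup>+y. f (comb_seq j x y) \<partial>S \<partial>S)"
proof -
  have "(\<integral>\<^sup>+x. f x \<partial>S) = (\<integral>\<^sup>+x. f x \<partial>distr (S \<Otimes>\<^sub>M S) S (\<lambda>(x, y). comb_seq j x y))"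
    unfolding PiM_comb_seq ..
  also have "\<dots> = (\<integral>\<^sup>+z. (case z of (x, y) \<Rightarrow> f (comb_seq j x y)) \<partial>(S \<Otimes>\<^sub>M S))"
    by (subst nn_integral_distr) (auto simp: case_prod_beta')
  also have "\<dots> = (\<integral>\<^sup>+x. \<integral>\<^sup>+y. f (comb_seq j x y) \<partial>S \<partial>S)"
    by (subst nn_integral_fst[symmetric]) auto
  finally show ?thesis .
qed

lemma walk_of_comb_seq: "k \<le> j \<Longrightarrow> walk_of (comb_seq j x y) k = walk_of x k"
  by (auto simp: walk_of_def comb_seq_def intro!: sum.cong)

lemma drop_steps_comb_seq [simp]: "drop_steps j (comb_seq j x y) = y"
  by (auto simp: drop_steps_def comb_seq_def)

lemma segment_comb_seq [simp]: "segment j (comb_seq j x y) = segment j x"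
  by (auto simp: segment_def walk_of_comb_seq)

lemma below_comb_seq [simp]: "below (comb_seq j x y) j = below x j"
  by (auto simp: below_def walk_of_comb_seq)

lemma nn_integral_drop_steps:
  assumes [measurable]: "f \<in> borel_measurable S"
  shows "(\<integral>\<^sup>+x. f (drop_steps m x) \<partial>S) = (\<integral>\<^sup>+x. f x \<partial>S)"
  by (subst nn_integral_split[where j=m]) (use P.emeasure_space_1 in auto)

lemma distr_drop_steps: "distr S S (drop_steps m) = S"
proof (rule measure_eqI)
  fix A assume "A \<in> sets (distr S S (drop_steps m))"
  then have [measurable]: "A \<in> sets S" by simp
  have "emeasure (distr S S (drop_steps m)) A = (\<integral>\<^sup>+x. indicator A x \<partial>distr S S (drop_steps m))" by simp
  also have "\<dots> = (\<integral>\<^sup>+x. indicator A (drop_steps m x) \<partial>S)" by (subst nn_integral_distr) auto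
  also have "\<dots> = emeasure S A" by (subst nn_integral_drop_steps) auto
  finally show "emeasure (distr S S (drop_steps m)) A = emeasure S A" .
qed simp

lemma AE_drop_steps: "AE x in S. Q x \<Longrightarrow> AE x in S. Q (drop_steps m x)"
  using AE_distrD[OF drop_steps_measurable[of m], of Q] unfolding distr_drop_steps by blast

lemma nn_integral_coordinate:
  assumes [measurable]: "f \<in> borel_measurable borel"
  shows "(\<integral>\<^sup>+x. f (x i) \<partial>S) = (\<integral>\<^sup>+x. f x \<partial>D)"
proof -
  have "distr S D (\<lambda>x. x i) = D" using PiM_component[of i] by simp
  then have "(\<integral>\<^sup>+x. f x \<partial>D) = (\<integral>\<^sup>+x. f x \<partial>distr S D (\<lambda>x. x i))" by simp
  also have "\<dots> = (\<integral>\<^sup>+x. f (x i) \<partial>S)" by (subst nn_integral_distr) (auto cong: measurable_cong_sets)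
  finally show ?thesis by simp
qed

lemma nn_integral_first_step:
  assumes [measurable]: "f \<in> borel_measurable borel" "g \<in> borel_measurable S"
  shows "(\<integral>\<^sup>+x. f (x 0) * g (drop_steps 1 x) \<partial>S) = (\<integral>\<^sup>+x. f x \<partial>D) * (\<integral>\<^sup>+x. g x \<partial>S)"
proof -
  have "(\<integral>\<^sup>+x. f (x 0) * g (drop_steps 1 x) \<partial>S) = (\<integral>\<^sup>+x. \<integral>\<^sup>+y. f (x 0) * g y \<partial>S \<partial>S)"
  proof (subst nn_integral_split[where j=1])
    have "comb_seq 1 x y 0 = x 0" for x y :: "nat \<Rightarrow> real" by (simp add: comb_seq_def)
    then show "(\<integral>\<^sup>+x. \<integral>\<^sup>+y. f (comb_seq 1 x y 0) * g (drop_steps 1 (comb_seq 1 x y)) \<partial>S \<partial>S)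
        = (\<integral>\<^sup>+x. \<integral>\<^sup>+y. f (x 0) * g y \<partial>S \<partial>S)" unfolding drop_steps_comb_seq by simp
  qed measurable
  also have "\<dots> = (\<integral>\<^sup>+x. f (x 0) \<partial>S) * (\<integral>\<^sup>+x. g x \<partial>S)"
    by (simp add: nn_integral_cmult nn_integral_multc)
  also have "\<dots> = (\<integral>\<^sup>+x. f x \<partial>D) * (\<integral>\<^sup>+x. g x \<partial>S)"
    by (simp add: nn_integral_coordinate)
  finally show ?thesis .
qed

text \<open>Given the earlier steps, step \<open>j\<close> would have to take one particular value.\<close>

lemma AE_linear_combination_neq:
  assumes "c j \<noteq> 0"
  shows "AE x in S. (\<Sum>i<Suc j. c i * x i) \<noteq> v"
proof -
  have [measurable]: "{x. (\<Sum>i<Suc j. c i * x i) = v} \<in> sets S"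
  proof -
    have "{x \<in> space S. (\<Sum>i<Suc j. c i * x i) = v} \<in> sets S" by measurable
    then show ?thesis by simp
  qed
  have "emeasure S {x \<in> space S. (\<Sum>i<Suc j. c i * x i) = v} =
      (\<integral>\<^sup>+x. indicator {x. (\<Sum>i<Suc j. c i * x i) = v} x \<partial>S)"
    by (subst nn_integral_indicator) (auto simp del: sum.lessThan_Suc)
  also have "\<dots> = (\<integral>\<^sup>+x. \<integral>\<^sup>+y. indicator {(v - (\<Sum>i<j. c i * x i)) / c j} (y 0) \<partial>S \<partial>S)"
  proof (subst nn_integral_split[where j=j])
    have "(\<Sum>i<Suc j. c i * comb_seq j x y i) = (\<Sum>i<j. c i * x i) + c j * y 0" for x y
      by (simp add: comb_seq_def)
    then show "(\<integral>\<^sup>+x. \<integral>\<^sup>+y. indicator {x. (\<Sum>i<Suc j. c i * x i) = v} (comb_seq j x y) \<partial>S \<partial>S) =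
        (\<integral>\<^sup>+x. \<integral>\<^sup>+y. indicator {(v - (\<Sum>i<j. c i * x i)) / c j} (y 0) \<partial>S \<partial>S)"
      using assms by (auto simp: indicator_def field_simps intro!: nn_integral_cong)
  qed (auto simp del: sum.lessThan_Suc)
  also have "\<dots> = 0" by (simp add: nn_integral_coordinate no_atoms)
  finally show ?thesis by (subst AE_iff_measurable[OF _ refl]) (auto simp del: sum.lessThan_Suc)
qed

lemma AE_walk_neq: "AE x in S. walk_of x (Suc j) \<noteq> v"
  using AE_linear_combination_neq[of "\<lambda>_. 1" j v] by (simp add: walk_of_def)

end

section \<open>The excess of a walk over a line\<close>

text \<open>The maximum of \<open>walk_of x n - a * n\<close> over \<open>n \<le> N\<close>, in the form of the Lindley recursion.\<close>

primrec running_max :: "real \<Rightarrow> nat \<Rightarrow> (nat \<Rightarrow> real) \<Rightarrow> real" where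
  "running_max a 0 x = 0"
| "running_max a (Suc N) x = max 0 (x 0 - a + running_max a N (drop_steps 1 x))"

text \<open>The supremum of \<open>walk_of x n - a * n\<close> over all \<open>n\<close>.\<close>

definition excess :: "real \<Rightarrow> (nat \<Rightarrow> real) \<Rightarrow> ennreal" where
  "excess a x = (SUP N. ennreal (running_max a N x))"

lemma running_max_nonneg: "0 \<le> running_max a N x"
  by (cases N) auto

lemma running_max_mono_Suc: "running_max a N x \<le> running_max a (Suc N) x"
proof (induction N arbitrary: x)
  case (Suc N)
  have "running_max a (Suc N) x = max 0 (x 0 - a + running_max a N (drop_steps 1 x))" by simp
  also have "\<dots> \<le> max 0 (x 0 - a + running_max a (Suc N) (drop_steps 1 x))"
    by (intro max.mono add_left_mono order_refl Suc.IH)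
  also have "\<dots> = running_max a (Suc (Suc N)) x" by (simp only: running_max.simps)
  finally show ?case .
qed simp

lemma walk_of_le_running_max: "n \<le> N \<Longrightarrow> walk_of x n - a * real n \<le> running_max a N x"
proof (induction N arbitrary: x n)
  case (Suc N)
  show ?case
  proof (cases n)
    case (Suc m)
    have "walk_of x n = x 0 + walk_of (drop_steps 1 x) m"
      unfolding Suc using walk_of_add[of x 1 m] by (simp add: walk_of_def)
    then show ?thesis using Suc.IH[of m "drop_steps 1 x"] Suc Suc.prems by (simp add: algebra_simps)
  qed simp
qed simp

lemma running_max_attained: "\<exists>n\<le>N. running_max a N x = walk_of x n - a * real n"
proof (induction N arbitrary: x)
  case (Suc N)
  obtain n where n: "n \<le> N" "running_max a N (drop_steps 1 x) = walk_of (drop_steps 1 x) n - a * real n"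
    using Suc by blast
  have "walk_of x (Suc n) = x 0 + walk_of (drop_steps 1 x) n"
    using walk_of_add[of x 1 n] by (simp add: walk_of_def)
  then have "x 0 - a + running_max a N (drop_steps 1 x) = walk_of x (Suc n) - a * real (Suc n)"
    using n by (simp add: algebra_simps)
  then show ?case using n(1)
    by (cases "0 \<le> x 0 - a + running_max a N (drop_steps 1 x)") (auto intro: exI[of _ 0] exI[of _ "Suc n"])
qed simp

lemma incseq_running_max: "incseq (\<lambda>N. ennreal (running_max a N x))"
  by (intro incseq_SucI ennreal_leI running_max_mono_Suc)

lemma running_max_tendsto: "(\<lambda>N. ennreal (running_max a N x)) \<longlonglongrightarrow> excess a x"
  unfolding excess_def by (rule LIMSEQ_SUP[OF incseq_running_max])

lemma excess_eq_0_iff: "excess a x = 0 \<longleftrightarrow> dominated x (ereal a)"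
proof
  assume 0: "excess a x = 0"
  have "ennreal (running_max a n x) \<le> 0" for n unfolding 0[symmetric] excess_def by (rule SUP_upper) simp
  then have "running_max a n x \<le> 0" for n by (simp add: ennreal_eq_0_iff)
  then have "walk_of x n - a * real n \<le> 0" for n
    using walk_of_le_running_max[of n n x a] by (meson order.trans order_refl)
  then show "dominated x (ereal a)" unfolding dominated_iff by simp
next
  assume "dominated x (ereal a)"
  then have "running_max a N x = 0" for N
    using running_max_attained[of N a x] running_max_nonneg[of a N x] unfolding dominated_iff
    by (metis diff_le_0_iff_le order_antisym)
  then show "excess a x = 0" by (simp add: excess_def)
qed

lemma excess_finite_bound:
  assumes "excess a x \<noteq> \<top>" shows "walk_of x n \<le> enn2real (excess a x) + a * real n"
proof -
  have "ennreal (running_max a n x) \<le> excess a x" unfolding excess_def by (rule SUP_upper) simp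
  then have "running_max a n x \<le> enn2real (excess a x)"
    using assms running_max_nonneg by (metis enn2real_ennreal enn2real_mono less_top)
  then show ?thesis using walk_of_le_running_max[of n n x a] by simp
qed

text \<open>The maximum exceeds that of the path without its first step by \<open>x 0 - a\<close>, cut off below at minus the
  latter maximum. As an equation between sums of nonnegative terms, this passes to the possibly
  infinite \<open>excess\<close>.\<close>

lemma running_max_recursion:
  "ennreal (running_max a (Suc N) x) + min (ennreal (running_max a N (drop_steps 1 x))) (ennreal (a - x 0)) =
    ennreal (running_max a N (drop_steps 1 x)) + ennreal (x 0 - a)"
proof -
  define r where "r = running_max a N (drop_steps 1 x)"
  have r: "0 \<le> r" unfolding r_def by (rule running_max_nonneg)
  consider "x 0 \<ge> a" | "x 0 < a" "r \<le> a - x 0" | "x 0 < a" "a - x 0 \<le> r" by linarith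
  then have "ennreal (max 0 (x 0 - a + r)) + min (ennreal r) (ennreal (a - x 0)) = ennreal r + ennreal (x 0 - a)"
  proof cases
    case 1
    then show ?thesis using r
      by (simp add: ennreal_neg ennreal_plus[symmetric] max_def min_def add.commute del: ennreal_plus)
  next
    case 2
    then show ?thesis using r by (simp add: ennreal_neg min_def ennreal_leI max_def)
  next
    case 3
    then have "min (ennreal r) (ennreal (a - x 0)) = ennreal (a - x 0)" by (simp add: min_def ennreal_leI)
    moreover have "max 0 (x 0 - a + r) = x 0 - a + r" using 3 by simp
    ultimately show ?thesis using 3 r by (simp add: ennreal_neg ennreal_plus[symmetric] del: ennreal_plus)
  qed
  then show ?thesis by (simp add: r_def)
qed

lemma excess_recursion:
  "excess a x + min (excess a (drop_steps 1 x)) (ennreal (a - x 0)) =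
    excess a (drop_steps 1 x) + ennreal (x 0 - a)"
proof (rule LIMSEQ_unique)
  show "(\<lambda>N. ennreal (running_max a (Suc N) x) + min (ennreal (running_max a N (drop_steps 1 x))) (ennreal (a - x 0)))
      \<longlonglongrightarrow> excess a x + min (excess a (drop_steps 1 x)) (ennreal (a - x 0))"
    by (intro tendsto_add tendsto_min tendsto_const running_max_tendsto
        LIMSEQ_Suc[OF running_max_tendsto])
  show "(\<lambda>N. ennreal (running_max a (Suc N) x) + min (ennreal (running_max a N (drop_steps 1 x))) (ennreal (a - x 0)))
      \<longlonglongrightarrow> excess a (drop_steps 1 x) + ennreal (x 0 - a)"
    unfolding running_max_recursion by (intro tendsto_add tendsto_const running_max_tendsto)
qed

lemma excess_eq_top_drop_steps: "excess a (drop_steps 1 x) = \<top> \<longleftrightarrow> excess a x = \<top>"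
proof -
  have "min (excess a (drop_steps 1 x)) (ennreal (a - x 0)) \<noteq> \<top>"
    by (metis ennreal_neq_top min.cobounded2 neq_top_trans)
  then show ?thesis using excess_recursion[of a x] by (metis ennreal_add_eq_top ennreal_neq_top)
qed

context continuous_walk
begin

lemma running_max_measurable [measurable]: "running_max a N \<in> borel_measurable S"
proof (induction N)
  case 0
  have "running_max a 0 = (\<lambda>x. 0)" by auto
  then show ?case by simp
next
  case (Suc N)
  note [measurable] = Suc
  have "running_max a (Suc N) = (\<lambda>x. max 0 (x 0 - a + running_max a N (drop_steps 1 x)))" by auto
  then show ?case by simp
qed

lemma excess_measurable [measurable]: "excess a \<in> borel_measurable S"
  unfolding excess_def[abs_def] by measurable

text \<open>The first step is independent of the other steps and has no atoms.\<close>

lemma AE_first_step_neq: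
  assumes [measurable]: "g \<in> borel_measurable S"
  shows "AE x in S. x 0 \<noteq> g (drop_steps 1 x)"
proof -
  interpret SS: pair_sigma_finite S S ..
  have [measurable]: "{x. x 0 = g (drop_steps 1 x)} \<in> sets S"
  proof -
    have "{x \<in> space S. x 0 = g (drop_steps 1 x)} \<in> sets S" by measurable
    then show ?thesis by simp
  qed
  have "emeasure S {x \<in> space S. x 0 = g (drop_steps 1 x)} = (\<integral>\<^sup>+x. indicator {x. x 0 = g (drop_steps 1 x)} x \<partial>S)"
    by (subst nn_integral_indicator) (auto simp del: One_nat_def)
  also have "\<dots> = (\<integral>\<^sup>+x. \<integral>\<^sup>+y. (if x 0 = g y then 1 else 0) \<partial>S \<partial>S)"
  proof (subst nn_integral_split[where j=1])
    have "comb_seq 1 x y 0 = x 0" for x y :: "nat \<Rightarrow> real" by (simp add: comb_seq_def)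
    then show "(\<integral>\<^sup>+x. \<integral>\<^sup>+y. indicator {x. x 0 = g (drop_steps 1 x)} (comb_seq 1 x y) \<partial>S \<partial>S) =
        (\<integral>\<^sup>+x. \<integral>\<^sup>+y. (if x 0 = g y then 1 else 0) \<partial>S \<partial>S)"
      by (simp only: indicator_def mem_Collect_eq drop_steps_comb_seq)
        (simp add: of_bool_def)
  qed measurable
  also have "\<dots> = (\<integral>\<^sup>+y. \<integral>\<^sup>+x. (if x 0 = g y then 1 else 0) \<partial>S \<partial>S)"
    by (rule SS.Fubini'[symmetric]) measurable
  also have "\<dots> = (\<integral>\<^sup>+y. 0 \<partial>S)"
  proof (intro nn_integral_cong)
    fix y
    have "(\<integral>\<^sup>+x. (if x 0 = g y then 1 else 0) \<partial>S) = (\<integral>\<^sup>+x. indicator {g y} (x 0) \<partial>S)"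
      by (intro nn_integral_cong) (auto simp: indicator_def)
    also have "\<dots> = 0" by (simp add: nn_integral_coordinate no_atoms)
    finally show "(\<integral>\<^sup>+x. (if x 0 = g y then 1 else 0) \<partial>S) = 0" .
  qed
  finally show ?thesis by (subst AE_iff_measurable[OF _ refl]) (auto simp del: One_nat_def)
qed

text \<open>Let \<open>i\<close> be the indicator of an infinite excess; it does not change when a step is dropped. Integrate
  \<open>running_max_recursion\<close> against \<open>i\<close>. Dropping a step preserves the expectation of the maximum up to
  \<open>N\<close>, while the maximum grows with \<open>N\<close>. So the expectation of \<open>x 0 - a\<close>, cut off at minus the maximum of
  the remaining path, is nonnegative on the event. The cut-off disappears there as \<open>N\<close> grows, and
  independence gives \<open>q * P \<le> p * P\<close> for the probability \<open>P\<close> of the event, whence \<open>P = 0\<close>. This is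
  the proof of the maximal ergodic theorem.\<close>

lemma AE_excess_finite:
  assumes drift: "(\<integral>\<^sup>+x. ennreal (x - a) \<partial>D) < (\<integral>\<^sup>+x. ennreal (a - x) \<partial>D)"
  shows "AE x in S. excess a x \<noteq> \<top>"
proof -
  define p q where "p = (\<integral>\<^sup>+x. ennreal (x - a) \<partial>D)" and "q = (\<integral>\<^sup>+x. ennreal (a - x) \<partial>D)"
  define i where "i x = (if excess a x = \<top> then 1 else 0 :: ennreal)" for x
  have [measurable]: "i \<in> borel_measurable S" unfolding i_def by measurable
  have i_shift: "i (drop_steps 1 x) = i x" for x unfolding i_def excess_eq_top_drop_steps ..
  define P where "P = (\<integral>\<^sup>+x. i x \<partial>S)"
  let ?cut = "\<lambda>N x. min (ennreal (running_max a N (drop_steps 1 x))) (ennreal (a - x 0))"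
  define E where "E N = (\<integral>\<^sup>+x. ennreal (running_max a N x) * i x \<partial>S)" for N
  have step: "(\<integral>\<^sup>+x. ennreal (running_max a (Suc N) x) * i x \<partial>S) +
      (\<integral>\<^sup>+x. ?cut N x * i x \<partial>S) = E N + p * P" for N
  proof -
    have "(\<integral>\<^sup>+x. ennreal (running_max a (Suc N) x) * i x \<partial>S) +
      (\<integral>\<^sup>+x. ?cut N x * i x \<partial>S) =
      (\<integral>\<^sup>+x. (ennreal (running_max a (Suc N) x) + ?cut N x) * i x \<partial>S)"
      unfolding distrib_right by (rule nn_integral_add[symmetric]) measurable
    also have "\<dots> = (\<integral>\<^sup>+x. ennreal (running_max a N (drop_steps 1 x)) * i (drop_steps 1 x) + ennreal (x 0 - a) * i (drop_steps 1 x) \<partial>S)"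
      unfolding running_max_recursion distrib_right i_shift ..
    also have "\<dots> = (\<integral>\<^sup>+x. ennreal (running_max a N (drop_steps 1 x)) * i (drop_steps 1 x) \<partial>S) + (\<integral>\<^sup>+x. ennreal (x 0 - a) * i (drop_steps 1 x) \<partial>S)"
      by (rule nn_integral_add) measurable
    also have "(\<integral>\<^sup>+x. ennreal (running_max a N (drop_steps 1 x)) * i (drop_steps 1 x) \<partial>S) = E N"
      unfolding E_def by (rule nn_integral_drop_steps[where f="\<lambda>x. ennreal (running_max a N x) * i x"]) measurable
    also have "(\<integral>\<^sup>+x. ennreal (x 0 - a) * i (drop_steps 1 x) \<partial>S) = p * P"
      unfolding p_def P_def by (rule nn_integral_first_step) measurable
    finally show ?thesis .
  qed
  have P1: "P \<le> 1"
  proof -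
    have "P \<le> (\<integral>\<^sup>+x. 1 \<partial>S)" unfolding P_def by (intro nn_integral_mono) (simp add: i_def)
    then show ?thesis using P.emeasure_space_1 by simp
  qed
  have pP: "p * P \<noteq> \<top>" using drift P1 unfolding p_def[symmetric] q_def[symmetric]
    by (auto simp: ennreal_mult_eq_top_iff top_unique)
  have E_fin: "E N \<noteq> \<top>" for N
  proof (induction N)
    case (Suc N)
    have "E (Suc N) \<le> E N + p * P" unfolding step[symmetric] E_def[of "Suc N"] by simp
    then show ?case using Suc pP by (auto simp: top_unique ennreal_add_eq_top)
  qed (simp add: E_def)
  have le: "(\<integral>\<^sup>+x. ?cut N x * i x \<partial>S) \<le> p * P" (is "?m N \<le> _") for N
  proof -
    have "E N \<le> E (Suc N)" unfolding E_def
      by (intro nn_integral_mono mult_right_mono ennreal_leI running_max_mono_Suc) simp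
    then have "E N + ?m N \<le> E N + p * P" unfolding step[symmetric] E_def[of "Suc N"] by (rule add_right_mono)
    then show ?thesis using E_fin[of N] by (simp add: ennreal_add_left_cancel_le)
  qed
  have "q * P = (\<integral>\<^sup>+x. ennreal (a - x 0) * i (drop_steps 1 x) \<partial>S)"
    unfolding q_def P_def by (rule nn_integral_first_step[symmetric]) measurable
  also have "\<dots> \<le> p * P"
  proof (rule LIMSEQ_le_const2)
    show "?m \<longlonglongrightarrow> (\<integral>\<^sup>+x. ennreal (a - x 0) * i (drop_steps 1 x) \<partial>S)"
    proof (rule nn_integral_LIMSEQ)
      show "incseq (\<lambda>N x. ?cut N x * i x)"
        by (intro incseq_SucI le_funI mult_right_mono min.mono ennreal_leI running_max_mono_Suc) auto
      show "(\<lambda>N. ?cut N x * i x)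
          \<longlonglongrightarrow> ennreal (a - x 0) * i (drop_steps 1 x)" for x
      proof (cases "excess a (drop_steps 1 x) = \<top>")
        case True
        have "(\<lambda>N. ?cut N x)
            \<longlonglongrightarrow> min (excess a (drop_steps 1 x)) (ennreal (a - x 0))"
          by (intro tendsto_min tendsto_const running_max_tendsto)
        moreover have "i (drop_steps 1 x) = 1" "i x = 1" using True i_shift[of x] by (auto simp: i_def)
        ultimately show ?thesis using True by simp
      next
        case False
        then have "i (drop_steps 1 x) = 0" "i x = 0" using i_shift[of x] by (auto simp: i_def)
        then show ?thesis by simp
      qed
    qed measurable
  qed (use le in auto)
  finally have qp: "q * P \<le> p * P" .
  have "P = 0"
  proof (rule ccontr)
    assume "P \<noteq> 0"
    then have "p * P < q * P"
      using drift P1 unfolding p_def[symmetric] q_def[symmetric]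
      by (intro ennreal_mult_strict_right_mono) (auto simp: zero_less_iff_neq_zero less_top[symmetric] top_unique)
    then show False using qp by simp
  qed
  then have "AE x in S. i x = 0" unfolding P_def by (subst (asm) nn_integral_0_iff_AE) auto
  then show ?thesis by eventually_elim (auto simp: i_def split: if_splits)
qed

text \<open>Let \<open>M\<close> be the excess and \<open>M'\<close> the excess without the first step. They have the same law, and
  where they are finite \<open>M - M'\<close> is \<open>x 0 - a\<close> plus a nonnegative term \<open>w\<close>, the part of \<open>a - x 0\<close> that
  exceeds \<open>M'\<close>. As \<open>M\<close> need not be integrable, truncate both at \<open>K\<close>, which makes the expectations equal;
  the differences stay above minus the negative part of \<open>x 0 - a\<close>, so Fatou's lemma gives
  expectation at most \<open>0\<close> for \<open>M - M'\<close>. As \<open>x 0 - a\<close> has mean \<open>0\<close>, the term \<open>w\<close> vanishes almost surely.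
  A path that stays below the line has \<open>M = 0\<close> and then \<open>x 0 = a - M'\<close>, which has probability \<open>0\<close> since
  \<open>x 0\<close> is independent of \<open>M'\<close> and has no atoms.\<close>

lemma AE_not_dominated_driftless:
  assumes drift: "(\<integral>\<^sup>+x. ennreal (x - a) \<partial>D) = (\<integral>\<^sup>+x. ennreal (a - x) \<partial>D)"
    and fin: "(\<integral>\<^sup>+x. ennreal (a - x) \<partial>D) \<noteq> \<top>"
  shows "AE x in S. \<not> dominated x (ereal a)"
proof -
  define q where "q = (\<integral>\<^sup>+x. ennreal (a - x) \<partial>D)"
  define j where "j x = (if excess a x = \<top> then 0 else 1 :: ennreal)" for x
  have [measurable]: "j \<in> borel_measurable S" unfolding j_def by measurable
  have j_shift: "j (drop_steps 1 x) = j x" for x unfolding j_def excess_eq_top_drop_steps ..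
  define P where "P = (\<integral>\<^sup>+x. j x \<partial>S)"
  have P1: "P \<le> 1"
  proof -
    have "P \<le> (\<integral>\<^sup>+x. 1 \<partial>S)" unfolding P_def by (intro nn_integral_mono) (simp add: j_def)
    then show ?thesis using P.emeasure_space_1 by simp
  qed
  have qP: "q * P \<noteq> \<top>" using fin P1 unfolding q_def[symmetric]
    by (auto simp: ennreal_mult_eq_top_iff top_unique)
  have plus: "(\<integral>\<^sup>+x. ennreal (x 0 - a) * j (drop_steps 1 x) \<partial>S) = q * P"
    unfolding q_def P_def drift[symmetric] by (rule nn_integral_first_step) measurable
  have minus: "(\<integral>\<^sup>+x. ennreal (a - x 0) * j (drop_steps 1 x) \<partial>S) = q * P"
    unfolding q_def P_def by (rule nn_integral_first_step) measurable
  define u where "u K x = min (excess a x) (ennreal (real K))" for K x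
  have [measurable]: "u K \<in> borel_measurable S" for K unfolding u_def by measurable
  define v where "v K x = (u K x + ennreal (a - x 0)) - u K (drop_steps 1 x)" for K x
  have [measurable]: "v K \<in> borel_measurable S" for K unfolding v_def by measurable
  have u_le: "u K (drop_steps 1 x) \<le> u K x + ennreal (a - x 0)" for K x
  proof -
    have "excess a (drop_steps 1 x) \<le> excess a (drop_steps 1 x) + ennreal (x 0 - a)" by simp
    also have "\<dots> \<le> excess a x + ennreal (a - x 0)"
      unfolding excess_recursion[symmetric] by (intro add_left_mono) simp
    finally show ?thesis unfolding u_def
      by (auto simp: min_def intro: order_trans add_increasing2)
  qed
  have int_v: "(\<integral>\<^sup>+x. v K x * j x \<partial>S) = q * P" for K
  proof -
    let ?U = "\<integral>\<^sup>+x. u K x * j x \<partial>S"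
    have "?U \<le> (\<integral>\<^sup>+x. ennreal (real K) \<partial>S)"
      by (intro nn_integral_mono) (auto simp: u_def j_def)
    then have U: "?U \<noteq> \<top>" using P.emeasure_space_1 by (auto simp: top_unique)
    have shift: "(\<integral>\<^sup>+x. u K (drop_steps 1 x) * j (drop_steps 1 x) \<partial>S) = ?U"
      by (rule nn_integral_drop_steps[where f="\<lambda>x. u K x * j x"]) measurable
    have "(\<integral>\<^sup>+x. v K x * j x \<partial>S) + ?U = (\<integral>\<^sup>+x. v K x * j x + u K (drop_steps 1 x) * j x \<partial>S)"
      unfolding shift[symmetric] j_shift by (rule nn_integral_add[symmetric]) measurable
    also have "\<dots> = (\<integral>\<^sup>+x. u K x * j x + ennreal (a - x 0) * j (drop_steps 1 x) \<partial>S)"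
    proof (intro nn_integral_cong)
      fix x
      have "v K x + u K (drop_steps 1 x) = u K x + ennreal (a - x 0)"
        unfolding v_def using u_le by (intro diff_add_cancel_ennreal)
      then show "v K x * j x + u K (drop_steps 1 x) * j x = u K x * j x + ennreal (a - x 0) * j (drop_steps 1 x)"
        unfolding j_shift by (metis distrib_right)
    qed
    also have "\<dots> = ?U + q * P" unfolding minus[symmetric] by (rule nn_integral_add) measurable
    finally show ?thesis using U by (simp add: add.commute ennreal_add_left_cancel)
  qed
  define w where "w x = ennreal (a - x 0) - min (excess a (drop_steps 1 x)) (ennreal (a - x 0))" for x
  have [measurable]: "w \<in> borel_measurable S" unfolding w_def by measurable
  have lim: "liminf (\<lambda>K. v K x * j x) = ennreal (x 0 - a) * j (drop_steps 1 x) + w x * j x" for x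
  proof (cases "excess a x = \<top>")
    case True
    then show ?thesis unfolding j_shift by (simp add: j_def Liminf_const)
  next
    case False
    then have False': "excess a (drop_steps 1 x) \<noteq> \<top>" by (simp only: excess_eq_top_drop_steps not_False_eq_True)
    obtain K0 :: nat where K0: "max (enn2real (excess a x)) (enn2real (excess a (drop_steps 1 x))) \<le> real K0"
      using real_arch_simple by blast
    have "v K x = ennreal (x 0 - a) + w x" if "K \<ge> K0" for K
    proof -
      have K: "enn2real (excess a x) \<le> real K" "enn2real (excess a (drop_steps 1 x)) \<le> real K"
        using K0 that by auto
      have "excess a x \<le> ennreal (real K)" "excess a (drop_steps 1 x) \<le> ennreal (real K)"
        using ennreal_leI[OF K(1)] ennreal_leI[OF K(2)] False False' ennreal_enn2real
        by (metis less_top)+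
      then have "v K x = (excess a x + ennreal (a - x 0)) - excess a (drop_steps 1 x)"
        by (simp add: v_def u_def min_def)
      also have "ennreal (a - x 0) = min (excess a (drop_steps 1 x)) (ennreal (a - x 0)) + w x"
        unfolding w_def by (simp add: add_diff_inverse_ennreal)
      also have "excess a x + (min (excess a (drop_steps 1 x)) (ennreal (a - x 0)) + w x) =
          excess a (drop_steps 1 x) + (ennreal (x 0 - a) + w x)"
        unfolding add.assoc[symmetric] excess_recursion ..
      finally show ?thesis using False' by simp
    qed
    then have "(\<lambda>K. v K x * j x) \<longlonglongrightarrow> (ennreal (x 0 - a) + w x) * j x"
      by (intro tendsto_eventually) (auto simp: eventually_sequentially intro!: exI[of _ K0])
    then have "liminf (\<lambda>K. v K x * j x) = (ennreal (x 0 - a) + w x) * j x"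
      by (intro lim_imp_Liminf) auto
    then show ?thesis by (simp only: distrib_right j_shift)
  qed
  have "q * P + (\<integral>\<^sup>+x. w x * j x \<partial>S) = (\<integral>\<^sup>+x. liminf (\<lambda>K. v K x * j x) \<partial>S)"
    unfolding lim plus[symmetric] by (rule nn_integral_add[symmetric]) measurable
  also have "\<dots> \<le> liminf (\<lambda>K. \<integral>\<^sup>+x. v K x * j x \<partial>S)" by (rule nn_integral_liminf) measurable
  also have "\<dots> = q * P + 0" unfolding int_v by (simp add: Liminf_const)
  finally have "(\<integral>\<^sup>+x. w x * j x \<partial>S) = 0" using qP by (simp add: ennreal_add_left_cancel_le)
  then have "AE x in S. w x * j x = 0" by (subst (asm) nn_integral_0_iff_AE) auto
  moreover have "AE x in S. x 0 \<noteq> a - enn2real (excess a (drop_steps 1 x))"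
    by (rule AE_first_step_neq[where g="\<lambda>y. a - enn2real (excess a y)"]) measurable
  ultimately show ?thesis
  proof eventually_elim
    case (elim x)
    show ?case
    proof
      assume "dominated x (ereal a)"
      then have 0: "excess a x = 0" by (simp add: excess_eq_0_iff)
      with elim have "w x = 0" by (simp add: j_def)
      then have "ennreal (a - x 0) \<le> excess a (drop_steps 1 x)"
        unfolding w_def by (auto simp: diff_eq_0_iff_ennreal min_def split: if_splits)
      with excess_recursion[of a x] 0 have eq: "ennreal (a - x 0) = excess a (drop_steps 1 x) + ennreal (x 0 - a)"
        by (simp add: min_def split: if_splits)
      have "x 0 \<le> a"
      proof (rule ccontr)
        assume "\<not> x 0 \<le> a"
        then have "ennreal (a - x 0) = 0" "ennreal (x 0 - a) > 0" by (auto simp: ennreal_neg)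
        then show False using eq by simp
      qed
      then have "ennreal (a - x 0) = excess a (drop_steps 1 x)" using eq by (simp add: ennreal_neg)
      then have "enn2real (excess a (drop_steps 1 x)) = a - x 0"
        using \<open>x 0 \<le> a\<close> by (metis diff_ge_0_iff_ge enn2real_ennreal)
      then show False using elim by simp
    qed
  qed
qed

end

section \<open>Lines steeper than the mean\<close>

text \<open>The identity \<open>x = (x - a) + a\<close> in terms of positive and negative parts, arranged such that it can be
  integrated when the negative part of \<open>x\<close> is not integrable.\<close>

lemma positive_part_balance:
  "ennreal x + ennreal (a - x) + ennreal (- a) = ennreal (- x) + ennreal (x - a) + ennreal a"
proof -
  have "max 0 x + max 0 (a - x) + max 0 (- a) = max 0 (- x) + max 0 (x - a) + max 0 a" by (auto simp: max_def)
  then have "ennreal (max 0 x + max 0 (a - x) + max 0 (- a)) = ennreal (max 0 (- x) + max 0 (x - a) + max 0 a)"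
    by (simp only:)
  then show ?thesis by (simp add: ennreal_plus)
qed

text \<open>A line of smaller slope \<open>c\<close> bounds the path, so after some time the slopes stay below the one at
  \<open>n0\<close>, and the maximum is one over finitely many times.\<close>

lemma maximal_slope_exists:
  assumes bound: "\<And>n. walk_of x n \<le> K + c * real n" and n0: "n0 \<ge> 1" "c < walk_of x n0 / real n0"
  shows "\<exists>N\<ge>1. dominated x (walk_of x N / N)"
proof -
  let ?r = "walk_of x n0 / real n0"
  obtain M :: nat where M: "K / (?r - c) < real M" using reals_Archimedean2 by blast
  define A where "A = {1..max M n0}"
  have A: "finite A" "n0 \<in> A" using n0 by (auto simp: A_def)
  then have "Max ((\<lambda>n. walk_of x n / n) ` A) \<in> (\<lambda>n. walk_of x n / n) ` A" by (intro Max_in) auto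
  then obtain N where N: "N \<in> A" "Max ((\<lambda>n. walk_of x n / n) ` A) = walk_of x N / N" by auto
  have max: "walk_of x n / n \<le> walk_of x N / N" if "n \<in> A" for n
    unfolding N(2)[symmetric] using A that by (intro Max_ge) auto
  have "walk_of x n / n \<le> walk_of x N / N" if "n \<ge> 1" for n
  proof (cases "n \<in> A")
    case False
    then have n: "n > M" using that by (auto simp: A_def)
    then have "K / (?r - c) < real n" using M by linarith
    then have "K < real n * (?r - c)" using n0 by (simp add: pos_divide_less_eq)
    then have "walk_of x n \<le> ?r * real n" using bound[of n] by (simp add: algebra_simps)
    then have "walk_of x n / n \<le> ?r" using that by (simp add: pos_divide_le_eq)
    then show ?thesis using max[OF A(2)] by simp
  qed (rule max)
  then have "dominated x (walk_of x N / N)" by (simp add: dominated_def)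
  moreover have "N \<ge> 1" using N(1) by (simp add: A_def)
  ultimately show ?thesis by blast
qed

text \<open>Take a time \<open>T\<close> at which \<open>walk_of x n - a * n\<close> is maximal.\<close>

lemma dominated_from_maximum:
  assumes bound: "\<And>n. walk_of x n \<le> K + c * real n" and ca: "c < a"
  shows "\<exists>T. dominated (drop_steps T x) (ereal a)"
proof -
  obtain M :: nat where M: "K / (a - c) < real M" using reals_Archimedean2 by blast
  let ?f = "\<lambda>n. walk_of x n - a * real n"
  have "Max (?f ` {..M}) \<in> ?f ` {..M}" by (intro Max_in) auto
  then obtain T where T: "Max (?f ` {..M}) = ?f T" by (rule imageE)
  have max: "?f n \<le> ?f T" if "n \<le> M" for n
    unfolding T[symmetric] using that by (intro Max_ge) auto
  have "?f n \<le> ?f T" for n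
  proof (cases "n \<le> M")
    case False
    then have "K / (a - c) < real n" using M by linarith
    then have "K < real n * (a - c)" using ca by (simp add: pos_divide_less_eq)
    then have "?f n \<le> 0" using bound[of n] by (simp add: algebra_simps)
    then show ?thesis using max[of 0] by simp
  qed (rule max)
  from this[of "T + k" for k] have "walk_of (drop_steps T x) k \<le> a * real k" for k
    unfolding walk_of_add of_nat_add by (simp add: algebra_simps)
  then have "dominated (drop_steps T x) (ereal a)" unfolding dominated_iff by blast
  then show ?thesis ..
qed

locale drift_walk = continuous_walk D for D +
  fixes \<mu> :: ereal
  assumes positive_part: "(\<integral>\<^sup>+x. ennreal x \<partial>D) \<noteq> \<top>"
    and mean: "\<mu> = enn2ereal (\<integral>\<^sup>+x. ennreal x \<partial>D) - enn2ereal (\<integral>\<^sup>+x. ennreal (- x) \<partial>D)"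
begin

lemma mean_drift:
  shows mean_less_imp: "\<mu> < ereal a \<Longrightarrow> (\<integral>\<^sup>+x. ennreal (x - a) \<partial>D) < (\<integral>\<^sup>+x. ennreal (a - x) \<partial>D)"
    and mean_eq_imp: "\<mu> = ereal a \<Longrightarrow> (\<integral>\<^sup>+x. ennreal (x - a) \<partial>D) = (\<integral>\<^sup>+x. ennreal (a - x) \<partial>D) \<and>
      (\<integral>\<^sup>+x. ennreal (a - x) \<partial>D) \<noteq> \<top>"
proof -
  define P Q p q where "P = (\<integral>\<^sup>+x. ennreal x \<partial>D)" and "Q = (\<integral>\<^sup>+x. ennreal (- x) \<partial>D)"
    and "p = (\<integral>\<^sup>+x. ennreal (x - a) \<partial>D)" and "q = (\<integral>\<^sup>+x. ennreal (a - x) \<partial>D)"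
  have D1: "emeasure D UNIV = 1" using M.emeasure_space_1 by simp
  have add3: "(\<integral>\<^sup>+x. f x + g x + c \<partial>D) = (\<integral>\<^sup>+x. f x \<partial>D) + (\<integral>\<^sup>+x. g x \<partial>D) + c"
    if "f \<in> borel_measurable borel" "g \<in> borel_measurable borel" for f g :: "real \<Rightarrow> ennreal" and c
  proof -
    have [measurable]: "f \<in> borel_measurable D" "g \<in> borel_measurable D"
      using that by (simp_all cong: measurable_cong_sets)
    show ?thesis by (simp add: nn_integral_add D1)
  qed
  have balance: "P + q + ennreal (- a) = Q + p + ennreal a"
  proof -
    have "P + q + ennreal (- a) = (\<integral>\<^sup>+x. ennreal x + ennreal (a - x) + ennreal (- a) \<partial>D)"
      unfolding P_def q_def by (rule add3[symmetric]) measurable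
    also have "\<dots> = (\<integral>\<^sup>+x. ennreal (- x) + ennreal (x - a) + ennreal a \<partial>D)"
      unfolding positive_part_balance ..
    also have "\<dots> = Q + p + ennreal a"
      unfolding Q_def p_def by (rule add3) measurable
    finally show ?thesis .
  qed
  have "p \<le> (\<integral>\<^sup>+x. ennreal x + ennreal (- a) \<partial>D)" unfolding p_def
  proof (intro nn_integral_mono)
    fix x :: real
    have "ennreal (x - a) \<le> ennreal (max 0 x + max 0 (- a))" by (intro ennreal_leI) (auto simp: max_def)
    also have "\<dots> = ennreal (max 0 x) + ennreal (max 0 (- a))" by simp
    also have "\<dots> = ennreal x + ennreal (- a)" by (simp add: max_def ennreal_neg)
    finally show "ennreal (x - a) \<le> ennreal x + ennreal (- a)" .
  qed
  also have "\<dots> = P + ennreal (- a)" unfolding P_def using add3[of ennreal "\<lambda>_. 0"] by simp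
  finally have p_fin: "p \<noteq> \<top>" using positive_part unfolding P_def[symmetric] by (auto simp: top_unique)
  obtain P' where P': "P = ennreal P'" "0 \<le> P'" using positive_part unfolding P_def[symmetric] by (cases P) auto
  obtain p' where p': "p = ennreal p'" "0 \<le> p'" using p_fin by (cases p) auto
  have real_balance: "P' + q' = Q' + p' + a" if "Q = ennreal Q'" "0 \<le> Q'" "q = ennreal q'" "0 \<le> q'" for Q' q'
  proof (cases "0 \<le> a")
    case True
    then show ?thesis using balance that P' p' by (simp add: ennreal_neg ennreal_plus[symmetric] del: ennreal_plus)
  next
    case False
    then have "ennreal (P' + q' + - a) = ennreal (Q' + p')"
      using balance that P' p' by (simp add: ennreal_neg ennreal_plus[symmetric] del: ennreal_plus)
    then show ?thesis using False that P' p' by (subst (asm) ennreal_inj) auto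
  qed
  show "p < q" if "\<mu> < ereal a"
  proof (cases Q)
    case (real Q')
    then have "P + q + ennreal (- a) \<noteq> \<top>" unfolding balance using p_fin by auto
    then obtain q' where q': "q = ennreal q'" "0 \<le> q'" by (cases q) auto
    have "P' + q' = Q' + p' + a" using real_balance real q' by blast
    moreover have "P' - Q' < a" using that P' real unfolding mean P_def[symmetric] Q_def[symmetric] by (simp add: enn2ereal_ennreal)
    ultimately have "p' < q'" by linarith
    then show ?thesis using p' q' by (simp add: ennreal_less_iff)
  next
    case top
    then have "q = \<top>" using balance P' by (auto simp: ennreal_add_eq_top)
    then show ?thesis using p_fin by (simp add: less_top)
  qed
  show "p = q \<and> q \<noteq> \<top>" if "\<mu> = ereal a"
  proof (cases Q)
    case (real Q')
    then have "P + q + ennreal (- a) \<noteq> \<top>" unfolding balance using p_fin by auto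
    then obtain q' where q': "q = ennreal q'" "0 \<le> q'" by (cases q) auto
    have "P' + q' = Q' + p' + a" using real_balance real q' by blast
    moreover have "P' - Q' = a" using that P' real unfolding mean P_def[symmetric] Q_def[symmetric] by (simp add: enn2ereal_ennreal)
    ultimately have "p' = q'" by linarith
    then show ?thesis using p' q' by simp
  next
    case top
    then show ?thesis using that P' unfolding mean P_def[symmetric] Q_def[symmetric] by (simp add: enn2ereal_ennreal)
  qed
qed

lemma mean_neq_infinity: "\<mu> \<noteq> \<infinity>"
proof -
  have "enn2ereal (\<integral>\<^sup>+x. ennreal x \<partial>D) \<noteq> \<infinity>" using positive_part by (metis enn2ereal_eq_top_iff infinity_ereal_def)
  moreover have "enn2ereal (\<integral>\<^sup>+x. ennreal x \<partial>D) \<ge> 0" "enn2ereal (\<integral>\<^sup>+x. ennreal (- x) \<partial>D) \<ge> 0" by auto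
  ultimately show ?thesis unfolding mean
    by (cases "enn2ereal (\<integral>\<^sup>+x. ennreal x \<partial>D)"; cases "enn2ereal (\<integral>\<^sup>+x. ennreal (- x) \<partial>D)") auto
qed

lemma AE_not_dominated_mean: "AE x in S. \<not> dominated x \<mu>"
proof (cases \<mu>)
  case (real a)
  then show ?thesis using AE_not_dominated_driftless[of a] mean_eq_imp[of a] by auto
next
  case MInf
  then show ?thesis by (auto simp: dominated_def)
qed (use mean_neq_infinity in simp)

lemma AE_steeper_lines_bound:
  "AE x in S. \<forall>r::rat. \<mu> < ereal (real_of_rat r) \<longrightarrow> excess (real_of_rat r) x \<noteq> \<top>"
  unfolding AE_all_countable using AE_excess_finite[OF mean_less_imp] by auto

lemma AE_regular: "AE x in S. regular x \<and> (\<forall>m. \<not> dominated (drop_steps m x) \<mu>)"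
proof -
  have "AE x in S. \<forall>m. (\<forall>r::rat. \<mu> < ereal (real_of_rat r) \<longrightarrow> excess (real_of_rat r) (drop_steps m x) \<noteq> \<top>)
      \<and> \<not> dominated (drop_steps m x) \<mu>"
    unfolding AE_all_countable
    by (intro allI AE_drop_steps[where Q="\<lambda>x. (\<forall>r::rat. \<mu> < ereal (real_of_rat r) \<longrightarrow> excess (real_of_rat r) x \<noteq> \<top>)
      \<and> \<not> dominated x \<mu>"] AE_conjI AE_steeper_lines_bound AE_not_dominated_mean)
  then show ?thesis
  proof eventually_elim
    case (elim x)
    have "\<exists>N\<ge>1. dominated (drop_steps m x) (walk_of (drop_steps m x) N / N)" for m
    proof -
      let ?y = "drop_steps m x"
      obtain n0 where n0: "n0 \<ge> 1" "\<mu> < ereal (walk_of ?y n0 / real n0)"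
        using elim unfolding dominated_def by (meson not_le)
      obtain r :: rat where r: "\<mu> < real_of_rat r" "ereal (real_of_rat r) < ereal (walk_of ?y n0 / real n0)"
        using ereal_dense3[OF n0(2)] by blast
      have "excess (real_of_rat r) ?y \<noteq> \<top>" using elim r by blast
      from excess_finite_bound[OF this] show ?thesis by (rule maximal_slope_exists) (use n0 r in auto)
    qed
    then show ?case using elim by (auto simp: regular_def)
  qed
qed

text \<open>Almost surely the path stays below the line of slope \<open>a\<close> from some time \<open>T\<close> on, and the probability of
  this is the same for each \<open>T\<close>.\<close>

lemma prob_dominated_pos:
  assumes "\<mu> < ereal a"
  shows "0 < measure S {x. dominated x (ereal a)}"
proof (rule ccontr)
  assume "\<not> 0 < measure S {x. dominated x (ereal a)}"
  then have 0: "measure S {x. dominated x (ereal a)} = 0" by (simp add: not_less measure_le_0_iff)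
  have "Measurable.pred S (\<lambda>x. dominated x (ereal a))" by measurable
  then have "AE x in S. \<not> dominated x (ereal a)"
    using 0 by (subst AE_iff_measurable[of "{x. dominated x (ereal a)}"]) (auto simp: pred_def P.emeasure_eq_measure)
  then have never: "AE x in S. \<forall>T. \<not> dominated (drop_steps T x) (ereal a)"
    unfolding AE_all_countable using AE_drop_steps by blast
  obtain r :: rat where r: "\<mu> < real_of_rat r" "ereal (real_of_rat r) < ereal a"
    using ereal_dense3[OF assms] by blast
  from never AE_steeper_lines_bound have "AE x in S. False"
  proof eventually_elim
    case (elim x)
    then have "excess (real_of_rat r) x \<noteq> \<top>" using r by blast
    from dominated_from_maximum[OF excess_finite_bound[OF this], of a] r elim show ?case by auto
  qed
  then show False using P.AE_False by auto
qed

end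

section \<open>The recursion along the first face\<close>

context continuous_walk
begin

text \<open>The lengths run through \<open>j + 1\<close>, as \<open>count_space\<close> starts at \<open>0\<close>. The law of a path is restricted to
  the event that it stays below its chord and not normalised.\<close>

definition face_measure :: "real list measure" where
  "face_measure = distr (density (count_space UNIV \<Otimes>\<^sub>M S) (\<lambda>(j, x). if below x (Suc j) then 1 else 0))
     segment_space (\<lambda>(j, x). segment (Suc j) x)"

lemma measurable_count_space_pair:
  assumes "\<And>j::nat. f j \<in> S \<rightarrow>\<^sub>M N"
  shows "(\<lambda>(j, x). f j x) \<in> count_space UNIV \<Otimes>\<^sub>M S \<rightarrow>\<^sub>M N"
  using assms by (intro measurable_pair_measure_countable1) auto

lemma sets_face_measure [simp, measurable_cong]: "sets face_measure = sets segment_space"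
  by (simp add: face_measure_def)

lemma space_face_measure [simp]: "space face_measure = space segment_space"
  by (simp add: face_measure_def)

lemma nn_integral_face_measure:
  assumes [measurable]: "g \<in> borel_measurable segment_space"
  shows "(\<integral>\<^sup>+z. g z \<partial>face_measure) =
    (\<Sum>j. \<integral>\<^sup>+x. (if below x (Suc j) then g (segment (Suc j) x) else 0) \<partial>S)"
proof -
  let ?C = "count_space (UNIV :: nat set)"
  have seg [measurable]: "(\<lambda>(j, x). segment (Suc j) x) \<in> ?C \<Otimes>\<^sub>M S \<rightarrow>\<^sub>M segment_space"
    by (rule measurable_count_space_pair) measurable
  have ind [measurable]: "(\<lambda>(j, x). if below x (Suc j) then 1 else 0 :: ennreal) \<in> borel_measurable (?C \<Otimes>\<^sub>M S)"
    by (rule measurable_count_space_pair) measurable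
  have "(\<integral>\<^sup>+z. g z \<partial>face_measure) =
      (\<integral>\<^sup>+p. (case p of (j, x) \<Rightarrow> if below x (Suc j) then 1 else 0) * g (case p of (j, x) \<Rightarrow> segment (Suc j) x) \<partial>(?C \<Otimes>\<^sub>M S))"
    unfolding face_measure_def
    by (subst nn_integral_distr, simp, simp, subst nn_integral_density) auto
  also have "\<dots> = (\<integral>\<^sup>+j. \<integral>\<^sup>+x. (if below x (Suc j) then 1 else 0) * g (segment (Suc j) x) \<partial>S \<partial>?C)"
    by (subst P.nn_integral_fst[symmetric]) auto
  also have "\<dots> = (\<Sum>j. \<integral>\<^sup>+x. (if below x (Suc j) then 1 else 0) * g (segment (Suc j) x) \<partial>S)"
    by (rule nn_integral_count_space_nat)
  also have "\<dots> = (\<Sum>j. \<integral>\<^sup>+x. (if below x (Suc j) then g (segment (Suc j) x) else 0) \<partial>S)"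
    by (intro suminf_cong nn_integral_cong) auto
  finally show ?thesis .
qed

text \<open>The end point of a path of given length has no atoms.\<close>

lemma face_measure_slope_eq: "emeasure face_measure {z \<in> space segment_space. slope z = y} = 0"
proof -
  have "emeasure face_measure {z \<in> space segment_space. slope z = y} =
      (\<integral>\<^sup>+z. (if slope z = y then 1 else 0) \<partial>face_measure)"
  proof -
    have "{z \<in> space segment_space. slope z = y} \<in> sets face_measure" by simp measurable
    then have "emeasure face_measure {z \<in> space segment_space. slope z = y} =
        (\<integral>\<^sup>+z. indicator {z \<in> space segment_space. slope z = y} z \<partial>face_measure)"
      by (rule nn_integral_indicator[symmetric])
    also have "\<dots> = (\<integral>\<^sup>+z. (if slope z = y then 1 else 0) \<partial>face_measure)"
      by (intro nn_integral_cong) (auto simp: indicator_def)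
    finally show ?thesis .
  qed
  also have "\<dots> = (\<Sum>j. \<integral>\<^sup>+x. (if below x (Suc j) then if slope (segment (Suc j) x) = y then 1 else 0 else 0) \<partial>S)"
    by (rule nn_integral_face_measure) measurable
  also have "\<dots> = (\<Sum>j. 0)"
  proof (intro suminf_cong)
    fix j
    have "AE x in S. (if below x (Suc j) then if slope (segment (Suc j) x) = y then 1 else 0 else 0 :: ennreal) = 0"
      using AE_walk_neq[of j "y * real (Suc j)"]
      by eventually_elim (auto simp: slope_segment field_simps)
    then show "(\<integral>\<^sup>+x. (if below x (Suc j) then if slope (segment (Suc j) x) = y then 1 else 0 else 0) \<partial>S) = 0"
      by (subst nn_integral_cong_AE) auto
  qed
  finally show ?thesis by simp
qed

end

context drift_walk
begin

context
  fixes a :: real and h :: "real list \<Rightarrow> real"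
  assumes a: "\<mu> < ereal a" and h_meas [measurable]: "h \<in> borel_measurable segment_space"
    and h: "\<And>z. 0 \<le> h z \<and> h z \<le> 1"
begin

text \<open>Faces of slope at most \<open>a\<close> do not contribute to products of weights.\<close>

definition weight :: "real list \<Rightarrow> ennreal" where
  "weight z = (if a < slope z then ennreal (h z) else 1)"

definition face_product :: "nat \<Rightarrow> (nat \<Rightarrow> real) \<Rightarrow> ennreal" where
  "face_product K x = (\<Prod>i<K. weight (face_segment (walk_of x) i))"

text \<open>The bound \<open>b\<close> on the slopes of the faces is the variable of the Volterra equation.\<close>

definition restricted_mean :: "nat \<Rightarrow> ereal \<Rightarrow> ennreal" where
  "restricted_mean K b = (\<integral>\<^sup>+x. (if dominated x b then face_product K x else 0) \<partial>S)"

lemma weight_measurable [measurable]: "weight \<in> borel_measurable segment_space"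
  unfolding weight_def[abs_def] by measurable

lemma face_product_measurable [measurable]: "face_product K \<in> borel_measurable S"
  unfolding face_product_def[abs_def]
  by (intro borel_measurable_prod_ennreal face_segment_measurable) auto

lemma restricted_mean_measurable [measurable]: "restricted_mean K \<in> borel_measurable borel"
  unfolding restricted_mean_def[abs_def] by measurable

lemma weight_le_1: "weight z \<le> 1"
  using h by (auto simp: weight_def)

lemma face_product_le_1: "face_product K x \<le> 1"
  unfolding face_product_def by (intro prod_le_1) (use weight_le_1 in auto)

lemma face_product_flat:
  assumes "regular x" "dominated x (ereal a)" shows "face_product K x = 1"
proof -
  have "\<not> a < slope (face_segment (walk_of x) i)" for i
    using slope_face_segment_le[OF assms, of i] by (simp add: not_less)
  then show ?thesis unfolding face_product_def weight_def by simp
qed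

lemma face_product_Suc:
  assumes "regular x" "first_face x N"
  shows "face_product (Suc K) x = weight (segment N x) * face_product K (drop_steps N x)"
  unfolding face_product_def prod.lessThan_Suc_shift by (simp add: face_segment_first_face[OF assms])

text \<open>Either no face is steeper than \<open>a\<close>, or the first face is, and it is cut off. At most one summand is
  nonzero.\<close>

lemma first_face_decomposition:
  assumes x: "regular x" and b: "ereal a \<le> b"
  shows "(if dominated x b then face_product (Suc K) x else 0) = (if dominated x (ereal a) then 1 else 0) +
    (\<Sum>j. if first_face x (Suc j) \<and> a < slope (segment (Suc j) x) \<and> ereal (slope (segment (Suc j) x)) \<le> b
         then ennreal (h (segment (Suc j) x)) * face_product K (drop_steps (Suc j) x) else 0)"
    (is "_ = _ + (\<Sum>j. ?g j)")
proof -
  obtain N where N: "first_face x N" using first_face_exists[OF x] .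
  then obtain m where m: "N = Suc m" by (cases N) (auto simp: first_face_def)
  let ?s = "slope (segment N x)"
  have s: "?s = walk_of x N / N" using m by (simp add: slope_segment)
  have dom: "dominated x c \<longleftrightarrow> ereal ?s \<le> c" for c
    unfolding s
  proof
    assume "dominated x c"
    moreover have "N \<ge> 1" using m by simp
    ultimately show "ereal (walk_of x N / N) \<le> c" unfolding dominated_def by blast
  qed (rule dominated_mono[OF first_face_dominated[OF N]])
  have zero: "?g j = 0" if "j \<notin> {m}" for j
  proof -
    have "\<not> first_face x (Suc j)" using first_face_unique[OF N, of "Suc j"] m that by blast
    then show ?thesis by simp
  qed
  have "(\<Sum>j. ?g j) = sum ?g {m}" by (rule suminf_finite) (use zero in auto)
  then have sum: "(\<Sum>j. ?g j) = ?g m" by (simp only: sum.insert sum.empty finite.emptyI empty_iff not_False_eq_True add_0_right)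
  show ?thesis
  proof (cases "dominated x (ereal a)")
    case True
    then have "dominated x b" using b by (rule dominated_mono)
    moreover have "?g m = 0" using True by (simp add: dom m)
    ultimately show ?thesis unfolding sum using True face_product_flat[OF x True] by simp
  next
    case False
    then have "weight (segment N x) = ennreal (h (segment N x))" by (simp add: dom weight_def)
    then show ?thesis unfolding sum using False N
      by (simp add: face_product_Suc[OF x N] m[symmetric] dom)
  qed
qed

text \<open>Expectations are taken in \<open>first_face_decomposition\<close>. The first \<open>j + 1\<close> steps are independent of the
  later ones, for which being dominated by the slope of the first face is the event in
  \<open>restricted_mean\<close>.\<close>

lemma restricted_mean_recursion:
  assumes b: "ereal a \<le> b"
  shows "restricted_mean (Suc K) b = ennreal (measure S {x. dominated x (ereal a)}) +
    (\<integral>\<^sup>+z. (if a < slope z \<and> ereal (slope z) \<le> b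
        then ennreal (h z) * restricted_mean K (ereal (slope z)) else 0) \<partial>face_measure)"
proof -
  define g where "g j x y = (if below x (Suc j) \<and> dominated y (ereal (slope (segment (Suc j) x))) \<and>
      a < slope (segment (Suc j) x) \<and> ereal (slope (segment (Suc j) x)) \<le> b
    then ennreal (h (segment (Suc j) x)) * face_product K y else 0)" for j x y
  let ?r = "\<lambda>j x. if below x (Suc j) then
      if a < slope (segment (Suc j) x) \<and> ereal (slope (segment (Suc j) x)) \<le> b
      then ennreal (h (segment (Suc j) x)) * restricted_mean K (ereal (slope (segment (Suc j) x))) else 0 else 0"
  have [measurable]: "(\<lambda>x. g j x (drop_steps (Suc j) x)) \<in> borel_measurable S" for j
    unfolding g_def by measurable
  have "restricted_mean (Suc K) b =
      (\<integral>\<^sup>+x. (if dominated x (ereal a) then 1 else 0) + (\<Sum>j. g j x (drop_steps (Suc j) x)) \<partial>S)"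
    unfolding restricted_mean_def
  proof (intro nn_integral_cong_AE, use AE_regular in eventually_elim)
    case (elim x)
    have "first_face x (Suc j) \<longleftrightarrow> below x (Suc j) \<and> dominated (drop_steps (Suc j) x) (ereal (slope (segment (Suc j) x)))" for j
      by (simp add: first_face_def slope_segment)
    then show ?case unfolding first_face_decomposition[OF conjunct1[OF elim] b] g_def by (simp add: conj_ac)
  qed
  also have "\<dots> = (\<integral>\<^sup>+x. (if dominated x (ereal a) then 1 else 0) \<partial>S) + (\<integral>\<^sup>+x. (\<Sum>j. g j x (drop_steps (Suc j) x)) \<partial>S)"
    by (rule nn_integral_add) measurable
  also have "(\<integral>\<^sup>+x. (if dominated x (ereal a) then 1 else 0) \<partial>S) = ennreal (measure S {x. dominated x (ereal a)})"
  proof -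
    have "Measurable.pred S (\<lambda>x. dominated x (ereal a))" by measurable
    then have [measurable]: "{x. dominated x (ereal a)} \<in> sets S" by (simp add: pred_def)
    have "(\<integral>\<^sup>+x. (if dominated x (ereal a) then 1 else 0) \<partial>S) = (\<integral>\<^sup>+x. indicator {x. dominated x (ereal a)} x \<partial>S)"
      by (intro nn_integral_cong) (auto simp: indicator_def)
    then show ?thesis by (simp add: P.emeasure_eq_measure)
  qed
  also have "(\<integral>\<^sup>+x. (\<Sum>j. g j x (drop_steps (Suc j) x)) \<partial>S) = (\<Sum>j. \<integral>\<^sup>+x. g j x (drop_steps (Suc j) x) \<partial>S)"
    by (rule nn_integral_suminf) measurable
  also have "(\<lambda>j. \<integral>\<^sup>+x. g j x (drop_steps (Suc j) x) \<partial>S) =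
      (\<lambda>j. \<integral>\<^sup>+x. ?r j x \<partial>S)"
  proof
    fix j
    have "(\<integral>\<^sup>+x. g j x (drop_steps (Suc j) x) \<partial>S) = (\<integral>\<^sup>+x. \<integral>\<^sup>+y. g j x y \<partial>S \<partial>S)"
    proof (subst nn_integral_split[where j="Suc j"])
      have "g j (comb_seq (Suc j) x y) (drop_steps (Suc j) (comb_seq (Suc j) x y)) = g j x y" for x y
        unfolding g_def below_comb_seq segment_comb_seq drop_steps_comb_seq ..
      then show "(\<integral>\<^sup>+x. \<integral>\<^sup>+y. g j (comb_seq (Suc j) x y) (drop_steps (Suc j) (comb_seq (Suc j) x y)) \<partial>S \<partial>S) =
          (\<integral>\<^sup>+x. \<integral>\<^sup>+y. g j x y \<partial>S \<partial>S)" by simp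
    qed measurable
    also have "\<dots> = (\<integral>\<^sup>+x. ?r j x \<partial>S)"
    proof (intro nn_integral_cong)
      fix x
      let ?s = "ereal (slope (segment (Suc j) x))"
      have mult: "(\<integral>\<^sup>+y. ennreal (h (segment (Suc j) x)) * (if dominated y ?s then face_product K y else 0) \<partial>S) =
          ennreal (h (segment (Suc j) x)) * restricted_mean K ?s"
        unfolding restricted_mean_def by (rule nn_integral_cmult) measurable
      then show "(\<integral>\<^sup>+y. g j x y \<partial>S) = ?r j x"
      proof (cases "below x (Suc j) \<and> a < slope (segment (Suc j) x) \<and> ?s \<le> b")
        case True
        then have "g j x y = ennreal (h (segment (Suc j) x)) * (if dominated y ?s then face_product K y else 0)" for y
          by (simp add: g_def)
        then show ?thesis using True mult by simp
      next
        case False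
        then have "g j x y = 0" for y by (auto simp: g_def)
        then show ?thesis using False by auto
      qed
    qed
    finally show "(\<integral>\<^sup>+x. g j x (drop_steps (Suc j) x) \<partial>S) = \<dots>" .
  qed
  also have "(\<Sum>j. \<integral>\<^sup>+x. ?r j x \<partial>S) =
      (\<integral>\<^sup>+z. (if a < slope z \<and> ereal (slope z) \<le> b
        then ennreal (h z) * restricted_mean K (ereal (slope z)) else 0) \<partial>face_measure)"
    by (rule nn_integral_face_measure[symmetric]) measurable
  finally show ?thesis .
qed

lemma restricted_mean_bounds:
  assumes "ereal a \<le> b"
  shows "ennreal (measure S {x. dominated x (ereal a)}) \<le> restricted_mean 0 b" "restricted_mean K b \<le> 1"
proof -
  have "Measurable.pred S (\<lambda>x. dominated x (ereal a))" by measurable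
  then have [measurable]: "{x. dominated x (ereal a)} \<in> sets S" by (simp add: pred_def)
  have "ennreal (measure S {x. dominated x (ereal a)}) = (\<integral>\<^sup>+x. indicator {x. dominated x (ereal a)} x \<partial>S)"
    by (simp add: P.emeasure_eq_measure)
  also have "\<dots> \<le> restricted_mean 0 b" unfolding restricted_mean_def face_product_def
    using assms by (intro nn_integral_mono) (auto simp: indicator_def dest: dominated_mono)
  finally show "ennreal (measure S {x. dominated x (ereal a)}) \<le> restricted_mean 0 b" .
  have "restricted_mean K b \<le> (\<integral>\<^sup>+x. 1 \<partial>S)" unfolding restricted_mean_def
    by (intro nn_integral_mono) (auto simp: face_product_le_1)
  then show "restricted_mean K b \<le> 1" using P.emeasure_space_1 by simp
qed

end

end

lemma decreasing_reals_to_ereal: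
  fixes \<mu> :: ereal
  assumes "\<mu> \<noteq> \<infinity>"
  obtains a :: "nat \<Rightarrow> real" where "decseq a" "\<And>n. \<mu> < ereal (a n)"
    "\<And>y::real. \<mu> < ereal y \<Longrightarrow> eventually (\<lambda>n. a n < y) sequentially"
proof (cases \<mu>)
  case (real m)
  show ?thesis
  proof (rule that[of "\<lambda>n. m + 1 / real (Suc n)"])
    show "decseq (\<lambda>n. m + 1 / real (Suc n))" by (intro decseq_SucI) (auto simp: field_simps)
    fix y :: real assume "\<mu> < ereal y"
    then show "eventually (\<lambda>n. m + 1 / real (Suc n) < y) sequentially"
      using real LIMSEQ_inverse_real_of_nat_add[of m] by (intro order_tendstoD(2)) (auto simp: inverse_eq_divide)
  qed (use real in auto)
next
  case MInf
  show ?thesis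
  proof (rule that[of "\<lambda>n. - real n"])
    fix y :: real
    obtain N :: nat where "- y < real N" using reals_Archimedean2 by blast
    then show "eventually (\<lambda>n. - real n < y) sequentially"
      by (auto simp: eventually_sequentially intro!: exI[of _ N])
  qed (use MInf in \<open>auto simp: decseq_def\<close>)
qed (use assms in simp)

context drift_walk
begin

definition steep_mass :: "real \<Rightarrow> ennreal" where
  "steep_mass a = (\<integral>\<^sup>+z. (if a < slope z then 1 else 0) \<partial>face_measure)"

text \<open>One step of the recursion for \<open>h = 1\<close>: its left side is at most \<open>1\<close>, and on the right the integrand
  is at least the positive probability that the path is dominated by \<open>a\<close>.\<close>

lemma steep_mass_finite:
  assumes a: "\<mu> < ereal a" shows "steep_mass a \<noteq> \<top>"
proof -
  let ?h = "\<lambda>_. 1 :: real"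
  define c where "c = measure S {x. dominated x (ereal a)}"
  have c: "0 < c" unfolding c_def by (rule prob_dominated_pos[OF a])
  have "ennreal c * steep_mass a = (\<integral>\<^sup>+z. ennreal c * (if a < slope z then 1 else 0) \<partial>face_measure)"
    unfolding steep_mass_def by (rule nn_integral_cmult[symmetric]) measurable
  also have "\<dots> \<le> (\<integral>\<^sup>+z. (if a < slope z \<and> ereal (slope z) \<le> \<top>
        then ennreal (?h z) * restricted_mean a ?h 0 (ereal (slope z)) else 0) \<partial>face_measure)"
    unfolding c_def by (intro nn_integral_mono)
      (auto intro!: restricted_mean_bounds(1)[OF a])
  also have "\<dots> \<le> restricted_mean a ?h 1 \<top>"
    unfolding One_nat_def by (subst restricted_mean_recursion[OF a]) (auto intro: add_increasing)
  also have "\<dots> \<le> 1" by (rule restricted_mean_bounds(2)[OF a]) auto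
  finally show ?thesis using c by (auto simp: ennreal_mult_top top_unique)
qed

text \<open>The recursion is the Volterra equation for the law \<open>\<nu>\<close> of the slope under \<open>face_measure\<close>, weighted
  by \<open>h\<close> and restricted to slopes greater than \<open>a\<close>.\<close>

lemma restricted_mean_tendsto:
  assumes a: "\<mu> < ereal a" and h_meas [measurable]: "h \<in> borel_measurable segment_space"
    and h: "\<And>z. 0 \<le> h z \<and> h z \<le> 1"
  shows "(\<lambda>K. restricted_mean a h K \<top>) \<longlonglongrightarrow> ennreal (measure S {x. dominated x (ereal a)} *
    exp (enn2real (\<integral>\<^sup>+z. (if a < slope z then ennreal (h z) else 0) \<partial>face_measure)))"
proof -
  define w where "w z = (if a < slope z then ennreal (h z) else 0)" for z
  have [measurable]: "w \<in> borel_measurable segment_space" unfolding w_def by measurable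
  define \<nu> where "\<nu> = distr (density face_measure w) borel (\<lambda>z. ereal (slope z))"
  have \<nu>_int: "(\<integral>\<^sup>+u. g u \<partial>\<nu>) = (\<integral>\<^sup>+z. w z * g (ereal (slope z)) \<partial>face_measure)"
    if [measurable]: "g \<in> borel_measurable borel" for g
    unfolding \<nu>_def by (subst nn_integral_distr, simp, simp, subst nn_integral_density) auto
  have \<nu>_em: "emeasure \<nu> A = (\<integral>\<^sup>+z. w z * indicator A (ereal (slope z)) \<partial>face_measure)"
    if [measurable]: "A \<in> sets borel" for A
    using \<nu>_int[of "indicator A"] by (simp add: \<nu>_def)
  have sets_\<nu>: "sets \<nu> = sets borel" by (simp add: \<nu>_def)
  have space_\<nu>: "space \<nu> = UNIV" by (simp add: \<nu>_def)
  have total: "emeasure \<nu> UNIV = (\<integral>\<^sup>+z. w z \<partial>face_measure)" by (simp add: \<nu>_em)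
  have "(\<integral>\<^sup>+z. w z \<partial>face_measure) \<le> steep_mass a"
    unfolding steep_mass_def w_def using h by (intro nn_integral_mono) auto
  then have "emeasure \<nu> (space \<nu>) \<noteq> \<infinity>"
    using steep_mass_finite[OF a] by (auto simp: space_\<nu> total top_unique)
  then have fin: "finite_measure \<nu>" by (rule finite_measureI)
  have no_atoms: "emeasure \<nu> {u} = 0" for u
  proof -
    have "AE z in face_measure. ereal (slope z) \<noteq> u"
    proof (cases u)
      case (real y)
      have "{z \<in> space segment_space. slope z = y} \<in> sets segment_space" by measurable
      then show ?thesis using real face_measure_slope_eq[of y]
        by (intro AE_I[of _ _ "{z \<in> space segment_space. slope z = y}"]) auto
    qed auto
    then have "AE z in face_measure. w z * indicator {u} (ereal (slope z)) = 0"
      by eventually_elim auto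
    then show ?thesis by (subst \<nu>_em, simp, subst nn_integral_cong_AE) auto
  qed
  have supp: "emeasure \<nu> {..<ereal a} = 0"
  proof -
    have "w z * indicator {..<ereal a} (ereal (slope z)) = 0" for z by (auto simp: w_def)
    then have "(\<integral>\<^sup>+z. w z * indicator {..<ereal a} (ereal (slope z)) \<partial>face_measure) = 0"
      by (intro nn_integral_zero') simp
    then show ?thesis by (simp only: \<nu>_em borel_open open_lessThan)
  qed
  have "(\<lambda>K. restricted_mean a h K \<top>) \<longlonglongrightarrow>
      ennreal (measure S {x. dominated x (ereal a)} * exp (measure \<nu> {..\<top>}))"
  proof (rule volterra_iterates_limit[OF fin sets_\<nu> no_atoms _ _ _ supp])
    fix K b assume b: "ereal a \<le> b"
    have "(\<integral>\<^sup>+u. restricted_mean a h K u * indicator {..b} u \<partial>\<nu>) =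
        (\<integral>\<^sup>+z. w z * (restricted_mean a h K (ereal (slope z)) * indicator {..b} (ereal (slope z))) \<partial>face_measure)"
      using restricted_mean_measurable[OF a h_meas h] by (intro \<nu>_int) simp
    also have "\<dots> = (\<integral>\<^sup>+z. (if a < slope z \<and> ereal (slope z) \<le> b
        then ennreal (h z) * restricted_mean a h K (ereal (slope z)) else 0) \<partial>face_measure)"
      by (intro nn_integral_cong) (auto simp: w_def indicator_def)
    finally show "restricted_mean a h (Suc K) b = ennreal (measure S {x. dominated x (ereal a)}) +
        (\<integral>\<^sup>+u. restricted_mean a h K u * indicator {..b} u \<partial>\<nu>)"
      unfolding restricted_mean_recursion[OF a h_meas h b] by simp
  qed (use restricted_mean_bounds[OF a h_meas h] in auto)
  moreover have "{..\<top>} = (UNIV :: ereal set)" by auto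
  ultimately show ?thesis unfolding w_def[symmetric] total[symmetric] by (simp add: measure_def)
qed

text \<open>For \<open>h = 1\<close> all products are \<open>1\<close>, hence so is the limit of their means.\<close>

lemma prob_dominated:
  assumes a: "\<mu> < ereal a"
  shows "measure S {x. dominated x (ereal a)} = exp (- enn2real (steep_mass a))"
proof -
  let ?h = "\<lambda>_. 1 :: real"
  have "(\<lambda>K. restricted_mean a ?h K \<top>) \<longlonglongrightarrow>
      ennreal (measure S {x. dominated x (ereal a)} * exp (enn2real (steep_mass a)))"
    using restricted_mean_tendsto[OF a, of ?h] by (simp add: steep_mass_def cong: if_cong)
  moreover have "restricted_mean a ?h K \<top> = 1" for K
  proof -
    have "restricted_mean a ?h K \<top> = (\<integral>\<^sup>+x. 1 \<partial>S)"
      unfolding restricted_mean_def[OF a, of ?h, simplified] face_product_def[OF a, of ?h, simplified] weight_def[OF a, of ?h, simplified]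
      by (intro nn_integral_cong) (auto simp: dominated_def cong: if_cong)
    then show ?thesis using P.emeasure_space_1 by simp
  qed
  ultimately have "ennreal (measure S {x. dominated x (ereal a)} * exp (enn2real (steep_mass a))) = 1"
    by (simp add: LIMSEQ_const_iff)
  then show ?thesis by (simp add: exp_minus field_simps flip: ennreal_1)
qed

lemma face_product_tendsto:
  assumes a: "\<mu> < ereal a" and h_meas [measurable]: "h \<in> borel_measurable segment_space"
    and h: "\<And>z. 0 \<le> h z \<and> h z \<le> 1"
  shows "(\<lambda>K. \<integral>\<^sup>+x. face_product a h K x \<partial>S) \<longlonglongrightarrow>
    ennreal (void_prob (\<integral>\<^sup>+z. (if a < slope z then ennreal (1 - h z) else 0) \<partial>face_measure))"
proof -
  define L H where "L = (\<integral>\<^sup>+z. (if a < slope z then ennreal (1 - h z) else 0) \<partial>face_measure)"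
    and "H = (\<integral>\<^sup>+z. (if a < slope z then ennreal (h z) else 0) \<partial>face_measure)"
  have "L + H = (\<integral>\<^sup>+z. (if a < slope z then ennreal (1 - h z) else 0) + (if a < slope z then ennreal (h z) else 0) \<partial>face_measure)"
    unfolding L_def H_def by (rule nn_integral_add[symmetric]) measurable
  also have "\<dots> = steep_mass a" unfolding steep_mass_def
    using h by (intro nn_integral_cong) (auto simp: ennreal_plus[symmetric] simp del: ennreal_plus)
  finally have LH: "L + H = steep_mass a" .
  then have "L \<noteq> \<top>" "H \<noteq> \<top>" using steep_mass_finite[OF a] by auto
  then have "measure S {x. dominated x (ereal a)} * exp (enn2real H) = void_prob L"
    unfolding prob_dominated[OF a] LH[symmetric]
    by (simp add: enn2real_plus less_top void_prob_def exp_add[symmetric])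
  moreover have "(\<integral>\<^sup>+x. face_product a h K x \<partial>S) = restricted_mean a h K \<top>" for K
    unfolding restricted_mean_def[OF a h_meas h] by (simp add: dominated_def)
  ultimately show ?thesis using restricted_mean_tendsto[OF a h_meas h] unfolding L_def[symmetric] H_def[symmetric] by simp
qed

end

section \<open>All slopes above the mean\<close>

context drift_walk
begin

text \<open>The means \<open>E K n\<close> for the threshold \<open>a n\<close> decrease both in the number \<open>K\<close> of faces and in \<open>n\<close>, as
  \<open>a n\<close> decreases to \<open>\<mu>\<close>. So the two limits commute. All faces are steeper than \<open>\<mu>\<close>, whence the
  product for the threshold \<open>a n\<close> finally agrees with the product of \<open>h\<close>.\<close>

lemma void_functional:
  assumes h_meas [measurable]: "h \<in> borel_measurable segment_space" and h: "\<And>z. 0 \<le> h z \<and> h z \<le> 1"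
  shows "(\<lambda>K. \<integral>\<^sup>+x. (\<Prod>i<K. ennreal (h (face_segment (walk_of x) i))) \<partial>S) \<longlonglongrightarrow>
    ennreal (void_prob (\<integral>\<^sup>+z. (if \<mu> < ereal (slope z) then ennreal (1 - h z) else 0) \<partial>face_measure))"
proof -
  obtain a where a: "decseq a" "\<And>n. \<mu> < ereal (a n)"
    "\<And>y::real. \<mu> < ereal y \<Longrightarrow> eventually (\<lambda>n. a n < y) sequentially"
    using decreasing_reals_to_ereal[OF mean_neq_infinity] by metis
  define L where "L = (\<integral>\<^sup>+z. (if \<mu> < ereal (slope z) then ennreal (1 - h z) else 0) \<partial>face_measure)"
  define l where "l n = (\<integral>\<^sup>+z. (if a n < slope z then ennreal (1 - h z) else 0) \<partial>face_measure)" for n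
  define F where "F K x = (\<Prod>i<K. ennreal (h (face_segment (walk_of x) i)))" for K x
  have F_meas [measurable]: "F K \<in> borel_measurable S" for K
    unfolding F_def[abs_def]
    by (intro borel_measurable_prod_ennreal face_segment_measurable[where h="\<lambda>z. ennreal (h z)"]) auto
  define E where "E K n = (\<integral>\<^sup>+x. face_product (a n) h K x \<partial>S)" for K n
  define G where "G K = (\<integral>\<^sup>+x. F K x \<partial>S)" for K
  have E_n: "(\<lambda>K. E K n) \<longlonglongrightarrow> ennreal (void_prob (l n))" for n
    unfolding E_def l_def by (rule face_product_tendsto[OF a(2) h_meas h])
  have E_K: "(\<lambda>n. E K n) \<longlonglongrightarrow> G K" for K
    unfolding E_def G_def
  proof (rule nn_integral_dominated_convergence[where w="\<lambda>_. 1"])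
    show "face_product (a n) h K \<in> borel_measurable S" for n
      by (rule face_product_measurable[OF a(2) h_meas h])
    show "AE x in S. face_product (a n) h K x \<le> 1" for n
      by (intro AE_I2 face_product_le_1[OF a(2) h_meas h])
    show "AE x in S. (\<lambda>n. face_product (a n) h K x) \<longlonglongrightarrow> F K x"
      using AE_regular
    proof eventually_elim
      case (elim x)
      have "eventually (\<lambda>n. weight (a n) h (face_segment (walk_of x) i) = ennreal (h (face_segment (walk_of x) i))) sequentially" for i
      proof -
        have "\<mu> < ereal (slope (face_segment (walk_of x) i))" using elim by (intro slope_face_segment_gt) auto
        from a(3)[OF this] show ?thesis
          by eventually_elim (simp add: weight_def[OF a(2) h_meas h])
      qed
      then have "eventually (\<lambda>n. \<forall>i\<in>{..<K}. weight (a n) h (face_segment (walk_of x) i) = ennreal (h (face_segment (walk_of x) i))) sequentially"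
        by (intro eventually_ball_finite) auto
      then have "eventually (\<lambda>n. face_product (a n) h K x = F K x) sequentially"
        unfolding face_product_def[OF a(2) h_meas h] F_def
        by eventually_elim (intro prod.cong, auto)
      then show ?case by (rule tendsto_eventually)
    qed
  qed (use P.emeasure_space_1 in auto)
  have E_dec: "decseq (\<lambda>n. E K n)" for K
  proof (intro decseq_SucI)
    fix n
    have "weight (a (Suc n)) h z \<le> weight (a n) h z" for z
      unfolding weight_def[OF a(2) h_meas h] using h[of z] decseq_SucD[OF a(1), of n] by auto
    then have "face_product (a (Suc n)) h K x \<le> face_product (a n) h K x" for x
      unfolding face_product_def[OF a(2) h_meas h] by (induction K) (auto intro: mult_mono)
    then show "E K (Suc n) \<le> E K n" unfolding E_def by (intro nn_integral_mono)
  qed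
  have E_dec': "decseq (\<lambda>K. E K n)" for n
  proof (intro decseq_SucI)
    fix K
    have "face_product (a n) h (Suc K) x \<le> face_product (a n) h K x" for x
      unfolding face_product_def[OF a(2) h_meas h] prod.lessThan_Suc
      by (metis mult.right_neutral mult_left_mono weight_le_1[OF a(2) h_meas h] zero_le)
    then show "E (Suc K) n \<le> E K n" unfolding E_def by (intro nn_integral_mono)
  qed
  have E_INF: "(INF n. E K n) = G K" for K using LIMSEQ_unique[OF LIMSEQ_INF[OF E_dec] E_K] .
  have E_INF': "(INF K. E K n) = ennreal (void_prob (l n))" for n
    using LIMSEQ_unique[OF LIMSEQ_INF[OF E_dec'] E_n] .
  have "decseq G"
    unfolding E_INF[symmetric] using E_dec' by (auto simp: decseq_def intro!: INF_mono)
  then have "G \<longlonglongrightarrow> (INF K. G K)" by (rule LIMSEQ_INF)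
  also have "(INF K. G K) = (INF n. ennreal (void_prob (l n)))"
    unfolding E_INF[symmetric] E_INF'[symmetric] by (rule INF_commute)
  also have "\<dots> = ennreal (void_prob L)"
  proof (rule LIMSEQ_unique[OF LIMSEQ_INF])
    show "decseq (\<lambda>n. ennreal (void_prob (l n)))"
      unfolding E_INF'[symmetric] using E_dec by (auto simp: decseq_def intro!: INF_mono)
    have "l \<longlonglongrightarrow> L" unfolding l_def[abs_def] L_def
    proof (rule nn_integral_LIMSEQ)
      show "incseq (\<lambda>n z. if a n < slope z then ennreal (1 - h z) else 0)"
      proof (intro incseq_SucI le_funI)
        fix n z
        show "(if a n < slope z then ennreal (1 - h z) else 0) \<le> (if a (Suc n) < slope z then ennreal (1 - h z) else 0)"
          using decseq_SucD[OF a(1), of n] by auto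
      qed
      show "(\<lambda>n. if a n < slope z then ennreal (1 - h z) else 0) \<longlonglongrightarrow> (if \<mu> < ereal (slope z) then ennreal (1 - h z) else 0)" for z
      proof (cases "\<mu> < ereal (slope z)")
        case True
        from a(3)[OF True] have "eventually (\<lambda>n. (if a n < slope z then ennreal (1 - h z) else 0) =
            (if \<mu> < ereal (slope z) then ennreal (1 - h z) else 0)) sequentially"
          by eventually_elim (simp add: True)
        then show ?thesis by (rule tendsto_eventually)
      next
        case False
        have "\<not> a n < slope z" for n
        proof
          assume "a n < slope z"
          then have "ereal (a n) < ereal (slope z)" by simp
          then show False using False a(2)[of n] by (meson order.strict_trans)
        qed
        then show ?thesis using False by simp
      qed
    qed measurable
    then show "(\<lambda>n. ennreal (void_prob (l n))) \<longlonglongrightarrow> ennreal (void_prob L)"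
      by (intro tendsto_ennrealI tendsto_void_prob)
  qed
  finally show ?thesis unfolding G_def[abs_def] F_def L_def .
qed

end

section \<open>Cyclic shifts\<close>

context continuous_walk
begin

lemma distr_permute:
  assumes "inj \<pi>" shows "distr S S (\<lambda>x. x \<circ> \<pi>) = S"
  using distr_PiM_reindex[of UNIV "\<lambda>_. D" \<pi> UNIV] assms M.prob_space_axioms
  by (simp add: comp_def restrict_UNIV)

text \<open>The indices from \<open>J\<close> on are fixed, which makes this a permutation of all steps.\<close>

definition cyclic :: "nat \<Rightarrow> nat \<Rightarrow> nat \<Rightarrow> nat" where
  "cyclic J m i = (if i < J then (m + i) mod J else i)"

lemma inj_cyclic: "inj (cyclic J m)"
proof (rule injI)
  fix i k assume eq: "cyclic J m i = cyclic J m k"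
  show "i = k"
  proof (cases "i < J \<and> k < J")
    case True
    then have "(m + i) mod J = (m + k) mod J" using eq by (simp add: cyclic_def)
    then obtain q r where "m + i + J * q = m + k + J * r" unfolding nat_mod_eq_iff by blast
    then have "i + J * q = k + J * r" by simp
    then have "i mod J = k mod J" unfolding nat_mod_eq_iff by blast
    then show ?thesis using True by simp
  next
    case False
    then show ?thesis using eq mod_less_divisor[of J "m + i"] mod_less_divisor[of J "m + k"]
      by (auto simp: cyclic_def split: if_splits)
  qed
qed

lemma walk_of_cyclic:
  assumes "m < J" "k \<le> J"
  shows "walk_of (x \<circ> cyclic J m) k + walk_of x m = walk_of x ((m + k) mod J) + (if J \<le> m + k then walk_of x J else 0)"
proof -
  define y where "y = x \<circ> cyclic J m"
  have "walk_of y k + walk_of x m = walk_of x ((m + k) mod J) + (if J \<le> m + k then walk_of x J else 0)"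
    using assms(2)
  proof (induction k)
    case 0
    then show ?case using assms by simp
  next
    case (Suc k)
    then have IH: "walk_of y k + walk_of x m = walk_of x ((m + k) mod J) + (if J \<le> m + k then walk_of x J else 0)"
      and k: "k < J" by auto
    have step: "y k = x ((m + k) mod J)" using k by (simp add: y_def cyclic_def)
    consider "m + k < J - 1" | "m + k = J - 1" | "J \<le> m + k" using k by linarith
    then show ?case
    proof cases
      case 1
      then have "m + Suc k < J" by linarith
      then show ?thesis using IH step by (simp add: walk_of_Suc)
    next
      case 2
      then have "Suc (m + k) = J" using k by simp
      then show ?thesis using IH step by (auto simp: walk_of_Suc)
    next
      case 3
      then have "(m + k) mod J = m + k - J" "(m + Suc k) mod J = Suc (m + k - J)"
        using k assms(1) Suc.prems by (auto simp: mod_if Suc_diff_le)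
      then show ?thesis using IH step 3 by (simp add: walk_of_Suc)
    qed
  qed
  then show ?thesis by (simp only: y_def)
qed

text \<open>Let \<open>d x k\<close> be the height of the path at time \<open>k\<close> above its chord of length \<open>J\<close>. The path with
  its steps rotated by \<open>m\<close> stays below its chord if and only if \<open>d x\<close> has its strict maximum over
  \<open>{..<J}\<close> at \<open>m\<close>. Almost surely the values of \<open>d x\<close> are distinct, so this holds for exactly one of the
  \<open>J\<close> rotations, all of which have the same law.\<close>

lemma prob_below: "emeasure S {x. below x (Suc n)} = ennreal (1 / real (Suc n))"
proof -
  define J where "J = Suc n"
  define d where "d x k = walk_of x k - (real k / real J) * walk_of x J" for x k
  define B where "B m = {x. \<forall>k<J. k \<noteq> m \<longrightarrow> d x k < d x m}" for m
  have J: "J > 0" by (simp add: J_def)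
  have B_meas [measurable]: "B m \<in> sets S" for m
  proof -
    have "{x \<in> space S. \<forall>k<J. k \<noteq> m \<longrightarrow> d x k < d x m} \<in> sets S" unfolding d_def by measurable
    then show ?thesis by (simp add: B_def)
  qed
  have B0: "B 0 = {x. below x J}"
  proof -
    have "below x J \<longleftrightarrow> (\<forall>k<J. k \<noteq> 0 \<longrightarrow> d x k < d x 0)" for x
      unfolding below_def d_def by (auto simp: Suc_le_eq)
    then show ?thesis by (auto simp: B_def)
  qed
  have shifted: "d (x \<circ> cyclic J m) k = d x ((m + k) mod J) - d x m" if "m < J" "k < J" for x m k
  proof -
    have full: "walk_of (x \<circ> cyclic J m) J = walk_of x J"
      using walk_of_cyclic[of m J J x] that by simp
    show ?thesis
    proof (cases "J \<le> m + k")
      case True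
      then have "(m + k) mod J = m + k - J" using that by (simp add: mod_if)
      moreover have "real (m + k - J) = real m + real k - real J" using True by simp
      ultimately show ?thesis using walk_of_cyclic[of m J k x] that True J
        unfolding d_def full by (simp add: diff_divide_distrib add_divide_distrib algebra_simps)
    next
      case False
      then show ?thesis using walk_of_cyclic[of m J k x] that
        unfolding d_def full by (simp add: add_divide_distrib algebra_simps)
    qed
  qed
  have B_shift: "x \<circ> cyclic J m \<in> B 0 \<longleftrightarrow> x \<in> B m" if m: "m < J" for x m
  proof -
    have "x \<circ> cyclic J m \<in> B 0 \<longleftrightarrow> (\<forall>k<J. k \<noteq> 0 \<longrightarrow> d x ((m + k) mod J) < d x m)"
      unfolding B_def using shifted[OF m, of _ x] shifted[OF m J, of x] m by auto
    also have "\<dots> \<longleftrightarrow> (\<forall>l<J. l \<noteq> m \<longrightarrow> d x l < d x m)"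
    proof safe
      fix l assume *: "\<forall>k<J. k \<noteq> 0 \<longrightarrow> d x ((m + k) mod J) < d x m" and l: "l < J" "l \<noteq> m"
      \<comment> \<open>the index that the rotation by \<open>m\<close> carries to \<open>l\<close>\<close>
      define k where "k = (if m \<le> l then l - m else J + l - m)"
      have "k < J" "k \<noteq> 0" "(m + k) mod J = l" using l m by (auto simp: k_def)
      then show "d x l < d x m" using * by metis
    next
      fix k assume *: "\<forall>l<J. l \<noteq> m \<longrightarrow> d x l < d x m" and k: "k < J" "0 < k"
      have "(m + k) mod J \<noteq> m" using k m by (cases "m + k < J") (auto simp: mod_if)
      then show "d x ((m + k) mod J) < d x m" using * J by simp
    qed
    finally show ?thesis by (simp add: B_def)
  qed
  have eq: "emeasure S (B m) = emeasure S (B 0)" if m: "m < J" for m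
  proof -
    have meas: "(\<lambda>x. x \<circ> cyclic J m) \<in> S \<rightarrow>\<^sub>M S"
      unfolding comp_def by (rule measurable_PiM_single') (auto simp: space_PiM)
    have "emeasure S (B 0) = emeasure (distr S S (\<lambda>x. x \<circ> cyclic J m)) (B 0)"
      unfolding distr_permute[OF inj_cyclic] ..
    also have "\<dots> = emeasure S ((\<lambda>x. x \<circ> cyclic J m) -` B 0 \<inter> space S)"
      by (rule emeasure_distr[OF meas]) measurable
    also have "(\<lambda>x. x \<circ> cyclic J m) -` B 0 \<inter> space S = B m" using B_shift[OF m] by auto
    finally show ?thesis ..
  qed
  have "AE x in S. d x k \<noteq> d x l" if kl: "k < l" "l < J" for k l
  proof -
    \<comment> \<open>coefficients of \<open>d x l - d x k\<close>; the last one is nonzero because \<open>l < J\<close>\<close>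
    define c where "c i = (if i < l then 1 else 0) - (if i < k then 1 else 0) - (real l - real k) / real J" for i
    have c: "c n \<noteq> 0" using kl by (auto simp: c_def J_def)
    have sum: "(\<Sum>i<J. c i * x i) = d x l - d x k" for x
    proof -
      have part: "(\<Sum>i<J. (if i < r then 1 else 0) * x i) = walk_of x r" if "r \<le> J" for r
      proof -
        have "(\<Sum>i<J. (if i < r then 1 else 0) * x i) = (\<Sum>i\<in>{..<J} \<inter> {..<r}. x i)"
          by (subst sum.inter_restrict) (auto intro!: sum.cong)
        also have "{..<J} \<inter> {..<r} = {..<r}" using that by auto
        finally show ?thesis by (simp add: walk_of_def)
      qed
      have "(\<Sum>i<J. c i * x i) = (\<Sum>i<J. (if i < l then 1 else 0) * x i) - (\<Sum>i<J. (if i < k then 1 else 0) * x i)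
          - (real l - real k) / real J * (\<Sum>i<J. x i)"
        unfolding c_def left_diff_distrib sum_subtractf sum_distrib_left ..
      then show ?thesis using kl part[of l] part[of k]
        by (simp add: d_def walk_of_def[of x J] left_diff_distrib diff_divide_distrib)
    qed
    from AE_linear_combination_neq[of c n 0, OF c] show ?thesis
      unfolding J_def[symmetric] sum by eventually_elim auto
  qed
  then have "AE x in S. \<forall>k l. k < l \<and> l < J \<longrightarrow> d x k \<noteq> d x l" unfolding AE_all_countable by auto
  then have "AE x in S. (\<Sum>m<J. indicator (B m) x) = (1 :: ennreal)"
  proof eventually_elim
    case (elim x)
    have "Max (d x ` {..<J}) \<in> d x ` {..<J}" using J by (intro Max_in) auto
    then obtain m where m: "Max (d x ` {..<J}) = d x m" "m \<in> {..<J}" by (rule imageE)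
    have lt: "d x k < d x m" if "k < J" "k \<noteq> m" for k
    proof -
      have "d x k \<le> d x m" unfolding m(1)[symmetric] using that by (intro Max_ge) auto
      moreover have "d x k \<noteq> d x m" using elim that m(2) by (metis lessThan_iff linorder_neqE_nat)
      ultimately show ?thesis by simp
    qed
    then have "x \<in> B m" by (auto simp: B_def)
    moreover have "x \<notin> B k" if "k \<in> {..<J} - {m}" for k
      using lt[of k] that m(2) by (auto simp: B_def dest!: spec[of _ m])
    ultimately show ?case using m(2) by (subst sum.remove[of _ m]) auto
  qed
  then have "(\<integral>\<^sup>+x. (\<Sum>m<J. indicator (B m) x) \<partial>S) = (\<integral>\<^sup>+x. 1 \<partial>S)" by (rule nn_integral_cong_AE)
  then have "(\<Sum>m<J. emeasure S (B m)) = 1" using P.emeasure_space_1 by (subst (asm) nn_integral_sum) auto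
  moreover have "(\<Sum>m<J. emeasure S (B m)) = (\<Sum>m<J. ennreal (measure S (B 0)))"
    unfolding P.emeasure_eq_measure[of "B 0", symmetric] by (intro sum.cong refl eq) simp
  ultimately have "(\<Sum>m<J. ennreal (measure S (B 0))) = 1" by simp
  then have "ennreal (\<Sum>m<J. measure S (B 0)) = ennreal 1"
    by (subst sum_ennreal[symmetric]) auto
  then have "(\<Sum>m<J. measure S (B 0)) = 1" by (subst (asm) ennreal_inj) (auto intro!: sum_nonneg)
  then have "real J * measure S (B 0) = 1" by simp
  then have "measure S (B 0) = 1 / real J" using J by (simp add: field_simps)
  then show ?thesis unfolding B0 by (simp add: P.emeasure_eq_measure J_def)
qed

end

section \<open>The faces of the concave majorant\<close>

theorem theorem9:
  fixes M :: "'a measure" and X :: "nat \<Rightarrow> 'a \<Rightarrow> real" and \<mu> :: ereal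
  assumes "prob_space M"
    and "prob_space.indep_vars M (\<lambda>_. borel) X {1..}"
    and "\<forall>i\<ge>1. distr M borel (X i) = distr M borel (X 1)"
    and "\<forall>x. emeasure (distr M borel (X 1)) {x} = 0"
    and "has_ext_mean M (X 1)"
    and "\<mu> = ext_mean M (X 1)"
    and "\<mu> < \<infinity>"
  shows "(AE \<omega> in M. (\<exists>C. is_concave_majorant (walk X \<omega>) C) \<and>
            infinite (contact_times (walk X \<omega>)) \<and> contact_time (walk X \<omega>) 0 = 0) \<and>
         lists_poisson_process M (face_intensity M X \<mu>) (\<lambda>i \<omega>. face_segment (walk X \<omega>) i)"
proof -
  interpret MP: prob_space M by fact
  have X_meas: "X i \<in> borel_measurable M" if "i \<ge> 1" for i
    using assms(2) that unfolding MP.indep_vars_def by auto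
  define D where "D = distr M borel (X 1)"
  have D_prob: "prob_space D" unfolding D_def using X_meas by (intro MP.prob_space_distr) auto
  have D_int: "(\<integral>\<^sup>+x. f x \<partial>D) = (\<integral>\<^sup>+\<omega>. f (X 1 \<omega>) \<partial>M)" if "f \<in> borel_measurable borel" for f
    unfolding D_def using X_meas that by (subst nn_integral_distr) auto
  have pos: "(\<integral>\<^sup>+x. ennreal x \<partial>D) \<noteq> \<top>"
  proof
    assume top: "(\<integral>\<^sup>+x. ennreal x \<partial>D) = \<top>"
    then have "(\<integral>\<^sup>+\<omega>. ennreal (- X 1 \<omega>) \<partial>M) \<noteq> \<top>"
      using assms(5) D_int[of ennreal] by (auto simp: has_ext_mean_def)
    then have "\<mu> = \<infinity>"
      unfolding assms(6) ext_mean_def using top D_int[of ennreal]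
      by (cases "\<integral>\<^sup>+\<omega>. ennreal (- X 1 \<omega>) \<partial>M") (auto simp: enn2ereal_ennreal)
    then show False using assms(7) by simp
  qed
  interpret drift_walk D \<mu>
  proof (intro drift_walk.intro continuous_walk.intro sequence_space.intro product_prob_spaceI
      continuous_walk_axioms.intro drift_walk_axioms.intro)
    show "\<mu> = enn2ereal (\<integral>\<^sup>+x. ennreal x \<partial>D) - enn2ereal (\<integral>\<^sup>+x. ennreal (- x) \<partial>D)"
      unfolding assms(6) ext_mean_def by (simp add: D_int)
  qed (use D_prob pos assms(4) in \<open>auto simp: D_def\<close>)
  define \<xi> where "\<xi> \<omega> = (\<lambda>i. X (Suc i) \<omega>)" for \<omega>
  have \<xi>_meas [measurable]: "\<xi> \<in> M \<rightarrow>\<^sub>M S"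
  proof (rule measurable_PiM_single')
    show "(\<lambda>\<omega>. \<xi> \<omega> i) \<in> M \<rightarrow>\<^sub>M D" for i
      using X_meas[of "Suc i"] by (simp add: \<xi>_def cong: measurable_cong_sets)
  qed (auto simp: space_PiM)
  have \<xi>_distr: "distr M S \<xi> = S"
  proof -
    let ?B = "PiM {1..} (\<lambda>_. borel :: real measure)" and ?g = "\<lambda>y. \<lambda>n\<in>UNIV. y (Suc n) :: real"
    have "distr M ?B (\<lambda>\<omega>. \<lambda>i\<in>{1..}. X i \<omega>) = PiM {1..} (\<lambda>i. distr M borel (X i))"
    proof (rule MP.indep_vars_iff_distr_eq_PiM'[THEN iffD1])
      show "X i \<in> borel_measurable M" if "i \<in> {1..}" for i using that by (intro X_meas) simp
    qed (use assms(2) in simp_all)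
    also have "\<dots> = PiM {1..} (\<lambda>_. D)"
    proof (intro PiM_cong refl)
      show "distr M borel (X i) = D" if "i \<in> {1..}" for i
        unfolding D_def using assms(3) that by blast
    qed
    finally have joint: "distr M ?B (\<lambda>\<omega>. \<lambda>i\<in>{1..}. X i \<omega>) = PiM {1..} (\<lambda>_. D)" .
    have g_meas: "?g \<in> ?B \<rightarrow>\<^sub>M S"
    proof (rule measurable_PiM_single')
      show "(\<lambda>y. ?g y i) \<in> ?B \<rightarrow>\<^sub>M D" for i
        using measurable_component_singleton[of "Suc i" "{1..}" "\<lambda>_. borel :: real measure"]
        by (simp cong: measurable_cong_sets)
    qed (auto simp: space_PiM)
    have "S = distr (PiM {1..} (\<lambda>_. D)) S ?g"
      using distr_PiM_reindex[of "{1..}" "\<lambda>_. D" Suc UNIV] D_prob by auto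
    also have "\<dots> = distr (distr M ?B (\<lambda>\<omega>. \<lambda>i\<in>{1..}. X i \<omega>)) S ?g" unfolding joint ..
    also have "\<dots> = distr M S (?g \<circ> (\<lambda>\<omega>. \<lambda>i\<in>{1..}. X i \<omega>))"
      by (intro distr_distr g_meas measurable_restrict) (auto intro: X_meas)
    also have "?g \<circ> (\<lambda>\<omega>. \<lambda>i\<in>{1..}. X i \<omega>) = \<xi>" by (auto simp: \<xi>_def fun_eq_iff)
    finally show ?thesis ..
  qed
  have transfer: "(\<integral>\<^sup>+\<omega>. f (\<xi> \<omega>) \<partial>M) = (\<integral>\<^sup>+x. f x \<partial>S)" if "f \<in> borel_measurable S" for f
    using nn_integral_distr[OF \<xi>_meas, of f] that by (simp add: \<xi>_distr)
  have walk: "walk X \<omega> = walk_of (\<xi> \<omega>)" for \<omega>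
  proof
    fix n show "walk X \<omega> n = walk_of (\<xi> \<omega>) n"
      by (induction n) (simp_all add: walk_def walk_of_def \<xi>_def)
  qed
  have reg: "AE \<omega> in M. regular (\<xi> \<omega>)"
    using AE_distrD[OF \<xi>_meas, of regular] AE_regular unfolding \<xi>_distr by auto
  define \<nu> where "\<nu> = density face_measure (\<lambda>z. if \<mu> < ereal (slope z) then 1 else 0)"
  have intensity: "face_intensity M X \<mu> = \<nu>"
  proof (rule measure_eqI)
    fix A assume "A \<in> sets (face_intensity M X \<mu>)"
    then have A [measurable]: "A \<in> sets segment_space" by simp
    let ?f = "\<lambda>j x. if below x (Suc j) then
      if \<mu> < ereal (slope (segment (Suc j) x)) \<and> segment (Suc j) x \<in> A then 1 else 0 else 0 :: ennreal"
    have "emeasure (face_intensity_on M X \<mu> (Suc j)) A =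
        (\<integral>\<^sup>+x. ?f j x \<partial>S)" for j
    proof -
      let ?c = "ennreal (1 / real (Suc j))"
      have B: "emeasure M (below_chord M X (Suc j)) = ?c"
      proof -
        have "below_chord M X (Suc j) = \<xi> -` {x. below x (Suc j)} \<inter> space M"
          by (auto simp: below_chord_def below_def walk)
        moreover have "{x. below x (Suc j)} \<in> sets S"
        proof -
          have "{x \<in> space S. below x (Suc j)} \<in> sets S" by measurable
          then show ?thesis by simp
        qed
        ultimately have "emeasure M (below_chord M X (Suc j)) = emeasure (distr M S \<xi>) {x. below x (Suc j)}"
          by (simp add: emeasure_distr)
        then show ?thesis unfolding \<xi>_distr prob_below .
      qed
      have steep: "ereal (real (Suc j)) * \<mu> < ereal (walk X \<omega> (Suc j)) \<longleftrightarrow> \<mu> < ereal (slope (segment (Suc j) (\<xi> \<omega>)))" for \<omega>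
        unfolding walk slope_segment[of "Suc j", simplified]
        by (cases \<mu>) (auto simp: field_simps)
      let ?E = "{\<omega> \<in> below_chord M X (Suc j). map (walk X \<omega>) [1..<Suc (Suc j)] \<in> A \<and>
          ereal (real (Suc j)) * \<mu> < ereal (walk X \<omega> (Suc j))}"
      have E: "?E = {\<omega> \<in> space M. below (\<xi> \<omega>) (Suc j) \<and> segment (Suc j) (\<xi> \<omega>) \<in> A \<and> \<mu> < ereal (slope (segment (Suc j) (\<xi> \<omega>)))}"
        unfolding steep by (auto simp: below_chord_def below_def walk segment_def)
      have "emeasure M ?E = (\<integral>\<^sup>+\<omega>. indicator ?E \<omega> \<partial>M)"
        unfolding E by (subst nn_integral_indicator) measurable
      also have "\<dots> = (\<integral>\<^sup>+\<omega>. ?f j (\<xi> \<omega>) \<partial>M)"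
        unfolding E by (intro nn_integral_cong) (auto simp: indicator_def)
      also have "\<dots> = (\<integral>\<^sup>+x. ?f j x \<partial>S)" by (rule transfer) measurable
      finally have E_int: "emeasure M ?E = (\<integral>\<^sup>+x. ?f j x \<partial>S)" .
      have "emeasure (face_intensity_on M X \<mu> (Suc j)) A = ?c * (emeasure M ?E / ?c)"
        using emeasure_face_intensity_on[of X M "Suc j" A \<mu>] X_meas A by (simp add: B del: upt_Suc)
      also have "\<dots> = emeasure M ?E"
        unfolding ennreal_times_divide by (subst mult.commute, rule mult_divide_eq_ennreal) auto
      finally show ?thesis unfolding E_int .
    qed
    then have "emeasure (face_intensity M X \<mu>) A =
        (\<Sum>j. \<integral>\<^sup>+x. ?f j x \<partial>S)"
      by (simp add: emeasure_face_intensity[OF A])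
    also have "\<dots> = (\<integral>\<^sup>+z. (if \<mu> < ereal (slope z) \<and> z \<in> A then 1 else 0) \<partial>face_measure)"
      by (rule nn_integral_face_measure[symmetric]) measurable
    also have "\<dots> = (\<integral>\<^sup>+z. (if \<mu> < ereal (slope z) then 1 else 0) * indicator A z \<partial>face_measure)"
      by (intro nn_integral_cong) (auto simp: indicator_def)
    also have "\<dots> = emeasure \<nu> A" unfolding \<nu>_def by (rule emeasure_density[symmetric]) measurable
    finally show "emeasure (face_intensity M X \<mu>) A = emeasure \<nu> A" .
  qed (simp add: \<nu>_def)
  have "lists_poisson_process M \<nu> (\<lambda>i \<omega>. face_segment (walk X \<omega>) i)"
  proof (rule MP.lists_poisson_processI)
    show "AE \<omega> in M. face_segment (walk X \<omega>) i \<in> space \<nu>" for i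
      using reg by eventually_elim (simp add: \<nu>_def space_segment_space walk face_segment_neq_Nil)
    fix i A assume "A \<in> sets \<nu>"
    then have A [measurable]: "A \<in> sets segment_space" by (simp add: \<nu>_def)
    have "Measurable.pred S (\<lambda>x. face_segment (walk_of x) i \<in> A)"
      by (rule face_segment_measurable) auto
    then have "Measurable.pred M (\<lambda>\<omega>. face_segment (walk_of (\<xi> \<omega>)) i \<in> A)"
      by (rule measurable_compose[OF \<xi>_meas])
    then show "{\<omega> \<in> space M. face_segment (walk X \<omega>) i \<in> A} \<in> sets M" by (simp add: pred_def walk)
  next
    show "has_void_functional M \<nu> (\<lambda>i \<omega>. face_segment (walk X \<omega>) i)"
      unfolding has_void_functional_def
    proof (intro allI impI)
      fix h :: "real list \<Rightarrow> real" assume "h \<in> borel_measurable \<nu> \<and> (\<forall>z. 0 \<le> h z \<and> h z \<le> 1)"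
      then have h_meas [measurable]: "h \<in> borel_measurable segment_space" and h: "\<And>z. 0 \<le> h z \<and> h z \<le> 1"
        by (auto simp: \<nu>_def)
      let ?p = "\<lambda>K x. \<Prod>i<K. h (face_segment (walk_of x) i)"
      have p_meas [measurable]: "?p K \<in> borel_measurable S" for K
        by (intro borel_measurable_prod face_segment_measurable) auto
      have p: "0 \<le> ?p K x" "?p K x \<le> 1" for K x
        using h by (auto intro!: prod_nonneg prod_le_1)
      have "ennreal (\<integral>\<omega>. ?p K (\<xi> \<omega>) \<partial>M) = (\<integral>\<^sup>+x. (\<Prod>i<K. ennreal (h (face_segment (walk_of x) i))) \<partial>S)" for K
      proof -
        have "integrable M (\<lambda>\<omega>. ?p K (\<xi> \<omega>))"
          using p by (intro MP.integrable_const_bound[of _ 1]) auto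
        then have "ennreal (\<integral>\<omega>. ?p K (\<xi> \<omega>) \<partial>M) = (\<integral>\<^sup>+\<omega>. ennreal (?p K (\<xi> \<omega>)) \<partial>M)"
          using p by (intro nn_integral_eq_integral[symmetric]) auto
        also have "\<dots> = (\<integral>\<^sup>+x. ennreal (?p K x) \<partial>S)"
          by (rule transfer[of "\<lambda>x. ennreal (?p K x)"]) measurable
        finally show ?thesis using h by (simp add: prod_ennreal)
      qed
      moreover have "(\<integral>\<^sup>+z. ennreal (1 - h z) \<partial>\<nu>) =
          (\<integral>\<^sup>+z. (if \<mu> < ereal (slope z) then ennreal (1 - h z) else 0) \<partial>face_measure)"
      proof -
        have "(\<integral>\<^sup>+z. ennreal (1 - h z) \<partial>\<nu>) =
            (\<integral>\<^sup>+z. (if \<mu> < ereal (slope z) then 1 else 0) * ennreal (1 - h z) \<partial>face_measure)"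
          unfolding \<nu>_def by (rule nn_integral_density) measurable
        also have "\<dots> = (\<integral>\<^sup>+z. (if \<mu> < ereal (slope z) then ennreal (1 - h z) else 0) \<partial>face_measure)"
          by (intro nn_integral_cong) auto
        finally show ?thesis .
      qed
      ultimately have "(\<lambda>K. ennreal (\<integral>\<omega>. ?p K (\<xi> \<omega>) \<partial>M)) \<longlonglongrightarrow> ennreal (void_prob (\<integral>\<^sup>+z. ennreal (1 - h z) \<partial>\<nu>))"
        using void_functional[OF h_meas h] by simp
      then show "(\<lambda>K. \<integral>\<omega>. (\<Prod>i<K. h (face_segment (walk X \<omega>) i)) \<partial>M) \<longlonglongrightarrow> void_prob (\<integral>\<^sup>+z. ennreal (1 - h z) \<partial>\<nu>)"
        unfolding walk using p by (subst (asm) tendsto_ennreal_iff) (auto simp: void_prob_bounds intro!: integral_nonneg_AE)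
    qed
  qed
  moreover have "AE \<omega> in M. (\<exists>C. is_concave_majorant (walk X \<omega>) C) \<and>
      infinite (contact_times (walk X \<omega>)) \<and> contact_time (walk X \<omega>) 0 = 0"
    using reg
  proof eventually_elim
    case (elim \<omega>)
    obtain N where "dominated (\<xi> \<omega>) (walk_of (\<xi> \<omega>) N / N)" using first_face_exists[OF elim] .
    then have "\<exists>C. is_concave_majorant (walk_of (\<xi> \<omega>)) C"
      by (intro concave_majorant_exists[of _ 0 "walk_of (\<xi> \<omega>) N / N"]) (auto simp: dominated_iff)
    then show ?case using infinite_contact_times[OF elim] contact_time_0[OF elim] by (simp add: walk)
  qed
  ultimately show ?thesis unfolding intensity by blast
qed

end
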